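(* There exists $n_0$ such that for every integer $n\ge n_0$ divisible by $6$ the following holds. If $H$ is a $3$-graph on $n$ vertices with $\delta_2(H)\ge n/3$, then $H$ contains a $C_6^3$-factor.
   Context: A $3$-graph $H$ consists of a finite vertex set $V(H)$ and an edge set $E(H)\subseteq\binom{V(H)}{3}$. For a set $S$ of two vertices, $\deg_H(S)$ is the number of edges of $H$ containing $S$, and the minimum codegree $\delta_2(H)$ is the minimum of $\deg_H(S)$ over all $2$-element subsets $S\subseteq V(H)$. $C_6^3$ denotes the $3$-graph on vertex set $\{1,\dots,6\}$ with edges $\{1,2,3\},\{3,4,5\},\{5,6,1\}$. A $C_6^3$-factor of $H$ is a spanning subhypergraph of $H$ consisting of $|V(H)|/6$ pairwise vertex-disjoint copies of $C_6^3$. *)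

theory Defs
  imports Complex_Main "HOL-Library.Ramsey" "HOL-Library.Disjoint_Sets"
begin

datatype 'a hypergraph = Hypergraph (verts: "'a set") (edges: "'a set set")

text \<open>Here \<open>nsets A k\<close> is the set of all \<open>k\<close>-element subsets of \<open>A\<close>.\<close>

definition three_graph :: "'a hypergraph \<Rightarrow> bool" where
  "three_graph H \<longleftrightarrow> finite (verts H) \<and> edges H \<subseteq> nsets (verts H) 3"

definition codegree :: "'a hypergraph \<Rightarrow> 'a set \<Rightarrow> nat" where
  "codegree H S = card {e \<in> edges H. S \<subseteq> e}"

text \<open>Only meaningful on at least two vertices; below that, \<open>Min\<close> is taken over the empty set.\<close>

definition min_codegree :: "'a hypergraph \<Rightarrow> nat" where
  "min_codegree H = Min (codegree H ` nsets (verts H) 2)"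

definition C63 :: "nat hypergraph" where
  "C63 = Hypergraph {1..6} {{1, 2, 3}, {3, 4, 5}, {5, 6, 1}}"

definition subhypergraph :: "'a hypergraph \<Rightarrow> 'a hypergraph \<Rightarrow> bool" where
  "subhypergraph G H \<longleftrightarrow> three_graph G \<and> verts G \<subseteq> verts H \<and> edges G \<subseteq> edges H"

definition hypergraph_iso :: "'a hypergraph \<Rightarrow> 'b hypergraph \<Rightarrow> bool" where
  "hypergraph_iso F G \<longleftrightarrow>
    (\<exists>f. bij_betw f (verts F) (verts G) \<and> edges G = (\<lambda>e. f ` e) ` edges F)"

text \<open>\<open>G\<close> is an \<open>F\<close>-factor of \<open>H\<close>, with \<open>\<K>\<close> the set of the
  \<open>card (verts H) / card (verts F)\<close> copies of \<open>F\<close> that make up \<open>G\<close>. The copies need not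
  be induced in \<open>H\<close>.\<close>

definition is_factor :: "'b hypergraph \<Rightarrow> 'a hypergraph \<Rightarrow> 'a hypergraph \<Rightarrow> bool" where
  "is_factor F H G \<longleftrightarrow>
    subhypergraph G H \<and> verts G = verts H \<and>
    (\<exists>\<K>. finite \<K> \<and> card \<K> * card (verts F) = card (verts H) \<and>
      (\<forall>K\<in>\<K>. hypergraph_iso F K) \<and> disjoint_family_on verts \<K> \<and>
      verts G = (\<Union>K\<in>\<K>. verts K) \<and> edges G = (\<Union>K\<in>\<K>. edges K))"

end

(*
  Any three vertices a, b, c can be the corners of a tile (a copy of C_6^3), the other three vertices
  being chosen in the neighbourhoods N a b, N b c, N c a.

  Absorption. For any u and v, Cauchy-Schwarz shows that for a positive proportion of all 11-sets R both
  R + u and R + v split into two tiles. Hence every 6-set has many absorbers,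
  and a greedy choice controlled by a potential function yields a small absorbing set.

  Fractional tilings. Let w be a weight function on which every tile weighs at least 1 and suppose that
  two vertices p, q (and a few more) have weight about 0. If b and b' lie in N p q, then p, q, b are the
  corners of a tile with b' on p q and weightless vertices on the other two edges, so w b + w b' >= 1.
  Thus essentially all of N p q has weight at least 1/2, which gives total weight n/6 as |N p q| >= n/3.
  If |N p q| is only a little smaller than n/3, the missing weight must sit on the complement of N p q,
  and edges inside this complement would produce a tile that is too light.

  Almost perfect tilings. Repeatedly removing a tile that is light for the weights given by an
  exponential potential keeps all relevant sets proportional, so the preceding argument applies to the
  rest again and again until o(n) vertices are left; these are absorbed.

  Extremal case. Otherwise the complement of some N p q spans almost no edges. Then after fixing the
  balance 1 : 2 of the two parts and covering the atypical vertices, the rest is perfectly tiled by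
  maximising the number of tiles in a partition into 6-sets: a bad 6-set can be mixed with six random
  other ones in such a way that no two vertices of a 6-set stay together.
*)
theory Submission
  imports Defs "HOL-Analysis.Convex" "HOL-Real_Asymp.Real_Asymp"
begin

section \<open>Tiles and tileable sets\<close>

text \<open>The bound n/3 is sharp: let A have fewer than n/3 vertices and take all triples that
  meet A. Pairs outside A have codegree |A|, but no vertex lies in all three edges of a tile, so
  each tile needs two vertices of A. This is the origin of the balance 1 : 2, and it is why the
  weight argument has no slack: for |A| = n/3, weight 1/2 on A gives every tile weight at least 1
  and has total exactly n/6. After some tiles have been removed, the relative codegree may have
  dropped by some small g below 1/3, and the loss must be recovered from edges in the complement of
  N p q. The greedy process controls only sizes of vertex sets, not numbers of edges; hence density
  is expressed by \<open>dense_in\<close>. No fractional tiling is ever constructed. The potential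
  itself supplies the weights: it penalises tracked sets whose proportion has fallen, and a tile
  that is light for these weights takes few vertices from them. This replaces linear programming
  duality by a multiplicative weights argument.\<close>

lemma sum_card_swap:
  assumes "finite A" "finite B"
  shows "(\<Sum>x\<in>A. card {y\<in>B. P x y}) = (\<Sum>y\<in>B. card {x\<in>A. P x y})"
  using sum_multicount_gen[OF assms, of P "\<lambda>y. card {x\<in>A. P x y}"] by simp

lemma card_gt_imp_ex_notin:
  assumes "card A > card B" "finite B"
  shows "\<exists>x\<in>A. x \<notin> B"
  using assms card_mono[of B A] by (meson leD subsetI)

lemma ex_notin_list:
  assumes "length xs < card A"
  shows "\<exists>x\<in>A. x \<notin> set xs"
  using card_gt_imp_ex_notin[of "set xs" A] assms card_length[of xs] by auto

lemma card_minus: "finite X \<Longrightarrow> card (X - R) + card (R \<inter> X) = card X"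
  using card_Int_Diff[of X R] by (simp add: Int_commute)

locale three_uniform =
  fixes V :: "'a set" and E :: "'a set set"
  assumes finite_V: "finite V" and edges_nsets: "E \<subseteq> nsets V 3"
begin

definition N :: "'a \<Rightarrow> 'a \<Rightarrow> 'a set" where
  "N a b = {x. {a, b, x} \<in> E}"

definition tile :: "'a set \<Rightarrow> bool" where
  "tile T \<longleftrightarrow> (\<exists>a b c x y z. distinct [a, b, c, x, y, z] \<and> T = {a, b, c, x, y, z} \<and>
     {a, b, x} \<in> E \<and> {b, c, y} \<in> E \<and> {c, a, z} \<in> E)"

inductive tileable :: "'a set \<Rightarrow> bool" where
  tileable_empty: "tileable {}"
| tileable_insert: "tileable U \<Longrightarrow> tile T \<Longrightarrow> T \<inter> U = {} \<Longrightarrow> tileable (T \<union> U)"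

lemma edge_card: "e \<in> E \<Longrightarrow> card e = 3" and edge_subset: "e \<in> E \<Longrightarrow> e \<subseteq> V"
  using edges_nsets by (auto simp: nsets_def)

lemma edgeD:
  assumes "{a, b, c} \<in> E"
  shows "a \<in> V" "b \<in> V" "c \<in> V" "a \<noteq> b" "a \<noteq> c" "b \<noteq> c"
proof -
  show "a \<in> V" "b \<in> V" "c \<in> V" using edge_subset[OF assms] by auto
  have "card {a, b, c} = 3" using edge_card[OF assms] .
  then show "a \<noteq> b" "a \<noteq> c" "b \<noteq> c" by (auto simp: card_insert_if split: if_splits)
qed

lemma N_subset: "N a b \<subseteq> V"
  using edgeD by (auto simp: N_def)

lemma N_memD: "x \<in> N a b \<Longrightarrow> x \<in> V" using N_subset by blast

lemma finite_N: "finite (N a b)"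
  using N_subset finite_V finite_subset by blast

lemma tileI:
  assumes "distinct [a, b, c, x, y, z]" "{a, b, x} \<in> E" "{b, c, y} \<in> E" "{c, a, z} \<in> E"
  shows "tile {a, b, c, x, y, z}"
  using assms unfolding tile_def by blast

lemma tile_card: "tile T \<Longrightarrow> card T = 6"
  by (auto simp: tile_def)

lemma tile_finite: "tile T \<Longrightarrow> finite T"
  by (auto simp: tile_def)

lemma tile_subset: "tile T \<Longrightarrow> T \<subseteq> V"
  unfolding tile_def using edgeD by blast

lemma tileable_tile: "tile T \<Longrightarrow> tileable T"
  using tileable_insert[OF tileable_empty, of T] by simp

lemma tileable_finite: "tileable U \<Longrightarrow> finite U"
  by (induction rule: tileable.induct) (auto simp: tile_finite)

lemma tileable_subset: "tileable U \<Longrightarrow> U \<subseteq> V"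
  by (induction rule: tileable.induct) (auto dest: tile_subset)

lemma tileable_card: "tileable U \<Longrightarrow> 6 dvd card U"
proof (induction rule: tileable.induct)
  case (tileable_insert U T)
  then show ?case
    by (simp add: card_Un_disjoint tile_finite tileable_finite tile_card)
qed simp

lemma tileable_Un:
  assumes "tileable A" "tileable B" "A \<inter> B = {}"
  shows "tileable (A \<union> B)"
  using assms
proof (induction rule: tileable.induct)
  case (tileable_insert U T)
  then have "tileable (U \<union> B)" by blast
  moreover have "T \<inter> (U \<union> B) = {}" using tileable_insert by blast
  ultimately have "tileable (T \<union> (U \<union> B))" using tileable.tileable_insert tileable_insert.hyps(2) by blast
  then show ?case by (simp add: Un_assoc)
qed simp

lemma tileable_UN:
  assumes "finite I" "\<And>i. i \<in> I \<Longrightarrow> tileable (f i)" "disjoint_family_on f I"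
  shows "tileable (\<Union>i\<in>I. f i)"
  using assms
proof (induction I rule: finite_induct)
  case empty
  then show ?case by (simp add: tileable_empty)
next
  case (insert i I)
  have "f i \<inter> (\<Union>j\<in>I. f j) = {}"
    using insert by (auto simp: disjoint_family_on_def)
  moreover have "tileable (\<Union>j\<in>I. f j)"
    using insert by (auto simp: disjoint_family_on_def)
  ultimately show ?case using insert by (auto intro: tileable_Un)
qed

lemma tileable_partition:
  assumes "tileable U"
  shows "\<exists>\<T>. finite \<T> \<and> (\<forall>T\<in>\<T>. tile T) \<and> disjoint \<T> \<and> \<Union>\<T> = U"
  using assms
proof (induction rule: tileable.induct)
  case tileable_empty
  then show ?case by (intro exI[of _ "{}"]) auto
next
  case (tileable_insert U T)
  then obtain \<T> where \<T>: "finite \<T>" "\<forall>T\<in>\<T>. tile T" "disjoint \<T>" "\<Union>\<T> = U" by blast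
  show ?case
  proof (intro exI[of _ "insert T \<T>"] conjI)
    show "disjoint (insert T \<T>)"
      using \<T> tileable_insert.hyps by (auto simp: disjoint_def)
  qed (use \<T> tileable_insert.hyps in auto)
qed

lemma tile_iso:
  assumes "tile T"
  shows "\<exists>F \<subseteq> E. (\<forall>e\<in>F. e \<subseteq> T) \<and> hypergraph_iso C63 (Hypergraph T F)"
proof -
  obtain a b c x y z where d: "distinct [a, b, c, x, y, z]" and T: "T = {a, b, c, x, y, z}"
    and e: "{a, b, x} \<in> E" "{b, c, y} \<in> E" "{c, a, z} \<in> E"
    using assms unfolding tile_def by blast
  \<comment> \<open>\<open>C63\<close> has corners 1, 3 and 5, so corners and outer vertices of the
    tile alternate in the list.\<close>
  define f where "f = (\<lambda>i::nat. [a, x, b, y, c, z] ! (i - 1))"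
  have I: "{1..6} = {1, 2, 3, 4, 5, 6::nat}" by auto
  have f: "f 1 = a" "f (Suc 0) = a" "f 2 = x" "f 3 = b" "f 4 = y" "f 5 = c" "f 6 = z"
    by (simp_all add: f_def)
  have "bij_betw f {1..6} T"
    using d f unfolding bij_betw_def I T by (auto simp: inj_on_def)
  moreover have "{{a, b, x}, {b, c, y}, {c, a, z}} = (\<lambda>e. f ` e) ` {{1, 2, 3}, {3, 4, 5}, {5, 6, 1}}"
    using f by (auto simp: insert_commute)
  ultimately have "hypergraph_iso C63 (Hypergraph T {{a, b, x}, {b, c, y}, {c, a, z}})"
    unfolding hypergraph_iso_def C63_def by auto
  then show ?thesis
    using e T by (intro exI[of _ "{{a, b, x}, {b, c, y}, {c, a, z}}"]) auto
qed

lemma tileable_imp_factor: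
  assumes "tileable V"
  shows "\<exists>G. is_factor C63 (Hypergraph V E) G"
proof -
  obtain \<T> where \<T>: "finite \<T>" "\<forall>T\<in>\<T>. tile T" "disjoint \<T>" "\<Union>\<T> = V"
    using tileable_partition[OF assms] by blast
  have "\<forall>T\<in>\<T>. \<exists>F \<subseteq> E. (\<forall>e\<in>F. e \<subseteq> T) \<and> hypergraph_iso C63 (Hypergraph T F)"
    using \<T>(2) tile_iso by blast
  then obtain F where F: "\<And>T. T \<in> \<T> \<Longrightarrow> F T \<subseteq> E \<and> hypergraph_iso C63 (Hypergraph T (F T))"
    by metis
  define \<K> where "\<K> = (\<lambda>T. Hypergraph T (F T)) ` \<T>"
  have inj: "inj_on (\<lambda>T. Hypergraph T (F T)) \<T>" by (auto simp: inj_on_def)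
  have "card V = (\<Sum>T\<in>\<T>. card T)"
    using card_Union_disjoint[of \<T>] \<T> tile_finite by (auto simp: disjoint_def pairwise_def disjnt_def)
  also have "\<dots> = card \<T> * 6" using \<T>(2) tile_card by simp
  finally have c: "card \<K> * 6 = card V" using card_image[OF inj] by (simp add: \<K>_def)
  have "is_factor C63 (Hypergraph V E) (Hypergraph V (\<Union>T\<in>\<T>. F T))"
    unfolding is_factor_def
  proof (intro conjI exI[of _ \<K>])
    show "subhypergraph (Hypergraph V (\<Union>T\<in>\<T>. F T)) (Hypergraph V E)"
      using F edges_nsets finite_V by (auto simp: subhypergraph_def three_graph_def; blast)
    show "card \<K> * card (verts C63) = card (verts (Hypergraph V E))"
      using c by (simp add: C63_def)
    show "\<forall>K\<in>\<K>. hypergraph_iso C63 K" using F by (auto simp: \<K>_def)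
    show "disjoint_family_on verts \<K>"
      using \<T>(3) by (auto simp: \<K>_def disjoint_family_on_def disjoint_def)
  qed (use \<T> in \<open>auto simp: \<K>_def\<close>)
  then show ?thesis by blast
qed

end

section \<open>Light tiles\<close>

lemma card_mult_le_sum:
  fixes w :: "'a \<Rightarrow> real"
  assumes "finite U" "\<And>v. v \<in> U \<Longrightarrow> 0 \<le> w v"
  shows "t * card {v \<in> U. t < w v} \<le> sum w U"
proof -
  have "t * card {v \<in> U. t < w v} = (\<Sum>v\<in>{v \<in> U. t < w v}. t)" by simp
  also have "\<dots> \<le> (\<Sum>v\<in>{v \<in> U. t < w v}. w v)" by (rule sum_mono) auto
  also have "\<dots> \<le> sum w U" by (rule sum_mono2) (use assms in auto)
  finally show ?thesis .
qed

lemma lowest_subset: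
  fixes c :: "'a \<Rightarrow> real"
  assumes "finite U" "K \<le> card U"
  shows "\<exists>Z\<subseteq>U. card Z = K \<and> (\<forall>z\<in>Z. \<forall>v\<in>U - Z. c z \<le> c v)"
  using assms(2)
proof (induction K)
  case 0
  then show ?case by (intro exI[of _ "{}"]) auto
next
  case (Suc K)
  then obtain Z where Z: "Z \<subseteq> U" "card Z = K" "\<forall>z\<in>Z. \<forall>v\<in>U - Z. c z \<le> c v" by auto
  have "U - Z \<noteq> {}" using Z Suc.prems card_mono[of Z U] assms(1) finite_subset[OF Z(1)] by force
  then obtain u where u: "u \<in> U - Z" "\<forall>v\<in>U - Z. c u \<le> c v"
    using assms(1) arg_min_if_finite[of "U - Z" c] by (metis finite_Diff not_less)
  show ?case
    using Z u finite_subset[OF Z(1) assms(1)] by (intro exI[of _ "insert u Z"]) auto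
qed

context three_uniform begin

text \<open>A robust form of the statement that \<open>D\<close> spans many edges. Unlike an edge count it only
  speaks about the sizes of sets of vertices, so it survives the removal of tiles as soon as polynomially
  many sets stay proportional.\<close>

definition dense_in :: "'a set \<Rightarrow> real \<Rightarrow> bool" where
  "dense_in D t \<longleftrightarrow> (\<exists>X\<subseteq>D. t \<le> card X \<and> (\<forall>x\<in>X. \<exists>Y\<subseteq>D. t \<le> card Y \<and>
      (\<forall>y\<in>Y. t \<le> card (N x y \<inter> D))))"

text \<open>For fixed \<open>b\<close> the pairs \<open>p\<close>, \<open>q\<close> with
  \<open>{p, q, b} \<in> E\<close> form a graph on \<open>Z\<close>. An edge of it whose ends both
  have degree at least 3 extends to a path x, p, q, y, so a bad pair has an end of degree at most 2,
  and there are at most \<open>4 * K\<close> such ordered pairs. Averaging over all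
  \<open>K * (K - 1)\<close> ordered pairs yields one that is bad for few \<open>b\<close>.\<close>

lemma exists_pair_few_bad:
  fixes g :: real
  assumes "finite U" "Z \<subseteq> U" "card Z = K" "4 * card U < (K - 1) * (g * card U - 1)" "2 \<le> K"
  defines "bad \<equiv> \<lambda>p q b. \<not> (\<exists>x\<in>Z. \<exists>y\<in>Z. distinct [p, q, x, y] \<and> {p, x, b} \<in> E \<and> {q, y, b} \<in> E)"
  shows "\<exists>p\<in>Z. \<exists>q\<in>Z. p \<noteq> q \<and> card {b \<in> N p q \<inter> U. bad p q b} \<le> g * card U - 1"
proof (rule ccontr)
  assume "\<not> ?thesis"
  then have many: "g * card U - 1 < card {b \<in> N p q \<inter> U. bad p q b}" if "p \<in> Z" "q \<in> Z" "p \<noteq> q" for p q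
    using that by force
  have fZ: "finite Z" using assms finite_subset by blast
  define P where "P = (SIGMA p:Z. Z - {p})"
  have fP: "finite P" using fZ by (simp add: P_def)
  have "card P = (\<Sum>p\<in>Z. card (Z - {p}))" unfolding P_def using fZ by (simp add: card_SigmaI)
  also have "\<dots> = K * (K - 1)" using fZ assms(3) by simp
  finally have cP: "card P = K * (K - 1)" .
  define B where "B = (\<lambda>r b. b \<in> N (fst r) (snd r) \<and> bad (fst r) (snd r) b)"
  have few: "card {r \<in> P. B r b} \<le> 4 * K" for b
  proof -
    define nb where "nb = (\<lambda>p. {q \<in> Z. {p, q, b} \<in> E})"
    define L where "L = {p \<in> Z. card (nb p) \<le> 2}"
    have fnb: "finite (nb p)" for p using fZ by (simp add: nb_def)
    have "p \<in> L \<or> q \<in> L" if "p \<in> Z" "q \<in> Z" "p \<noteq> q" "bad p q b" for p q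
    proof (rule ccontr)
      assume "\<not> ?thesis"
      then have "card (nb p) \<ge> 3" "card (nb q) \<ge> 3" using that by (auto simp: L_def)
      then obtain x where x: "x \<in> nb p" "x \<noteq> q" "x \<noteq> p"
        using ex_notin_list[of "[p, q]" "nb p"] by auto
      obtain y where y: "y \<in> nb q" "y \<notin> {p, x}"
        using ex_notin_list[of "[p, x]" "nb q"] \<open>card (nb q) \<ge> 3\<close> by auto
      have "y \<noteq> q" using y(1) edgeD(4)[of q y b] by (auto simp: nb_def)
      then have "distinct [p, q, x, y]" using x y that by auto
      then show False using that(4) x y unfolding bad_def nb_def by blast
    qed
    then have "{r \<in> P. B r b} \<subseteq> (SIGMA p:L. nb p) \<union> prod.swap ` (SIGMA p:L. nb p)"
      by (force simp: P_def B_def nb_def N_def image_iff insert_commute)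
    moreover have fin: "finite (SIGMA p:L. nb p)" using fZ fnb by (auto simp: L_def)
    ultimately have "card {r \<in> P. B r b} \<le> card ((SIGMA p:L. nb p) \<union> prod.swap ` (SIGMA p:L. nb p))"
      by (intro card_mono) auto
    also have "\<dots> \<le> card (SIGMA p:L. nb p) + card (prod.swap ` (SIGMA p:L. nb p))" by (rule card_Un_le)
    also have "\<dots> \<le> card (SIGMA p:L. nb p) + card (SIGMA p:L. nb p)"
      using card_image_le[OF fin] by simp
    also have "card (SIGMA p:L. nb p) = (\<Sum>p\<in>L. card (nb p))"
      using fZ fnb by (intro card_SigmaI) (auto simp: L_def)
    also have "\<dots> \<le> card L * 2" using sum_bounded_above[of L "\<lambda>p. card (nb p)" 2] by (auto simp: L_def)
    also have "card L \<le> K" using fZ assms(3) by (auto simp: L_def intro!: card_mono)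
    finally show ?thesis by simp
  qed
  have "real (K * (K - 1)) * (g * card U - 1) = (\<Sum>r\<in>P. g * card U - 1)" using cP by simp
  also have "\<dots> \<le> (\<Sum>r\<in>P. real (card {b \<in> U. B r b}))"
  proof (rule sum_mono)
    fix r assume "r \<in> P"
    then have "g * card U - 1 < card {b \<in> N (fst r) (snd r) \<inter> U. bad (fst r) (snd r) b}"
      by (intro many) (auto simp: P_def)
    also have "{b \<in> N (fst r) (snd r) \<inter> U. bad (fst r) (snd r) b} = {b \<in> U. B r b}" by (auto simp: B_def)
    finally show "g * card U - 1 \<le> card {b \<in> U. B r b}" by simp
  qed
  also have "\<dots> = real (\<Sum>r\<in>P. card {b \<in> U. B r b})" by simp
  also have "\<dots> = real (\<Sum>b\<in>U. card {r \<in> P. B r b})"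
    using sum_card_swap[OF fP assms(1), of B] by simp
  also have "\<dots> \<le> real (\<Sum>b\<in>U. 4 * K)" by (intro of_nat_mono sum_mono few)
  also have "\<dots> = K * (4 * real (card U))" by simp
  finally have "real K * ((K - 1) * (g * card U - 1)) \<le> K * (4 * real (card U))" by (simp add: mult.assoc)
  then have "(K - 1) * (g * card U - 1) \<le> 4 * real (card U)" using \<open>2 \<le> K\<close> by simp
  then show False using assms(4,5) by (simp add: of_nat_diff)
qed

lemma light_tile_normalized:
  fixes w :: "'a \<Rightarrow> real" and g r :: real
  assumes U: "U \<subseteq> V" and Z: "Z \<subseteq> U" "card Z = K" "2 \<le> K"
    and K: "4 * card U < (K - 1) * (g * card U - 1)" "K \<le> g * card U"
    and g: "g \<le> 1/100" "100 \<le> card U" and r: "30 * g * card U + 5 \<le> r * card U"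
    and w: "\<And>v. v \<in> U \<Longrightarrow> 0 \<le> w v" "\<And>v. v \<in> Z \<Longrightarrow> w v = 0" "sum w U < card U / 6"
    and codeg: "\<And>a b. a \<in> U \<Longrightarrow> b \<in> U \<Longrightarrow> a \<noteq> b \<Longrightarrow> (1/3 - g) * card U \<le> card (N a b \<inter> U)"
    and rich: "\<And>a b. a \<in> U \<Longrightarrow> b \<in> U \<Longrightarrow> a \<noteq> b \<Longrightarrow> card (N a b \<inter> U) \<le> (1/3 + 2 * g) * card U
       \<Longrightarrow> dense_in (U - N a b) (r * card U)"
  shows "\<exists>T. tile T \<and> T \<subseteq> U \<and> sum w T < 1"
proof (rule ccontr)
  assume "\<not> ?thesis"
  then have ge1: "1 \<le> sum w T" if "tile T" "T \<subseteq> U" for T using that by (meson not_less)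
  have fU: "finite U" using U finite_V finite_subset by blast
  have fZ: "finite Z" using Z fU finite_subset by blast
  obtain p q where pq: "p \<in> Z" "q \<in> Z" "p \<noteq> q"
    and few: "card {b \<in> N p q \<inter> U. \<not> (\<exists>x\<in>Z. \<exists>y\<in>Z. distinct [p, q, x, y] \<and> {p, x, b} \<in> E \<and> {q, y, b} \<in> E)}
       \<le> g * card U - 1"
    using exists_pair_few_bad[OF fU Z(1,2) K(1) Z(3)] by blast
  define J where "J = {b \<in> N p q \<inter> U. \<not> (\<exists>x\<in>Z. \<exists>y\<in>Z. distinct [p, q, x, y] \<and> {p, x, b} \<in> E \<and> {q, y, b} \<in> E)}"
  define S where "S = N p q \<inter> U - J - Z"
  have fS: "finite S" "S \<subseteq> U" "S \<subseteq> N p q" using fU by (auto simp: S_def)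
  have pair: "1 \<le> w b + w b'" if "b \<in> S" "b' \<in> S" "b \<noteq> b'" for b b'
  proof -
    obtain x y where xy: "x \<in> Z" "y \<in> Z" "distinct [p, q, x, y]" "{p, x, b} \<in> E" "{q, y, b} \<in> E"
      using \<open>b \<in> S\<close> by (auto simp: S_def J_def)
    have e: "{p, q, b'} \<in> E" using \<open>b' \<in> S\<close> by (auto simp: S_def N_def)
    have d: "distinct [p, q, b, b', y, x]"
      using xy edgeD[OF xy(4)] edgeD[OF xy(5)] edgeD[OF e] that by (auto simp: S_def)
    have "tile {p, q, b, b', y, x}"
      by (rule tileI[OF d]) (use e xy in \<open>auto simp: insert_commute\<close>)
    moreover have "{p, q, b, b', y, x} \<subseteq> U" using pq xy that fS Z by auto
    ultimately have "1 \<le> sum w {p, q, b, b', y, x}" by (rule ge1)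
    also have "\<dots> = w p + w q + w b + w b' + w y + w x" using d by simp
    also have "\<dots> = w b + w b'" using w(2)[OF pq(1)] w(2)[OF pq(2)] w(2)[OF xy(1)] w(2)[OF xy(2)] by simp
    finally show ?thesis .
  qed
  define S' where "S' = {b \<in> S. 1/2 \<le> w b}"
  have "card (S - S') \<le> 1"
  proof (rule ccontr)
    assume "\<not> card (S - S') \<le> 1"
    then obtain b b' where "b \<in> S - S'" "b' \<in> S - S'" "b \<noteq> b'"
      using card_le_Suc0_iff_eq[of "S - S'"] fS by auto
    then show False using pair[of b b'] by (auto simp: S'_def)
  qed
  moreover have "card S = card S' + card (S - S')"
    using card_Int_Diff[OF fS(1), of S'] by (simp add: S'_def Int_def conj_ac)
  ultimately have cS': "real (card S) \<le> card S' + 1" by simp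
  have "card (N p q \<inter> U) \<le> card (S \<union> J \<union> Z)"
    using fS fZ fU by (intro card_mono) (auto simp: S_def J_def)
  also have "\<dots> \<le> card S + card J + card Z" by (meson add_mono card_Un_le le_refl le_trans)
  \<comment> \<open>The bound on \<open>J\<close> is \<open>g * card U - 1\<close>, \<open>Z\<close>
    has at most \<open>g * card U\<close> vertices, and the 1 saved in the first bound pays for the
    one vertex of \<open>S\<close> that may be light.\<close>
  finally have cN: "real (card (N p q \<inter> U)) \<le> card S' + 2 * g * card U"
    using cS' few K Z unfolding J_def by linarith
  have "real (card S') / 2 = (\<Sum>b\<in>S'. 1/2)" by simp
  also have "\<dots> \<le> sum w S'" by (rule sum_mono) (simp add: S'_def)
  also have "\<dots> \<le> sum w (N p q \<inter> U)"
    by (rule sum_mono2) (use fU w fS in \<open>auto simp: S'_def\<close>)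
  finally have heavy: "(card (N p q \<inter> U) - 2 * g * card U) / 2 \<le> sum w (N p q \<inter> U)" using cN by (simp add: field_simps)
  define D where "D = U - N p q"
  have fD: "finite D" "D \<subseteq> U" using fU by (auto simp: D_def)
  have split: "sum w U = sum w (N p q \<inter> U) + sum w D"
    using sum.Int_Diff[OF fU, of w "N p q"] by (simp add: D_def Int_commute)
  have "0 \<le> sum w D" by (rule sum_nonneg) (use fD w in auto)
  then have small: "card (N p q \<inter> U) \<le> (1/3 + 2 * g) * card U"
    using heavy split w(3) by (simp add: field_simps)
  have "p \<in> U" "q \<in> U" using pq Z by auto
  then have "dense_in D (r * card U)" unfolding D_def using rich pq small by blast
  then obtain X where X: "X \<subseteq> D" "r * card U \<le> card X"
    and XY: "\<And>x. x \<in> X \<Longrightarrow> \<exists>Y\<subseteq>D. r * card U \<le> card Y \<and> (\<forall>y\<in>Y. r * card U \<le> card (N x y \<inter> D))"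
    unfolding dense_in_def by blast
  have "(1/3 - g) * card U \<le> card (N p q \<inter> U)" using codeg pq Z by auto
  \<comment> \<open>The neighbourhood carries at least \<open>(1/3 - 3 * g) / 2 * card U\<close>,
    which leaves at most \<open>3/2 * g * card U\<close> of the total
    \<open>card U / 6\<close>.\<close>
  then have wD: "sum w D \<le> 3/2 * g * card U"
    using heavy split w(3) by (simp add: field_simps)
  define H where "H = {v \<in> D. 1/20 < w v}"
  have "1/20 * real (card H) \<le> sum w D" unfolding H_def
    by (rule card_mult_le_sum[OF fD(1)]) (use w fD in auto)
  then have cH: "real (card H) \<le> 30 * g * card U" using wD by linarith
  have fH: "finite H" using fD by (simp add: H_def)
  \<comment> \<open>The proportion \<open>r\<close> exceeds that of the heavy vertices, with 5
    vertices to spare for those already chosen.\<close>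
  have exists_notin: "\<exists>x\<in>A. x \<notin> H \<and> x \<notin> set xs" if "r * card U \<le> card A" "length xs \<le> 4" for A xs
  proof -
    have "card (H \<union> set xs) \<le> card H + length xs"
      using card_Un_le[of H "set xs"] card_length[of xs] by linarith
    then have "real (card (H \<union> set xs)) < card A" using that cH r by linarith
    then show ?thesis using card_gt_imp_ex_notin[of "H \<union> set xs" A] fH by auto
  qed
  obtain b1 where b1: "b1 \<in> X" "b1 \<notin> H" using exists_notin[of X "[]"] X by auto
  obtain Y where Y: "Y \<subseteq> D" "r * card U \<le> card Y" "\<And>y. y \<in> Y \<Longrightarrow> r * card U \<le> card (N b1 y \<inter> D)"
    using XY[OF b1(1)] by blast
  obtain b2 where b2: "b2 \<in> Y" "b2 \<notin> H" using exists_notin[of Y "[]"] Y by auto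
  obtain b3 where b3: "b3 \<in> N b1 b2" "b3 \<in> D" "b3 \<notin> H" using exists_notin[of "N b1 b2 \<inter> D" "[]"] Y b2 by auto
  obtain c where c: "c \<in> Y" "c \<notin> H" "c \<notin> {b2, b3}" 
    using exists_notin[of Y "[b2, b3]"] Y by auto
  obtain d where d: "d \<in> N b1 c" "d \<in> D" "d \<notin> H" "d \<notin> {b2, b3}"
    using exists_notin[of "N b1 c \<inter> D" "[b2, b3]"] Y(3)[OF c(1)] by auto
  \<comment> \<open>\<open>dense_in\<close> supplies outer vertices in \<open>D\<close> for the two
    pairs at \<open>b1\<close>; for the pair \<open>b2\<close>, \<open>c\<close> only the codegree
    is available. The five vertices from \<open>D - H\<close> weigh at most 1/20 each, so the sixth
    may weigh up to 3/5. Less than 5/18 of \<open>U\<close> is heavier than that, and this is below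
    the proportion \<open>1/3 - g\<close>.\<close>
  define Q where "Q = {v \<in> U. 3/5 < w v}"
  have "3/5 * real (card Q) \<le> sum w U" unfolding Q_def by (rule card_mult_le_sum[OF fU]) (use w in auto)
  then have "real (card Q) < 5/18 * card U" using w(3) by linarith
  moreover have "card (Q \<union> {b1, b3, d}) \<le> card Q + 3"
    using card_Un_le[of Q "{b1, b3, d}"] by (auto simp: card_insert_if split: if_splits)
  moreover have "g * card U \<le> 1/100 * card U" by (rule mult_right_mono) (use g in auto)
  moreover have "(1/3 - g) * card U = card U / 3 - g * card U" by (simp add: algebra_simps)
  moreover have "100 \<le> real (card U)" using g by simp
  ultimately have "real (card (Q \<union> {b1, b3, d})) < (1/3 - g) * card U" by linarith
  also have "\<dots> \<le> card (N b2 c \<inter> U)" using codeg[of b2 c] b2 c Y fD by auto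
  finally obtain z where z: "z \<in> N b2 c" "z \<in> U" "z \<notin> Q" "z \<notin> {b1, b3, d}"
    using card_gt_imp_ex_notin[of "Q \<union> {b1, b3, d}" "N b2 c \<inter> U"] fU by (auto simp: Q_def)
  have e: "{b1, b2, b3} \<in> E" "{b1, c, d} \<in> E" "{b2, c, z} \<in> E" using b3 d z by (auto simp: N_def)
  have dist: "distinct [b1, b2, c, b3, z, d]"
    using edgeD[OF e(1)] edgeD[OF e(2)] edgeD[OF e(3)] c d z by auto
  have "tile {b1, b2, c, b3, z, d}"
    by (rule tileI[OF dist]) (use e in \<open>auto simp: insert_commute\<close>)
  moreover have "{b1, b2, c, b3, z, d} \<subseteq> U" using b1 b2 b3 c d z X Y fD by auto
  ultimately have "1 \<le> sum w {b1, b2, c, b3, z, d}" by (rule ge1)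
  also have "\<dots> = w b1 + w b2 + w c + w b3 + w z + w d" using dist by simp
  also have "\<dots> \<le> 1/20 + 1/20 + 1/20 + 1/20 + 3/5 + 1/20"
    by (intro add_mono) (use b1 b2 b3 c d z X Y fD in \<open>auto simp: H_def Q_def not_less\<close>)
  finally show False by simp
qed

text \<open>Subtracting the \<open>K\<close>-th smallest weight reduces this to the case of \<open>K\<close> weightless vertices.\<close>

lemma light_tile:
  fixes c :: "'a \<Rightarrow> real" and g r del :: real and K :: nat
  assumes U: "U \<subseteq> V"
    and par: "0 < g" "g \<le> 1/100" "40 * g \<le> r" "0 < del"
    and K: "2 \<le> K" "8 \<le> g * (real K - 1)" "K \<le> g * card U" "100 \<le> card U"
      "5 \<le> 10 * g * card U" "6 * K < del * (real (card U) - K)"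
    and c: "\<And>v. v \<in> U \<Longrightarrow> 0 \<le> c v" "0 < sum c U"
    and codeg: "\<And>a b. a \<in> U \<Longrightarrow> b \<in> U \<Longrightarrow> a \<noteq> b \<Longrightarrow> (1/3 - g) * card U \<le> card (N a b \<inter> U)"
    and rich: "\<And>a b. a \<in> U \<Longrightarrow> b \<in> U \<Longrightarrow> a \<noteq> b \<Longrightarrow> card (N a b \<inter> U) \<le> (1/3 + 2 * g) * card U
       \<Longrightarrow> dense_in (U - N a b) (r * card U)"
  shows "\<exists>T. tile T \<and> T \<subseteq> U \<and> sum c T \<le> (6 + del) * sum c U / card U"
proof -
  define n where "n = real (card U)"
  define C where "C = sum c U"
  have fU: "finite U" using U finite_V finite_subset by blast
  have n: "100 \<le> n" "K \<le> g * n" "6 * K < del * (n - K)" using K by (auto simp: n_def)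
  have "g * n \<le> 1/100 * n" using n par by (intro mult_right_mono) auto
  then have Kn: "100 * K \<le> n" using n by linarith
  obtain Z where Z: "Z \<subseteq> U" "card Z = K" "\<And>z v. z \<in> Z \<Longrightarrow> v \<in> U - Z \<Longrightarrow> c z \<le> c v"
    using lowest_subset[OF fU, of K c] Kn unfolding n_def by auto
  have fZ: "finite Z" "Z \<noteq> {}" using Z K fU finite_subset by auto
  define t where "t = Max (c ` Z)"
  have t: "t \<in> c ` Z" "\<And>z. z \<in> Z \<Longrightarrow> c z \<le> t" using fZ by (auto simp: t_def)
  then have tv: "t \<le> c v" if "v \<in> U - Z" for v using Z(3) that by auto
  have t0: "0 \<le> t" using t(1) c Z by auto
  have cUZ: "real (card (U - Z)) = n - K"
    using Z fZ Kn card_mono[OF fU Z(1)] by (simp add: card_Diff_subset n_def of_nat_diff)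
  have CZ: "sum c (U - Z) \<le> C" unfolding C_def by (rule sum_mono2) (use fU c in auto)
  have "(n - K) * t = (\<Sum>v\<in>U - Z. t)" using cUZ by simp
  also have "\<dots> \<le> sum c (U - Z)" by (rule sum_mono) (use tv in auto)
  finally have tC: "(n - K) * t \<le> C" using CZ by linarith
  have Kt: "6 * (K * t) < del * C"
  proof (cases "t = 0")
    case False
    then have "6 * K * t < del * (n - K) * t" using n t0 by (intro mult_strict_right_mono) auto
    also have "\<dots> \<le> del * C" using mult_left_mono[OF tC, of del] par by (simp add: mult.assoc)
    finally show ?thesis by (simp add: mult.assoc)
  qed (use par c C_def in auto)
  \<comment> \<open>\<open>m + 6 * t\<close> is exactly the weight allowed for the tile, so a tile
    of \<open>w\<close>-weight below 1 suffices. That the total \<open>w\<close>-weight is below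
    \<open>n / 6\<close> amounts to \<open>Kt\<close>: making \<open>K\<close> vertices weightless
    costs no more than \<open>K * t\<close>, and \<open>del\<close> pays for it.\<close>
  define m where "m = (6 + del) * C / n - 6 * t"
  have nm: "n * m = (6 + del) * C - 6 * (n * t)" using n by (simp add: m_def field_simps)
  have "0 < n * m" using tC Kt par c nm mult_nonneg_nonneg[OF of_nat_0_le_iff[of K] t0]
    by (simp add: algebra_simps C_def)
  then have m: "0 < m" using n by (simp add: zero_less_mult_iff)
  define w where "w = (\<lambda>v. max 0 (c v - t) / m)"
  have "sum w U = (\<Sum>v\<in>U. max 0 (c v - t)) / m" by (simp add: w_def sum_divide_distrib)
  also have "(\<Sum>v\<in>U. max 0 (c v - t)) = (\<Sum>v\<in>U - Z. max 0 (c v - t)) + (\<Sum>v\<in>Z. max 0 (c v - t))"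
    by (rule sum.subset_diff[OF Z(1) fU])
  also have "(\<Sum>v\<in>Z. max 0 (c v - t)) = 0" using t by (intro sum.neutral) auto
  also have "(\<Sum>v\<in>U - Z. max 0 (c v - t)) = (\<Sum>v\<in>U - Z. c v - t)"
    by (rule sum.cong) (use tv in auto)
  also have "\<dots> = sum c (U - Z) - (n - K) * t" using cUZ by (simp add: sum_subtractf)
  finally have sw: "sum w U * m \<le> C - (n - K) * t" using CZ m by simp
  have "6 * (sum w U * m) < n * m" using sw Kt nm by (simp add: algebra_simps)
  then have "6 * sum w U < n" using m by (simp add: mult.assoc[symmetric])
  then have sw': "sum w U < card U / 6" by (simp add: n_def)
  have "\<exists>T. tile T \<and> T \<subseteq> U \<and> sum w T < 1"
  proof (rule light_tile_normalized[OF U Z(1,2) K(1) _ K(3) par(2) K(4) _ _ _ sw' codeg rich])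
    have "8 * n - (K - 1) \<le> g * (real K - 1) * n - (real K - 1)"
      using K n by (intro diff_mono mult_right_mono) (auto simp: of_nat_diff)
    moreover have "4 * n < 8 * n - (K - 1)" using Kn n by linarith
    ultimately show "real (4 * card U) < (real K - 1) * (g * real (card U) - 1)"
      by (simp add: n_def algebra_simps)
    have "40 * g * card U \<le> r * card U" using par by (intro mult_right_mono) auto
    then show "30 * g * real (card U) + 5 \<le> r * real (card U)" using K by linarith
  qed (use m t in \<open>auto simp: w_def\<close>)
  then obtain T where T: "tile T" "T \<subseteq> U" "sum w T < 1" by blast
  have "sum c T \<le> (\<Sum>v\<in>T. w v * m + t)"
    by (rule sum_mono) (use m in \<open>auto simp: w_def\<close>)
  also have "\<dots> = sum w T * m + 6 * t"
    using tile_card[OF T(1)] by (simp add: sum.distrib sum_distrib_right)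
  also have "\<dots> \<le> m + 6 * t" using T(3) m by simp
  finally show ?thesis using T unfolding m_def C_def n_def by auto
qed

end

section \<open>Almost perfect tilings\<close>

lemma exp_le_quadratic:
  fixes x :: real
  assumes "\<bar>x\<bar> \<le> 1"
  shows "exp x \<le> 1 + x + x\<^sup>2"
proof (cases "0 \<le> x")
  case True
  then show ?thesis using exp_bound[of x] assms by simp
next
  case False
  define t where "t = - x"
  have t: "0 \<le> t" "t \<le> 1" using False assms by (auto simp: t_def)
  have "1 \<le> (1 - t + t\<^sup>2) * (1 + t + t\<^sup>2 / 2)"
  proof -
    have "(1 - t + t\<^sup>2) * (1 + t + t\<^sup>2 / 2) = 1 + (t\<^sup>2 + t^3 + t^4) / 2"
      by (simp add: field_simps power2_eq_square power3_eq_cube power4_eq_xxxx)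
    moreover have "0 \<le> t\<^sup>2 + t^3 + t^4" using t by simp
    ultimately show ?thesis by simp
  qed
  also have "\<dots> \<le> (1 - t + t\<^sup>2) * exp t"
  proof (rule mult_left_mono)
    show "1 + t + t\<^sup>2 / 2 \<le> exp t" using exp_lower_Taylor_quadratic[OF t(1)] .
    have "0 \<le> t\<^sup>2" by simp
    then show "0 \<le> 1 - t + t\<^sup>2" using t by linarith
  qed
  finally have "exp (- t) \<le> 1 - t + t\<^sup>2"
    by (simp add: exp_minus field_simps)
  then show ?thesis by (simp add: t_def)
qed

context three_uniform begin

text \<open>\<open>c v\<close> is the sum of the potentials of the tracked sets through
  \<open>v\<close>, so \<open>sum c A\<close> weights each \<open>F\<close> by the size of
  \<open>F \<inter> A\<close>. To first order, removing \<open>T\<close> changes the potential by a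
  multiple of \<open>M * sum c T - 6 * sum c U\<close>; hence a tile that is hardly heavier than six
  average vertices nearly preserves it. The second-order terms are collected in the summand with
  \<open>lam\<^sup>2\<close>.\<close>

lemma potential_step:
  fixes FF :: "'a set set" and lam del :: real and n' :: nat
  assumes FF: "finite FF" and U: "finite U" "12 \<le> card U" "\<exists>F\<in>FF. U \<subseteq> F"
    and lam: "0 < lam" "12 * lam \<le> card U" and del: "0 \<le> del"
    and step: "\<And>c. (\<And>v. v \<in> U \<Longrightarrow> 0 \<le> c v) \<Longrightarrow> 0 < sum c U \<Longrightarrow>
      \<exists>T. tile T \<and> T \<subseteq> U \<and> sum c T \<le> (6 + del) * sum c U / card U"
  defines "\<Phi> \<equiv> \<lambda>U. \<Sum>F\<in>FF. exp (lam * (card F / n' - card (F \<inter> U) / card U))"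
  shows "\<exists>T. tile T \<and> T \<subseteq> U \<and>
    \<Phi> (U - T) \<le> (1 + 2 * lam * del / card U + 144 * lam\<^sup>2 / (real (card U))\<^sup>2) * \<Phi> U"
proof -
  define M where "M = real (card U)"
  have M: "12 \<le> M" "12 * lam \<le> M" using U lam by (auto simp: M_def)
  define \<phi> where "\<phi> = (\<lambda>F. exp (lam * (card F / n' - card (F \<inter> U) / card U)))"
  define c where "c = (\<lambda>v. \<Sum>F\<in>FF. if v \<in> F then \<phi> F else 0)"
  have pos: "0 < \<phi> F" "0 \<le> \<phi> F" for F by (simp_all add: \<phi>_def)
  have csum: "sum c A = (\<Sum>F\<in>FF. \<phi> F * card (F \<inter> A))" if "finite A" for A
  proof -
    have "sum c A = (\<Sum>F\<in>FF. \<Sum>v\<in>A. if v \<in> F then \<phi> F else 0)"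
      unfolding c_def by (rule sum.swap)
    also have "\<dots> = (\<Sum>F\<in>FF. \<phi> F * card (F \<inter> A))"
    proof (rule sum.cong)
      fix F
      have "(\<Sum>v\<in>A. if v \<in> F then \<phi> F else 0) = (\<Sum>v\<in>A \<inter> F. \<phi> F)"
        by (rule sum.inter_restrict[OF that, symmetric])
      then show "(\<Sum>v\<in>A. if v \<in> F then \<phi> F else 0) = \<phi> F * card (F \<inter> A)"
        by (simp add: Int_commute)
    qed simp
    finally show ?thesis .
  qed
  obtain F0 where F0: "F0 \<in> FF" "U \<subseteq> F0" using U(3) by blast
  have "0 < \<phi> F0 * card (F0 \<inter> U)"
    using pos(1)[of F0] U F0 by (auto simp: inf.absorb2)
  also have "\<dots> \<le> (\<Sum>F\<in>FF. \<phi> F * card (F \<inter> U))"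
    by (rule member_le_sum[OF F0(1)]) (use FF pos(2) in simp_all)
  finally have "0 < sum c U" using csum U by simp
  moreover have "0 \<le> c v" for v unfolding c_def by (intro sum_nonneg) (use pos(2) in auto)
  ultimately obtain T where T: "tile T" "T \<subseteq> U" "sum c T \<le> (6 + del) * sum c U / card U"
    using step[of c] by blast
  have cT: "card T = 6" "finite T" using tile_card tile_finite T by auto
  have M': "real (card (U - T)) = M - 6"
    using cT T U by (simp add: card_Diff_subset M_def of_nat_diff)
  define y where "y = (\<lambda>F. real (card (F \<inter> T)))"
  define Y where "Y = (\<lambda>F. real (card (F \<inter> U)))"
  \<comment> \<open>The change of the exponent when \<open>T\<close> is removed: \<open>lam\<close>
    times the drop of the proportion of \<open>F\<close>.\<close>
  define s where "s = (\<lambda>F. lam * (y F * M - 6 * Y F) / (M * (M - 6)))"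
  have y: "0 \<le> y F" "y F \<le> 6" for F using cT card_mono[of T "F \<inter> T"] by (auto simp: y_def)
  have Y: "0 \<le> Y F" "Y F \<le> M" for F using U card_mono[of U "F \<inter> U"] by (auto simp: Y_def M_def)
  have sb: "\<bar>s F\<bar> \<le> 12 * lam / M" for F
  proof -
    have "\<bar>y F * M - 6 * Y F\<bar> \<le> 6 * M"
    proof -
      have "y F * M \<le> 6 * M" using y M by (intro mult_right_mono) auto
      moreover have "0 \<le> y F * M" using y M by simp
      ultimately show ?thesis using Y[of F] by (intro abs_leI) linarith+
    qed
    then have "lam * \<bar>y F * M - 6 * Y F\<bar> / (M * (M - 6)) \<le> lam * (6 * M) / (M * (M - 6))"
      using lam M by (intro divide_right_mono mult_left_mono) auto
    then have "\<bar>s F\<bar> \<le> lam * (6 * M) / (M * (M - 6))"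
      using lam M unfolding s_def by (simp add: abs_mult)
    also have "\<dots> \<le> 12 * lam / M"
      using lam M by (simp add: field_simps)
    finally show ?thesis .
  qed
  have "12 * lam / M \<le> 1" using M by simp
  then have s1: "\<bar>s F\<bar> \<le> 1" for F using sb[of F] by linarith
  have s2: "(s F)\<^sup>2 \<le> 144 * lam\<^sup>2 / M\<^sup>2" for F
    using power_mono[OF sb[of F], of 2] by (simp add: power_divide power_mult_distrib)
  have new: "exp (lam * (card F / n' - card (F \<inter> (U - T)) / card (U - T))) = \<phi> F * exp (s F)" for F
  proof -
    have "F \<inter> (U - T) = F \<inter> U - F \<inter> T" by auto
    moreover have "F \<inter> T \<subseteq> F \<inter> U" using T by auto
    ultimately have c: "real (card (F \<inter> (U - T))) = Y F - y F"
      using U cT by (simp add: card_Diff_subset card_mono of_nat_diff Y_def y_def)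
    have "Y F / M - (Y F - y F) / (M - 6) = (y F * M - 6 * Y F) / (M * (M - 6))"
      using M by (simp add: field_simps)
    then have s: "s F = lam * (Y F / M - (Y F - y F) / (M - 6))" unfolding s_def by simp
    have \<phi>: "\<phi> F = exp (lam * (card F / n' - Y F / M))" by (simp add: \<phi>_def Y_def M_def)
    show ?thesis unfolding \<phi> M' exp_add[symmetric] s c by (simp add: algebra_simps)
  qed
  have cU: "sum c U \<le> M * sum \<phi> FF"
  proof -
    have "sum c U \<le> (\<Sum>F\<in>FF. \<phi> F * M)"
      unfolding csum[OF U(1)] using Y pos(2) by (intro sum_mono mult_left_mono) (auto simp: Y_def)
    then show ?thesis by (simp add: sum_distrib_left mult.commute)
  qed
  have lin: "(\<Sum>F\<in>FF. \<phi> F * s F) \<le> 2 * lam * del / M * sum \<phi> FF"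
  proof -
    have "(\<Sum>F\<in>FF. \<phi> F * s F) = (\<Sum>F\<in>FF. lam / (M * (M - 6)) * (M * (\<phi> F * y F) - 6 * (\<phi> F * Y F)))"
      by (rule sum.cong) (auto simp: s_def algebra_simps diff_divide_distrib)
    also have "\<dots> = lam / (M * (M - 6)) * (M * sum c T - 6 * sum c U)"
      unfolding csum[OF U(1)] csum[OF cT(2)]
      by (simp only: sum_distrib_left[symmetric] sum_subtractf y_def Y_def)
    also have "\<dots> \<le> lam / (M * (M - 6)) * (del * (M * sum \<phi> FF))"
    proof (rule mult_left_mono)
      have "M * sum c T \<le> (6 + del) * sum c U" using T(3) M by (simp add: M_def field_simps)
      moreover have "del * sum c U \<le> del * (M * sum \<phi> FF)" using cU del by (rule mult_left_mono)
      ultimately show "M * sum c T - 6 * sum c U \<le> del * (M * sum \<phi> FF)" by (simp add: algebra_simps)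
    qed (use lam M in auto)
    also have "\<dots> = (lam * del * sum \<phi> FF) * (1 / (M - 6))" using M by (simp add: field_simps)
    also have "\<dots> \<le> (lam * del * sum \<phi> FF) * (2 / M)"
    proof (rule mult_left_mono)
      show "1 / (M - 6) \<le> 2 / M" using M by (simp add: field_simps)
      show "0 \<le> lam * del * sum \<phi> FF" using lam del pos(2) by (intro mult_nonneg_nonneg sum_nonneg) auto
    qed
    finally show ?thesis by (simp add: mult_ac)
  qed
  have "\<Phi> (U - T) = (\<Sum>F\<in>FF. \<phi> F * exp (s F))" by (simp add: \<Phi>_def new)
  also have "\<dots> \<le> (\<Sum>F\<in>FF. \<phi> F * (1 + s F + 144 * lam\<^sup>2 / M\<^sup>2))"
  proof (intro sum_mono mult_left_mono)
    fix F show "exp (s F) \<le> 1 + s F + 144 * lam\<^sup>2 / M\<^sup>2"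
      using exp_le_quadratic[OF s1[of F]] s2[of F] by linarith
  qed (use pos(2) in auto)
  also have "\<dots> = (\<Sum>F\<in>FF. \<phi> F * s F) + (1 + 144 * lam\<^sup>2 / M\<^sup>2) * sum \<phi> FF"
    (is "(\<Sum>F\<in>FF. \<phi> F * (1 + s F + ?q)) = _")
    by (simp only: distrib_left distrib_right sum.distrib sum_distrib_right[symmetric] mult_1_left
        mult_1_right) simp
  also have "\<dots> \<le> (1 + 2 * lam * del / M + 144 * lam\<^sup>2 / M\<^sup>2) * sum \<phi> FF"
    using lin by (simp add: algebra_simps)
  also have "sum \<phi> FF = \<Phi> U" by (simp add: \<Phi>_def \<phi>_def)
  finally show ?thesis using T unfolding M_def by auto
qed

text \<open>While at least \<open>\<sigma> * n' V'\<close> vertices are left, a step multiplies the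
  potential by at most \<open>1 + \<kappa>\<close>. It starts at \<open>card FF\<close>, and
  \<open>num\<close> keeps it below \<open>exp (lam * \<gamma>)\<close> during \<open>n' V'\<close>
  steps. Each summand obeys the same bound, so no tracked set has lost more than
  \<open>\<gamma>\<close> of its proportion, which is what \<open>step\<close> asks for in the next
  round.\<close>

lemma tracked_greedy_tiling:
  fixes FF :: "'a set set" and lam del \<sigma> \<gamma> :: real
  defines "n' \<equiv> \<lambda>V'. real (card V')"
  assumes FF: "finite FF" "V' \<in> FF" "finite V'"
    and par: "0 < lam" "0 \<le> del" "0 < \<sigma>" "12 \<le> \<sigma> * n' V'" "12 * lam \<le> \<sigma> * n' V'"
    and num: "card FF * exp (2 * lam * del / \<sigma> + 144 * lam\<^sup>2 / (\<sigma>\<^sup>2 * n' V')) < exp (lam * \<gamma>)"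
    and step: "\<And>U c. U \<subseteq> V' \<Longrightarrow> \<sigma> * n' V' \<le> card U \<Longrightarrow>
      (\<And>F. F \<in> FF \<Longrightarrow> card F / n' V' - \<gamma> \<le> card (F \<inter> U) / card U) \<Longrightarrow>
      (\<And>v. v \<in> U \<Longrightarrow> 0 \<le> c v) \<Longrightarrow> 0 < sum c U \<Longrightarrow>
      \<exists>T. tile T \<and> T \<subseteq> U \<and> sum c T \<le> (6 + del) * sum c U / card U"
    and sub: "\<And>F. F \<in> FF \<Longrightarrow> F \<subseteq> V'"
  shows "\<exists>U\<subseteq>V'. card U < \<sigma> * n' V' \<and> tileable (V' - U)"
proof (rule ccontr)
  assume none: "\<not> ?thesis"
  define n where "n = n' V'"
  have n0: "0 < n" using par(4) by (cases "card V' = 0") (auto simp: n_def n'_def)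
  define \<Phi> where "\<Phi> = (\<lambda>U. \<Sum>F\<in>FF. exp (lam * (card F / n - card (F \<inter> U) / card U)))"
  define \<kappa> where "\<kappa> = 2 * lam * del / (\<sigma> * n) + 144 * lam\<^sup>2 / (\<sigma> * n)\<^sup>2"
  have \<kappa>: "0 \<le> \<kappa>" using par n0 unfolding \<kappa>_def by (intro add_nonneg_nonneg divide_nonneg_nonneg) auto
  \<comment> \<open>Under the assumption \<open>none\<close> the process never stops, so this holds
    even for \<open>t\<close> beyond \<open>card V' / 6\<close>, which is absurd.\<close>
  have ex: "\<exists>U\<subseteq>V'. tileable (V' - U) \<and> card U + 6 * t = card V' \<and> \<Phi> U \<le> card FF * (1 + \<kappa>) ^ t" for t
  proof (induction t)
    case 0
    have "F \<inter> V' = F" if "F \<in> FF" for F using sub[OF that] by blast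
    then have "\<Phi> V' = (\<Sum>F\<in>FF. 1)" unfolding \<Phi>_def by (intro sum.cong) (auto simp: n_def n'_def)
    then show ?case by (intro exI[of _ V']) (auto simp: tileable_empty)
  next
    case (Suc t)
    then obtain U where U: "U \<subseteq> V'" "tileable (V' - U)" "card U + 6 * t = card V'"
      "\<Phi> U \<le> card FF * (1 + \<kappa>) ^ t" by blast
    have fU: "finite U" using U FF finite_subset by blast
    have big: "\<sigma> * n \<le> card U" using none U(1,2) unfolding n_def by (meson not_less)
    have "(1 + \<kappa>) ^ t \<le> (1 + \<kappa>) ^ card V'" using U \<kappa> by (intro power_increasing) auto
    also have "\<dots> \<le> exp (\<kappa> * n)"
      using power_mono[OF exp_ge_add_one_self[of \<kappa>], of "card V'"] \<kappa>
      by (simp add: exp_of_nat2_mult[symmetric] n_def n'_def)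
    also have "\<kappa> * n = 2 * lam * del / \<sigma> + 144 * lam\<^sup>2 / (\<sigma>\<^sup>2 * n)"
      using n0 par by (simp add: \<kappa>_def field_simps power2_eq_square)
    finally have "card FF * (1 + \<kappa>) ^ t \<le> card FF * exp (2 * lam * del / \<sigma> + 144 * lam\<^sup>2 / (\<sigma>\<^sup>2 * n))"
      by (rule mult_left_mono) auto
    then have small: "\<Phi> U < exp (lam * \<gamma>)" using num U(4) unfolding n_def by linarith
    have track: "card F / n - \<gamma> \<le> card (F \<inter> U) / card U" if "F \<in> FF" for F
    proof -
      have "exp (lam * (card F / n - card (F \<inter> U) / card U)) \<le> \<Phi> U"
        unfolding \<Phi>_def by (rule member_le_sum[OF that]) (use FF in auto)
      then have "lam * (card F / n - card (F \<inter> U) / card U) < lam * \<gamma>" using small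
        by (metis exp_less_cancel_iff le_less_trans)
      then show ?thesis using par by simp
    qed
    have s: "\<exists>T. tile T \<and> T \<subseteq> U \<and> sum c T \<le> (6 + del) * sum c U / card U"
      if "\<And>v. v \<in> U \<Longrightarrow> 0 \<le> c v" "0 < sum c U" for c
      using step[OF U(1) _ _ that] big track unfolding n_def by blast
    obtain T where T: "tile T" "T \<subseteq> U"
      and "(\<Sum>F\<in>FF. exp (lam * (card F / card V' - card (F \<inter> (U - T)) / card (U - T))))
       \<le> (1 + 2 * lam * del / card U + 144 * lam\<^sup>2 / (real (card U))\<^sup>2) *
        (\<Sum>F\<in>FF. exp (lam * (card F / card V' - card (F \<inter> U) / card U)))"
      using potential_step[OF FF(1) fU _ _ par(1) _ par(2) s, of "card V'"] big par U(1) FF(2)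
      unfolding n_def by fastforce
    then have "\<Phi> (U - T) \<le> (1 + 2 * lam * del / card U + 144 * lam\<^sup>2 / (real (card U))\<^sup>2) * \<Phi> U"
      unfolding \<Phi>_def n_def n'_def by simp
    also have "\<dots> \<le> (1 + \<kappa>) * (card FF * (1 + \<kappa>) ^ t)"
    proof (rule mult_mono)
      have p: "0 < \<sigma> * n" using par n0 by simp
      have p': "0 < real (card U)" using big p by linarith
      have "2 * lam * del / card U \<le> 2 * lam * del / (\<sigma> * n)"
        using big p par by (intro divide_left_mono) auto
      moreover have "144 * lam\<^sup>2 / (real (card U))\<^sup>2 \<le> 144 * lam\<^sup>2 / (\<sigma> * n)\<^sup>2"
        using big p p' par n0 by (intro divide_left_mono power_mono mult_pos_pos zero_less_power) auto
      ultimately show "1 + 2 * lam * del / card U + 144 * lam\<^sup>2 / (real (card U))\<^sup>2 \<le> 1 + \<kappa>"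
        by (simp add: \<kappa>_def)
    qed (use U \<kappa> in \<open>auto simp: \<Phi>_def intro!: sum_nonneg\<close>)
    finally have "\<Phi> (U - T) \<le> card FF * (1 + \<kappa>) ^ Suc t" by (simp add: mult_ac)
    moreover have "V' - (U - T) = T \<union> (V' - U)" using T U by auto
    moreover have "tileable (T \<union> (V' - U))" using T U by (intro tileable_insert) auto
    moreover have "card (U - T) + 6 = card U"
      using T fU tile_card tile_finite by (metis card_Diff_subset card_mono le_add_diff_inverse2)
    ultimately show ?case using U(1,3) by (intro exI[of _ "U - T"]) auto
  qed
  obtain U where "U \<subseteq> V'" "card U + 6 * card V' = card V'" using ex[of "card V'"] by auto
  then show False using n0 by (simp add: n_def n'_def)
qed

end

section \<open>Absorption\<close>

lemma card_distinct_avoiding_ge: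
  assumes "finite V" "Z \<subseteq> V" "card Z + k < card V"
  shows "real (card V) ^ k - k * (card Z + k) * real (card V) ^ (k - 1)
    \<le> card {xs. length xs = k \<and> distinct xs \<and> set xs \<subseteq> V - Z}"
proof -
  define n where "n = real (card V)"
  have n: "0 < n" "card Z + k < n" using assms by (auto simp: n_def)
  have cV: "card (V - Z) = card V - card Z"
    using assms by (metis card_Diff_subset finite_subset)
  \<comment> \<open>The lists are counted by a falling factorial whose factors are all at least
    \<open>n - card Z - k\<close>; Bernoulli's inequality bounds the \<open>k\<close>-th power of
    this number from below.\<close>
  have "1 + real k * (- real (card Z + k) / n) \<le> (1 + (- real (card Z + k) / n)) ^ k"
    by (rule Bernoulli_inequality) (use n in \<open>simp add: field_simps\<close>)
  then have "n ^ k * (1 + real k * (- real (card Z + k) / n)) \<le> n ^ k * (1 + (- real (card Z + k) / n)) ^ k"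
    by (rule mult_left_mono) (use n in simp)
  also have "\<dots> = (n - (card Z + k)) ^ k"
  proof -
    have "n * (1 + (- real (card Z + k) / n)) = n - (card Z + k)" using n by (simp add: field_simps)
    then show ?thesis by (simp only: power_mult_distrib[symmetric])
  qed
  also have "\<dots> = real (card V - card Z - k) ^ k" using assms(3) by (simp add: n_def of_nat_diff)
  also have "\<dots> = real ((\<Prod>i\<in>{card V - card Z - k + 1..card V - card Z}. card V - card Z - k))"
    using assms(3) by simp
  also have "\<dots> \<le> real (\<Prod>{card V - card Z - k + 1..card V - card Z})"
    by (intro of_nat_mono prod_mono) auto
  also have "\<dots> = card {xs. length xs = k \<and> distinct xs \<and> set xs \<subseteq> V - Z}"
    using card_lists_distinct_length_eq'[of k "V - Z"] assms cV by simp
  finally have "n ^ k * (1 + real k * (- real (card Z + k) / n))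
    \<le> card {xs. length xs = k \<and> distinct xs \<and> set xs \<subseteq> V - Z}" .
  moreover have "n ^ k * (1 + real k * (- real (card Z + k) / n)) = n ^ k - k * (card Z + k) * n ^ (k - 1)"
    using n by (cases k) (simp_all add: field_simps)
  ultimately show ?thesis by (simp add: n_def)
qed

text \<open>The lists are chosen one after the other so that the potential
  \<open>\<Sum>i\<in>I. (1/2) ^ (number of chosen members of F i)\<close> drops by a constant factor at every step.\<close>

lemma greedy_selection:
  fixes F :: "'i \<Rightarrow> 'b list set" and \<eta> :: real
  assumes V: "finite V" and I: "finite I" "I \<noteq> {}" and \<eta>: "0 < \<eta>" "\<eta> \<le> 1" and k: "1 \<le> k"
    and F: "\<And>i. i \<in> I \<Longrightarrow> F i \<subseteq> {xs. set xs \<subseteq> V \<and> length xs = k}"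
      "\<And>i. i \<in> I \<Longrightarrow> \<eta> * real (card V) ^ k \<le> card (F i)"
    and m: "2 * k\<^sup>2 * (m + 1) \<le> \<eta> * card V"
  shows "\<exists>Ls. length Ls = m \<and> (\<forall>xs\<in>set Ls. distinct xs \<and> (\<exists>i\<in>I. xs \<in> F i)) \<and>
    pairwise (\<lambda>j l. set (Ls ! j) \<inter> set (Ls ! l) = {}) {..<m} \<and>
    (\<Sum>i\<in>I. (1/2) ^ card {j. j < m \<and> Ls ! j \<in> F i}) \<le> card I * (1 - \<eta>/4) ^ m"
  using m
proof (induction m)
  case 0
  then show ?case by (intro exI[of _ "[]"]) (auto simp: pairwise_def)
next
  case (Suc m)
  have "2 * real (k\<^sup>2) * (real m + 1) \<le> 2 * real (k\<^sup>2) * (real (Suc m) + 1)"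
    by (intro mult_left_mono) auto
  then obtain Ls where Ls: "length Ls = m" "\<And>xs. xs \<in> set Ls \<Longrightarrow> distinct xs \<and> (\<exists>i\<in>I. xs \<in> F i)"
    "pairwise (\<lambda>j l. set (Ls ! j) \<inter> set (Ls ! l) = {}) {..<m}"
    "(\<Sum>i\<in>I. (1/2) ^ card {j. j < m \<and> Ls ! j \<in> F i}) \<le> card I * (1 - \<eta>/4) ^ m"
    using Suc.IH Suc.prems by force
  define n where "n = real (card V)"
  define Z where "Z = (\<Union>xs\<in>set Ls. set xs)"
  have ZV: "Z \<subseteq> V" using Ls(2) F(1) by (fastforce simp: Z_def)
  have "card Z \<le> (\<Sum>xs\<in>set Ls. card (set xs))" unfolding Z_def by (rule card_UN_le) simp
  also have "\<dots> \<le> (\<Sum>xs\<in>set Ls. k)"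
  proof (rule sum_mono)
    fix xs assume "xs \<in> set Ls"
    then have "length xs = k" using Ls(2) F(1) by blast
    then show "card (set xs) \<le> k" using card_length[of xs] by simp
  qed
  also have "\<dots> \<le> m * k" using card_length[of Ls] Ls(1) by simp
  finally have cZ: "card Z \<le> m * k" .
  have big: "2 * k * (card Z + k) \<le> \<eta> * n"
  proof -
    have "real (2 * k * (card Z + k)) \<le> real (2 * k * (m * k + k))"
      using cZ by (intro of_nat_mono mult_left_mono add_right_mono) auto
    also have "\<dots> \<le> real (2 * k\<^sup>2 * (Suc m + 1))"
      by (intro of_nat_mono) (simp add: power2_eq_square algebra_simps)
    also have "\<dots> \<le> \<eta> * n" using Suc.prems by (simp add: n_def algebra_simps)
    finally show ?thesis .
  qed
  have "\<eta> * n \<le> 1 * n" using \<eta> by (intro mult_right_mono) (auto simp: n_def)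
  then have "2 * k * (card Z + k) \<le> card V" using big unfolding n_def by linarith
  moreover have "card Z + k < 2 * k * (card Z + k)"
  proof -
    have "card Z + k < 2 * 1 * (card Z + k)" using k by simp
    also have "\<dots> \<le> 2 * k * (card Z + k)" using k by (intro mult_right_mono mult_left_mono) auto
    finally show ?thesis .
  qed
  ultimately have ZkV: "card Z + k < card V" by linarith
  then have n0: "0 < n" by (simp add: n_def)
  define L where "L = {xs. set xs \<subseteq> V \<and> length xs = k}"
  define D where "D = {xs. length xs = k \<and> distinct xs \<and> set xs \<subseteq> V - Z}"
  define A where "A = (\<Union>i\<in>I. F i) \<inter> D"
  have fL: "finite L" "real (card L) = n ^ k"
    using finite_lists_length_eq[OF V, of k] card_lists_length_eq[OF V, of k] by (auto simp: L_def n_def)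
  have DL: "D \<subseteq> L" by (auto simp: D_def L_def)
  have fA: "finite A" "A \<subseteq> L" using DL fL finite_subset by (auto simp: A_def)
  have cA: "real (card A) \<le> n ^ k" using card_mono[OF fL(1) fA(2)] fL(2) by linarith
  \<comment> \<open>By the hypothesis on \<open>m\<close>, the lists that repeat an entry or meet
    \<open>Z\<close> make up at most half of \<open>\<eta> * n ^ k\<close>, so each family keeps at
    least half of its guaranteed size.\<close>
  have FD: "\<eta> / 2 * n ^ k \<le> card (F i \<inter> A)" if "i \<in> I" for i
  proof -
    have FL: "F i \<subseteq> L" using F(1)[OF that] by (simp add: L_def)
    have D: "n ^ k - k * (card Z + k) * n ^ (k - 1) \<le> card D"
      using card_distinct_avoiding_ge[OF V ZV ZkV] by (simp add: D_def n_def)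
    have k2: "2 * (k * (card Z + k) * n ^ (k - 1)) \<le> \<eta> * n ^ k"
    proof -
      have "2 * k * (card Z + k) * n ^ (k - 1) \<le> \<eta> * n * n ^ (k - 1)"
        using big n0 by (intro mult_right_mono) auto
      moreover have "n ^ k = n * n ^ (k - 1)" using k by (cases k) auto
      ultimately show ?thesis by (simp add: algebra_simps)
    qed
    have "card (F i) + card D \<le> card (F i \<inter> D) + card L"
    proof -
      have "card (F i) + card D = card (F i \<union> D) + card (F i \<inter> D)"
        using FL DL fL finite_subset by (intro card_Un_Int) auto
      moreover have "card (F i \<union> D) \<le> card L" using FL DL fL by (intro card_mono) auto
      ultimately show ?thesis by linarith
    qed
    moreover have "F i \<inter> D = F i \<inter> A" using that by (auto simp: A_def)
    ultimately have "real (card (F i)) + card D \<le> card (F i \<inter> A) + n ^ k"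
      using fL(2) by (metis of_nat_add of_nat_mono)
    then show ?thesis using F(2)[OF that] D k2 unfolding n_def[symmetric] by linarith
  qed
  define h where "h = (\<lambda>i. card {j. j < m \<and> Ls ! j \<in> F i})"
  define \<Phi> where "\<Phi> = (\<Sum>i\<in>I. (1/2::real) ^ h i)"
  \<comment> \<open>The potential after \<open>xs\<close> has been added. At least the proportion
    \<open>\<eta> / 2\<close> of \<open>A\<close> lies in \<open>F i\<close>, and a hit halves the
    term of \<open>i\<close>, so on average the potential shrinks by the factor
    \<open>1 - \<eta>/4\<close>.\<close>
  define \<psi> where "\<psi> = (\<lambda>xs. \<Sum>i\<in>I. (1/2::real) ^ h i * (if xs \<in> F i then 1/2 else 1))"
  have "(\<Sum>xs\<in>A. \<psi> xs) = (\<Sum>i\<in>I. (1/2) ^ h i * (\<Sum>xs\<in>A. if xs \<in> F i then 1/2 else 1))"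
    unfolding \<psi>_def by (subst sum.swap) (simp add: sum_distrib_left)
  also have "\<dots> \<le> (\<Sum>i\<in>I. (1/2) ^ h i * (card A * (1 - \<eta>/4)))"
  proof (intro sum_mono mult_left_mono)
    fix i assume i: "i \<in> I"
    have "(\<Sum>xs\<in>A. if xs \<in> F i then 1/2 else 1) = (\<Sum>xs\<in>A. 1 - (if xs \<in> F i then 1/2 else (0::real)))"
      by (rule sum.cong) auto
    also have "\<dots> = card A - (\<Sum>xs\<in>A. if xs \<in> F i then 1/2 else 0)" by (simp add: sum_subtractf)
    also have "(\<Sum>xs\<in>A. if xs \<in> F i then 1/2 else 0) = card (F i \<inter> A) / (2::real)"
      using sum.inter_restrict[OF fA(1), of "\<lambda>_. 1/2::real" "F i"] by (simp add: Int_commute)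
    also have "card A - card (F i \<inter> A) / 2 \<le> card A * (1 - \<eta>/4)"
    proof -
      have "\<eta> / 2 * card A \<le> \<eta> / 2 * n ^ k" using cA \<eta> by (intro mult_left_mono) auto
      then have "\<eta> / 2 * card A \<le> card (F i \<inter> A)" using FD[OF i] by linarith
      then show ?thesis by (simp add: algebra_simps)
    qed
    finally show "(\<Sum>xs\<in>A. if xs \<in> F i then 1/2 else 1) \<le> card A * (1 - \<eta>/4)" .
  qed simp
  also have "\<dots> = card A * ((1 - \<eta>/4) * \<Phi>)" by (simp add: \<Phi>_def sum_distrib_left mult_ac)
  finally have avg: "(\<Sum>xs\<in>A. \<psi> xs) \<le> card A * ((1 - \<eta>/4) * \<Phi>)" .
  obtain i0 where "i0 \<in> I" using I by blast
  moreover have "0 < \<eta> / 2 * n ^ k" using \<eta> n0 by simp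
  ultimately have "0 < card (F i0 \<inter> A)" using FD[of i0] by linarith
  then have "A \<noteq> {}" by force
  have "\<exists>xs\<in>A. \<psi> xs \<le> (1 - \<eta>/4) * \<Phi>"
  proof (rule ccontr)
    assume "\<not> ?thesis"
    then have "(\<Sum>xs\<in>A. (1 - \<eta>/4) * \<Phi>) < (\<Sum>xs\<in>A. \<psi> xs)"
      using fA \<open>A \<noteq> {}\<close> by (intro sum_strict_mono) auto
    then show False using avg by simp
  qed
  then obtain xs where xs: "xs \<in> A" "\<psi> xs \<le> (1 - \<eta>/4) * \<Phi>" by blast
  define Ls' where "Ls' = Ls @ [xs]"
  have nth: "Ls' ! j = (if j < m then Ls ! j else xs)" if "j < Suc m" for j
    using that Ls(1) by (auto simp: Ls'_def nth_append)
  have hits: "card {j. j < Suc m \<and> Ls' ! j \<in> F i} = h i + (if xs \<in> F i then 1 else 0)" for i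
  proof -
    have "{j. j < Suc m \<and> Ls' ! j \<in> F i} = {j. j < m \<and> Ls ! j \<in> F i} \<union> (if xs \<in> F i then {m} else {})"
      using nth by (auto simp: less_Suc_eq)
    then show ?thesis by (simp add: h_def)
  qed
  have "(\<Sum>i\<in>I. (1/2) ^ card {j. j < Suc m \<and> Ls' ! j \<in> F i}) = \<psi> xs"
    unfolding hits \<psi>_def by (rule sum.cong) auto
  also have "\<dots> \<le> (1 - \<eta>/4) * (card I * (1 - \<eta>/4) ^ m)"
    using xs(2) Ls(4) \<eta> mult_left_mono[of \<Phi> "card I * (1 - \<eta>/4) ^ m" "1 - \<eta>/4"]
    unfolding \<Phi>_def h_def by linarith
  finally have "(\<Sum>i\<in>I. (1/2) ^ card {j. j < Suc m \<and> Ls' ! j \<in> F i}) \<le> card I * (1 - \<eta>/4) ^ Suc m"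
    by (simp add: mult_ac)
  moreover have "pairwise (\<lambda>j l. set (Ls' ! j) \<inter> set (Ls' ! l) = {}) {..<Suc m}"
  proof -
    have "set (Ls ! j) \<inter> set xs = {}" if "j < m" for j
      using xs(1) that Ls(1) by (fastforce simp: A_def D_def Z_def)
    then show ?thesis using Ls(3) nth by (auto simp: pairwise_def less_Suc_eq)
  qed
  moreover have "\<forall>ys\<in>set Ls'. distinct ys \<and> (\<exists>i\<in>I. ys \<in> F i)"
    using Ls(2) xs(1) by (auto simp: Ls'_def A_def D_def)
  ultimately show ?case using Ls(1) by (intro exI[of _ Ls']) (auto simp: Ls'_def)
qed

text \<open>Cauchy-Schwarz twice. The exponent 4 is needed because a list that exchanges two
  vertices takes four entries from one common set.\<close>

lemma power4_mean:
  fixes f :: "'i \<Rightarrow> real"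
  assumes "finite A"
  shows "(sum f A) ^ 4 \<le> real (card A) ^ 3 * (\<Sum>i\<in>A. f i ^ 4)"
proof -
  define n where "n = real (card A)"
  have "(sum f A) ^ 4 = ((sum f A)\<^sup>2)\<^sup>2" by simp
  also have "\<dots> \<le> ((\<Sum>i\<in>A. (f i)\<^sup>2) * n)\<^sup>2"
    using sum_squared_le_sum_of_squares[of f A] by (intro power_mono) (auto simp: n_def)
  also have "\<dots> = (\<Sum>i\<in>A. (f i)\<^sup>2)\<^sup>2 * n\<^sup>2" by (simp add: power_mult_distrib)
  also have "\<dots> \<le> ((\<Sum>i\<in>A. ((f i)\<^sup>2)\<^sup>2) * n) * n\<^sup>2"
    using sum_squared_le_sum_of_squares[of "\<lambda>i. (f i)\<^sup>2" A] by (intro mult_right_mono) (auto simp: n_def)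
  finally show ?thesis by (simp add: n_def power2_eq_square power3_eq_cube power4_eq_xxxx mult_ac)
qed

section \<open>Lists of eleven vertices that can exchange two given vertices\<close>

locale codegree_third = three_uniform +
  assumes codeg: "\<And>a b. a \<in> V \<Longrightarrow> b \<in> V \<Longrightarrow> a \<noteq> b \<Longrightarrow> card V / 3 \<le> card (N a b)"
begin

text \<open>For \<open>b\<close> in \<open>links u (u', x1, x2)\<close> the vertices \<open>u\<close> and \<open>u'\<close> form an edge with \<open>b\<close> and each of
  \<open>x1\<close>, \<open>x2\<close>, so \<open>u'\<close> can stand in for \<open>u\<close>. A list in \<open>swaps u v\<close> plus \<open>u\<close> splits into tiles with
  corners \<open>u, b1, x1\<close> and \<open>v', b3, c\<close>; the same list plus \<open>v\<close> splits into tiles with corners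
  \<open>v, b1, y1\<close> and \<open>u', b3, c\<close>.\<close>

definition links :: "'a \<Rightarrow> 'a \<times> 'a \<times> 'a \<Rightarrow> 'a set" where
  "links u = (\<lambda>(u', x1, x2). {b \<in> V. x1 \<in> N u b \<and> x1 \<in> N u' b \<and> x2 \<in> N u b \<and> x2 \<in> N u' b})"

text \<open>Let \<open>S u'\<close> be the intersection of \<open>N u b\<close> and
  \<open>N u' b\<close>. The sizes of these sets count the pairs \<open>x \<in> N u b\<close>,
  \<open>u' \<in> N x b\<close>, so they add up to at least \<open>(n / 3)\<^sup>2\<close>. By
  Cauchy-Schwarz their squares add up to at least \<open>n ^ 3 / 81\<close>, and each square counts
  the choices of \<open>x1\<close> and \<open>x2\<close>.\<close>

lemma card_links_ge:
  assumes u: "u \<in> V" "b \<in> V" "b \<noteq> u"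
  shows "real (card V) ^ 3 / 81 \<le> card {w \<in> V \<times> V \<times> V. b \<in> links u w}"
proof -
  define n where "n = real (card V)"
  have n0: "0 < n" using u finite_V by (auto simp: n_def card_gt_0_iff)
  define S where "S = (\<lambda>u'. {x \<in> N u b. x \<in> N u' b})"
  have fS: "finite (S u')" "S u' \<subseteq> V" for u' using finite_N N_memD by (auto simp: S_def)
  have "(\<Sum>u'\<in>V. card (S u')) = (\<Sum>x\<in>N u b. card {u' \<in> V. x \<in> N u' b})"
    unfolding S_def by (rule sum_card_swap[OF finite_V finite_N])
  also have "real \<dots> \<ge> (\<Sum>x\<in>N u b. n / 3)"
    unfolding of_nat_sum
  proof (rule sum_mono)
    fix x assume "x \<in> N u b"
    then have "x \<in> V" "x \<noteq> b" using N_memD edgeD(6)[of u b x] by (auto simp: N_def)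
    moreover have "{u' \<in> V. x \<in> N u' b} = N x b" using edgeD(1)[of _ b x] by (auto simp: N_def insert_commute)
    ultimately show "n / 3 \<le> card {u' \<in> V. x \<in> N u' b}" using codeg u by (simp add: n_def)
  qed
  finally have "card (N u b) * (n / 3) \<le> (\<Sum>u'\<in>V. real (card (S u')))" by simp
  moreover have "n / 3 * (n / 3) \<le> card (N u b) * (n / 3)"
    using codeg[of u b] u n0 by (intro mult_right_mono) (auto simp: n_def)
  ultimately have ge: "n\<^sup>2 / 9 \<le> (\<Sum>u'\<in>V. real (card (S u')))" by (simp add: power2_eq_square)
  have "(n\<^sup>2 / 9)\<^sup>2 \<le> (\<Sum>u'\<in>V. real (card (S u')))\<^sup>2" by (rule power_mono[OF ge]) simp
  also have "\<dots> \<le> (\<Sum>u'\<in>V. (real (card (S u')))\<^sup>2) * n"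
    using sum_squared_le_sum_of_squares[of "\<lambda>u'. real (card (S u'))" V] by (simp add: n_def)
  finally have "n ^ 3 / 81 * n \<le> (\<Sum>u'\<in>V. (real (card (S u')))\<^sup>2) * n"
    by (simp add: power2_eq_square power3_eq_cube)
  then have "n ^ 3 / 81 \<le> (\<Sum>u'\<in>V. (real (card (S u')))\<^sup>2)" using n0 by simp
  also have "\<dots> = card (SIGMA u':V. S u' \<times> S u')"
    using fS finite_V by (simp add: card_SigmaI power2_eq_square card_cartesian_product)
  also have "(SIGMA u':V. S u' \<times> S u') = {w \<in> V \<times> V \<times> V. b \<in> links u w}"
    using u N_memD by (auto simp: S_def links_def)
  finally show ?thesis by (simp add: n_def)
qed

text \<open>The choices behind \<open>swaps\<close> as an iterated \<open>Sigma\<close>, whose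
  cardinality is a nested sum. The diagonal \<open>b3 = c\<close> is given all of \<open>V\<close>,
  so that \<open>z\<close> always has at least \<open>card V / 3\<close> options.\<close>

definition swap_data where
  "swap_data u v = (SIGMA r:(V \<times> V \<times> V) \<times> (V \<times> V \<times> V).
     SIGMA q:(let C = links u (fst r) \<inter> links v (snd r) in C \<times> C \<times> C \<times> C).
       (case q of (b1, b2, b3, c) \<Rightarrow> if b3 = c then V else N b3 c))"

definition swaps :: "'a \<Rightarrow> 'a \<Rightarrow> 'a list set" where
  "swaps u v = {R. \<exists>u' x1 x2 v' y1 y2 b1 b2 b3 c z.
     R = [u', x1, x2, v', y1, y2, b1, b2, b3, c, z] \<and>
     {u', x1, x2, v', y1, y2} \<subseteq> V \<and>
     {b1, b2, b3, c} \<subseteq> links u (u', x1, x2) \<inter> links v (v', y1, y2) \<and>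
     z \<in> (if b3 = c then V else N b3 c)}"

lemma swaps_lists: "R \<in> swaps u v \<Longrightarrow> set R \<subseteq> V \<and> length R = 11"
  unfolding swaps_def using N_memD by (auto simp: links_def split: if_splits) 

lemma tileable_two:
  assumes "tile T1" "tile T2" "T1 \<inter> T2 = {}" "T = T1 \<union> T2"
  shows "tileable T"
  using assms tileable_Un tileable_tile by blast

lemma swaps_tileable1:
  assumes "R \<in> swaps u v" "distinct (u # R)"
  shows "tileable (insert u (set R))"
proof -
  obtain u' x1 x2 v' y1 y2 b1 b2 b3 c z where R: "R = [u', x1, x2, v', y1, y2, b1, b2, b3, c, z]"
    and b: "{b1, b2, b3, c} \<subseteq> links u (u', x1, x2) \<inter> links v (v', y1, y2)"
    and z: "z \<in> (if b3 = c then V else N b3 c)"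
    using assms(1) unfolding swaps_def mem_Collect_eq by (elim exE conjE) (rule that)
  have d: "distinct [u, u', x1, x2, v', y1, y2, b1, b2, b3, c, z]" using assms(2) R by simp
  have zE: "{b3, c, z} \<in> E" using z d by (simp add: N_def)
  have dd: "distinct [u, b1, x1, x2, u', b2]" "distinct [v', b3, c, y1, z, y2]" using d by auto
  show ?thesis
  proof (rule tileable_two)
    show "tile {u, b1, x1, x2, u', b2}"
      by (rule tileI[OF dd(1)]) (use b in \<open>simp_all add: links_def N_def insert_commute\<close>)
    show "tile {v', b3, c, y1, z, y2}"
      by (rule tileI[OF dd(2)]) (use b zE in \<open>simp_all add: links_def N_def insert_commute\<close>)
    show "{u, b1, x1, x2, u', b2} \<inter> {v', b3, c, y1, z, y2} = {}" using d by auto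
    show "insert u (set R) = {u, b1, x1, x2, u', b2} \<union> {v', b3, c, y1, z, y2}"
      unfolding R by auto
  qed
qed

text \<open>\<open>swaps\<close> is symmetric up to exchanging the triples that belong to
  \<open>u\<close> and \<open>v\<close>, which does not change the vertex set of the list.\<close>

lemma swaps_tileable2:
  assumes "R \<in> swaps u v" "distinct (v # R)"
  shows "tileable (insert v (set R))"
proof -
  obtain u' x1 x2 v' y1 y2 b1 b2 b3 c z where R: "R = [u', x1, x2, v', y1, y2, b1, b2, b3, c, z]"
    and V: "{u', x1, x2, v', y1, y2} \<subseteq> V"
    and b: "{b1, b2, b3, c} \<subseteq> links u (u', x1, x2) \<inter> links v (v', y1, y2)"
    and z: "z \<in> (if b3 = c then V else N b3 c)"
    using assms(1) unfolding swaps_def mem_Collect_eq by (elim exE conjE) (rule that)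
  define R' where "R' = [v', y1, y2, u', x1, x2, b1, b2, b3, c, z]"
  have "R' \<in> swaps v u"
    unfolding swaps_def mem_Collect_eq R'_def
    by (intro exI conjI, rule refl) (use V b z in auto)
  moreover have "distinct (v # R')" "set R' = set R" using assms(2) by (auto simp: R R'_def)
  ultimately show ?thesis using swaps_tileable1 by metis
qed

text \<open>Each \<open>b\<close> outside \<open>{u, v}\<close> lies in \<open>links u w\<close> for
  many \<open>w\<close> and, independently, in \<open>links v w'\<close> for many \<open>w'\<close>.
  So the sets \<open>links u w \<inter> links v w'\<close> are large on average over all pairs of
  triples, and the power mean inequality carries this over to their fourth powers, which count the
  choices of \<open>b1\<close>, \<open>b2\<close>, \<open>b3\<close>, \<open>c\<close>.\<close>

lemma card_swaps_ge:
  assumes uv: "u \<in> V" "v \<in> V" and big: "10 \<le> card V"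
  shows "real (card V) ^ 11 / (3 * 10 ^ 16) \<le> card (swaps u v)"
proof -
  define n where "n = real (card V)"
  have n: "10 \<le> n" using big by (simp add: n_def)
  define W where "W = V \<times> V \<times> V"
  define f where "f = (\<lambda>r. real (card (links u (fst r) \<inter> links v (snd r))))"
  have fW: "finite W" "real (card W) = n ^ 3"
    using finite_V by (auto simp: W_def n_def power3_eq_cube card_cartesian_product)
  have flinks: "finite (links u r)" "links u r \<subseteq> V" for u r
    using finite_V by (auto simp: links_def split: prod.splits)
  have "(n - 2) * (n ^ 3 / 81)\<^sup>2 \<le> real (card (V - {u, v})) * (n ^ 3 / 81)\<^sup>2"
  proof (rule mult_right_mono)
    have "card V - card {u, v} \<le> card (V - {u, v})" by (rule diff_card_le_card_Diff) simp
    moreover have "card {u, v} \<le> 2" by (simp add: card_insert_if)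
    ultimately show "n - 2 \<le> real (card (V - {u, v}))" unfolding n_def by linarith
  qed simp
  also have "\<dots> = (\<Sum>b\<in>V - {u, v}. (n ^ 3 / 81) * (n ^ 3 / 81))" by (simp add: power2_eq_square)
  also have "\<dots> \<le> (\<Sum>b\<in>V - {u, v}. real (card {w \<in> W. b \<in> links u w}) * real (card {w \<in> W. b \<in> links v w}))"
    unfolding W_def n_def by (intro sum_mono mult_mono card_links_ge) (use uv in auto)
  also have "\<dots> \<le> (\<Sum>b\<in>V. real (card {w \<in> W. b \<in> links u w}) * real (card {w \<in> W. b \<in> links v w}))"
    by (rule sum_mono2) (use finite_V in auto)
  also have "\<dots> = (\<Sum>b\<in>V. real (card {r \<in> W \<times> W. b \<in> links u (fst r) \<inter> links v (snd r)}))"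
  proof (rule sum.cong)
    fix b
    have "{r \<in> W \<times> W. b \<in> links u (fst r) \<inter> links v (snd r)} = {w \<in> W. b \<in> links u w} \<times> {w \<in> W. b \<in> links v w}"
      by auto
    then show "real (card {w \<in> W. b \<in> links u w}) * real (card {w \<in> W. b \<in> links v w}) =
      real (card {r \<in> W \<times> W. b \<in> links u (fst r) \<inter> links v (snd r)})"
      by (simp add: card_cartesian_product)
  qed simp
  also have "\<dots> = real (\<Sum>r\<in>W \<times> W. card {b \<in> V. b \<in> links u (fst r) \<inter> links v (snd r)})"
    using sum_card_swap[of V "W \<times> W" "\<lambda>b r. b \<in> links u (fst r) \<inter> links v (snd r)"] finite_V fW
    by (simp flip: of_nat_sum)
  also have "\<dots> = sum f (W \<times> W)"
    unfolding of_nat_sum f_def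
  proof (rule sum.cong)
    fix r
    have "{b \<in> V. b \<in> links u (fst r) \<inter> links v (snd r)} = links u (fst r) \<inter> links v (snd r)"
      using flinks(2)[of u "fst r"] by blast
    then show "real (card {b \<in> V. b \<in> links u (fst r) \<inter> links v (snd r)}) =
      real (card (links u (fst r) \<inter> links v (snd r)))" by simp
  qed simp
  finally have s1: "(n - 2) * (n ^ 3 / 81)\<^sup>2 \<le> sum f (W \<times> W)" .
  \<comment> \<open>\<open>81\<^sup>2 = 6561\<close>; the rounding to \<open>10 ^ 4\<close> makes up
    for the two excluded vertices, since \<open>n\<close> is at least 10.\<close>
  have s2: "n ^ 7 / 10 ^ 4 \<le> (n - 2) * (n ^ 3 / 81)\<^sup>2"
  proof -
    have "n * 6561 \<le> (n - 2) * 10 ^ 4" using n by simp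
    then have "n * 6561 * n ^ 6 \<le> (n - 2) * 10 ^ 4 * n ^ 6" using n by (intro mult_right_mono) auto
    moreover have "(n ^ 3 / 81)\<^sup>2 = n ^ 6 / 6561" by (simp add: power_divide)
    moreover have "n ^ 7 = n * n ^ 6" by (simp add: power_Suc[symmetric])
    ultimately show ?thesis by (simp add: field_simps)
  qed
  have "(n ^ 7 / 10 ^ 4) ^ 4 \<le> (sum f (W \<times> W)) ^ 4"
    using s1 s2 n by (intro power_mono) auto
  also have "\<dots> \<le> real (card (W \<times> W)) ^ 3 * (\<Sum>r\<in>W \<times> W. f r ^ 4)"
    by (rule power4_mean) (use fW in auto)
  also have "real (card (W \<times> W)) = n ^ 6" using fW by (simp add: card_cartesian_product power_add[symmetric])
  finally have "n ^ 18 * (n ^ 10 / 10 ^ 16) \<le> n ^ 18 * (\<Sum>r\<in>W \<times> W. f r ^ 4)"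
    by (simp add: power_divide power_add[symmetric] power_mult[symmetric])
  then have s4: "n ^ 10 / 10 ^ 16 \<le> (\<Sum>r\<in>W \<times> W. f r ^ 4)"
    by (rule mult_left_le_imp_le) (use n in simp)
  define Q where "Q = (\<lambda>r. let C = links u (fst r) \<inter> links v (snd r) in C \<times> C \<times> C \<times> C)"
  define Z where "Z = (\<lambda>(b1::'a, b2::'a, b3, c). if b3 = c then V else N b3 c)"
  have fQ: "finite (Q r)" for r using flinks by (auto simp: Q_def Let_def)
  have fZ: "finite (Z q)" for q using finite_V finite_N by (auto simp: Z_def split: prod.splits)
  have cQ: "real (card (Q r)) = f r ^ 4" for r
    by (simp add: Q_def Let_def f_def card_cartesian_product power4_eq_xxxx)
  have cZ: "n / 3 \<le> card (Z q)" if "q \<in> Q r" for q r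
  proof -
    obtain b1 b2 b3 c where q: "q = (b1, b2, b3, c)" by (metis prod.exhaust)
    have "b3 \<in> links u (fst r)" "c \<in> links u (fst r)" using that q by (auto simp: Q_def Let_def)
    then have "b3 \<in> V" "c \<in> V" using flinks(2) by blast+
    then show ?thesis using codeg[of b3 c] by (auto simp: Z_def q n_def)
  qed
  have "n ^ 11 / (3 * 10 ^ 16) = n ^ 10 / 10 ^ 16 * (n / 3)" using power_Suc2[of n 10] by simp
  also have "\<dots> \<le> (\<Sum>r\<in>W \<times> W. f r ^ 4) * (n / 3)" using s4 n by (intro mult_right_mono) auto
  also have "\<dots> = (\<Sum>r\<in>W \<times> W. \<Sum>q\<in>Q r. n / 3)" by (simp add: cQ sum_distrib_right)
  also have "\<dots> \<le> (\<Sum>r\<in>W \<times> W. \<Sum>q\<in>Q r. real (card (Z q)))" by (intro sum_mono cZ)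
  also have "\<dots> = card (SIGMA r:W \<times> W. SIGMA q:Q r. Z q)"
    using fW fQ fZ by (simp add: card_SigmaI)
  also have "(SIGMA r:W \<times> W. SIGMA q:Q r. Z q) = swap_data u v"
    unfolding swap_data_def W_def Q_def Z_def by simp
  also have "card (swap_data u v) \<le> card (swaps u v)"
  proof (rule card_inj_on_le)
    define \<iota> where "\<iota> = (\<lambda>(((u', x1, x2), (v', y1, y2)), (b1, b2, b3, c), z).
      [u'::'a, x1, x2, v', y1, y2, b1, b2, b3, c, z])"
    show "inj_on \<iota> (swap_data u v)" by (auto simp: inj_on_def \<iota>_def)
    show "\<iota> ` swap_data u v \<subseteq> swaps u v"
    proof clarify
      fix u' x1 x2 v' y1 y2 b1 b2 b3 c z
      assume "(((u', x1, x2), v', y1, y2), (b1, b2, b3, c), z) \<in> swap_data u v"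
      then show "\<iota> (((u', x1, x2), v', y1, y2), (b1, b2, b3, c), z) \<in> swaps u v"
        unfolding swaps_def mem_Collect_eq \<iota>_def prod.case
        by - (intro exI conjI, rule refl, simp_all add: swap_data_def Let_def)
    qed
    have "swaps u v \<subseteq> {R. set R \<subseteq> V \<and> length R = 11}" using swaps_lists by blast
    then show "finite (swaps u v)" using finite_lists_length_eq[OF finite_V] finite_subset by blast
  qed
  finally show ?thesis by (simp add: n_def)
qed

end

section \<open>Absorbers of 6-sets and the absorbing set\<close>

context codegree_third begin

fun blocks :: "'a list \<Rightarrow> 'a list \<Rightarrow> 'a list set" where
  "blocks [] [] = {[]}"
| "blocks (u # us) (v # vs) = (\<lambda>(r, s). r @ s) ` (swaps u v \<times> blocks us vs)"
| "blocks _ _ = {}"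

lemma blocks_lists: "s \<in> blocks us vs \<Longrightarrow> set s \<subseteq> V \<and> length s = 11 * length us"
proof (induction us vs arbitrary: s rule: blocks.induct)
  case (2 u us v vs)
  then obtain r s' where "r \<in> swaps u v" "s' \<in> blocks us vs" "s = r @ s'" by auto
  then show ?case using 2(1)[of s'] swaps_lists[of r u v] by auto
qed auto

lemma card_blocks_ge:
  assumes "length us = length vs" "set us \<subseteq> V" "set vs \<subseteq> V" "10 \<le> card V"
  shows "(real (card V) ^ 11 / (3 * 10 ^ 16)) ^ length us \<le> card (blocks us vs)"
  using assms(1-3)
proof (induction us vs rule: list_induct2)
  case (Cons u us v vs)
  define \<kappa> where "\<kappa> = real (card V) ^ 11 / (3 * 10 ^ 16)"
  have inj: "inj_on (\<lambda>(r, s). r @ s) (swaps u v \<times> blocks us vs)"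
  proof (rule inj_onI, clarify)
    fix r s r' s' assume *: "r \<in> swaps u v" "r' \<in> swaps u v" "r @ s = r' @ s'"
    then have "length r = length r'" using swaps_lists by metis
    then show "r = r' \<and> s = s'" using *(3) by simp
  qed
  have "\<kappa> ^ length (u # us) = \<kappa> * \<kappa> ^ length us" by simp
  also have "\<dots> \<le> real (card (swaps u v)) * real (card (blocks us vs))"
    using card_swaps_ge[of u v] Cons assms(4) by (intro mult_mono) (auto simp: \<kappa>_def)
  also have "\<dots> = card (blocks (u # us) (v # vs))"
    using card_image[OF inj] by (simp add: card_cartesian_product)
  finally show ?case by (simp add: \<kappa>_def)
qed simp

lemma blocks_tileable:
  assumes "s \<in> blocks us vs"
  shows "distinct (us @ s) \<Longrightarrow> tileable (set us \<union> set s)"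
    and "distinct (vs @ s) \<Longrightarrow> tileable (set vs \<union> set s)"
proof -
  have "(distinct (us @ s) \<longrightarrow> tileable (set us \<union> set s)) \<and> (distinct (vs @ s) \<longrightarrow> tileable (set vs \<union> set s))"
    using assms
  proof (induction us vs arbitrary: s rule: blocks.induct)
    case (2 u us v vs)
    then obtain r s' where r: "r \<in> swaps u v" and s': "s' \<in> blocks us vs" and s: "s = r @ s'" by auto
    note IH = 2(1)[OF s']
    have "tileable (set (u # us) \<union> set s)" if d: "distinct ((u # us) @ s)"
    proof -
      have "tileable (insert u (set r) \<union> (set us \<union> set s'))"
        by (rule tileable_Un) (use d s conjunct1[OF IH] swaps_tileable1[OF r] in auto)
      also have "insert u (set r) \<union> (set us \<union> set s') = set (u # us) \<union> set s" using s by auto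
      finally show ?thesis .
    qed
    moreover have "tileable (set (v # vs) \<union> set s)" if d: "distinct ((v # vs) @ s)"
    proof -
      have "tileable (insert v (set r) \<union> (set vs \<union> set s'))"
        by (rule tileable_Un) (use d s conjunct2[OF IH] swaps_tileable2[OF r] in auto)
      also have "insert v (set r) \<union> (set vs \<union> set s') = set (v # vs) \<union> set s" using s by auto
      finally show ?thesis .
    qed
    ultimately show ?case by blast
  qed (auto simp: tileable_empty)
  then show "distinct (us @ s) \<Longrightarrow> tileable (set us \<union> set s)"
    and "distinct (vs @ s) \<Longrightarrow> tileable (set vs \<union> set s)" by blast+
qed

text \<open>On the diagonal, where no edge can be asked for, all of \<open>V\<close> is allowed, so that every choice
  has at least \<open>card V / 3\<close> continuations; the lists affected are not distinct and never used.\<close>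

definition N' :: "'a \<Rightarrow> 'a \<Rightarrow> 'a set" where
  "N' a b = (if a = b then V else N a b)"

definition tile_lists :: "'a list set" where
  "tile_lists = (\<lambda>((a, b, c), x, y, z). [a, b, c, x, y, z]) `
     (SIGMA (a, b, c):V \<times> V \<times> V. N' a b \<times> N' b c \<times> N' c a)"

lemma N'_props: "finite (N' a b)" "N' a b \<subseteq> V" "a \<in> V \<Longrightarrow> b \<in> V \<Longrightarrow> card V / 3 \<le> card (N' a b)"
  using codeg[of a b] by (auto simp: N'_def finite_V finite_N dest: N_memD)

lemma tile_lists_tile: "vs \<in> tile_lists \<Longrightarrow> distinct vs \<Longrightarrow> tile (set vs)"
  unfolding tile_lists_def
proof clarify
  fix a b c x y z
  assume d: "distinct [a, b, c, x, y, z]" and "x \<in> N' a b" "y \<in> N' b c" "z \<in> N' c a"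
  then have "{a, b, x} \<in> E" "{b, c, y} \<in> E" "{c, a, z} \<in> E" by (auto simp: N'_def N_def)
  then show "tile (set [a, b, c, x, y, z])" using tileI[OF d] by simp
qed

lemma tile_lists_lists: "vs \<in> tile_lists \<Longrightarrow> set vs \<subseteq> V \<and> length vs = 6"
  unfolding tile_lists_def by (auto dest: N'_props(2)[THEN subsetD])

lemma card_tile_lists_ge: "real (card V) ^ 6 / 27 \<le> card tile_lists"
proof -
  define n where "n = real (card V)"
  define P where "P = (\<lambda>(a, b, c). N' a b \<times> N' b c \<times> N' c a)"
  have fP: "finite (P p)" for p using N'_props by (auto simp: P_def split: prod.splits)
  have "n ^ 6 / 27 = (\<Sum>p\<in>V \<times> V \<times> V. n / 3 * (n / 3 * (n / 3)))"
    by (simp add: card_cartesian_product n_def eval_nat_numeral)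
  also have "\<dots> \<le> (\<Sum>p\<in>V \<times> V \<times> V. real (card (P p)))"
  proof (rule sum_mono)
    fix p assume "p \<in> V \<times> V \<times> V"
    then obtain a b c where p: "p = (a, b, c)" "a \<in> V" "b \<in> V" "c \<in> V" by auto
    have "n / 3 * (n / 3 * (n / 3)) \<le> real (card (N' a b)) * (real (card (N' b c)) * real (card (N' c a)))"
      using N'_props(3) p by (intro mult_mono) (auto simp: n_def)
    then show "n / 3 * (n / 3 * (n / 3)) \<le> real (card (P p))"
      by (simp add: P_def p card_cartesian_product)
  qed
  also have "\<dots> = card (Sigma (V \<times> V \<times> V) P)" using finite_V fP by (simp add: card_SigmaI)
  also have "\<dots> = card tile_lists"
    unfolding tile_lists_def
  proof (subst card_image)
    show "inj_on (\<lambda>((a, b, c), x, y, z). [a, b, c, x, y, z]) (SIGMA (a, b, c):V \<times> V \<times> V. N' a b \<times> N' b c \<times> N' c a)"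
      by (auto simp: inj_on_def)
    show "real (card (Sigma (V \<times> V \<times> V) P)) = card (SIGMA (a, b, c):V \<times> V \<times> V. N' a b \<times> N' b c \<times> N' c a)"
      by (simp add: P_def)
  qed
  finally show ?thesis by (simp add: n_def)
qed

text \<open>The six vertices of \<open>us\<close> replace those of the tile \<open>vs\<close>, one by one, in the blocks.\<close>

definition absorbers :: "'a list \<Rightarrow> 'a list set" where
  "absorbers us = (\<lambda>(vs, s). vs @ s) ` (SIGMA vs:tile_lists. blocks us vs)"

text \<open>72 = 6 + 6 * 11: a tile, and eleven further vertices for each of its six.\<close>

lemma absorbers_lists:
  assumes "length us = 6" shows "absorbers us \<subseteq> {xs. set xs \<subseteq> V \<and> length xs = 72}"
proof
  fix xs assume "xs \<in> absorbers us"
  then obtain vs s where "vs \<in> tile_lists" "s \<in> blocks us vs" "xs = vs @ s"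
    by (auto simp: absorbers_def)
  then show "xs \<in> {xs. set xs \<subseteq> V \<and> length xs = 72}"
    using tile_lists_lists[of vs] blocks_lists[of s us vs] assms by simp
qed

text \<open>The blocks can be completed by \<open>vs\<close> as well as by \<open>us\<close>. In the
  first case nothing is left over; in the second \<open>vs\<close> is left over and is itself a
  tile.\<close>

lemma absorbers_tileable:
  assumes "xs \<in> absorbers us" "distinct xs"
  shows "tileable (set xs)" "distinct (us @ xs) \<Longrightarrow> tileable (set us \<union> set xs)"
proof -
  obtain vs s where xs: "vs \<in> tile_lists" "s \<in> blocks us vs" "xs = vs @ s"
    using assms(1) by (auto simp: absorbers_def)
  show "tileable (set xs)" using blocks_tileable(2)[OF xs(2)] assms(2) xs(3) by simp
  show "tileable (set us \<union> set xs)" if d: "distinct (us @ xs)"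
  proof -
    have "tileable (set vs \<union> (set us \<union> set s))"
      by (rule tileable_Un[OF tileable_tile])
        (use d xs tile_lists_tile blocks_tileable(1)[OF xs(2)] in auto)
    also have "set vs \<union> (set us \<union> set s) = set us \<union> set xs" using xs by auto
    finally show ?thesis .
  qed
qed

lemma card_absorbers_ge:
  assumes us: "length us = 6" "set us \<subseteq> V" and big: "10 \<le> card V"
  shows "1 / (27 * (3 * 10 ^ 16) ^ 6) * real (card V) ^ 72 \<le> card (absorbers us)"
proof -
  define n where "n = real (card V)"
  define \<kappa> :: real where "\<kappa> = 3 * 10 ^ 16"
  have inj: "inj_on (\<lambda>(vs, s). vs @ s) (SIGMA vs:tile_lists. blocks us vs)"
  proof (rule inj_onI, clarify)
    fix vs s vs' s' assume *: "vs \<in> tile_lists" "vs' \<in> tile_lists" "vs @ s = vs' @ s'"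
    then have "length vs = length vs'" using tile_lists_lists by metis
    then show "vs = vs' \<and> s = s'" using *(3) by simp
  qed
  have fin: "finite tile_lists" "finite (blocks us vs)" for vs
  proof -
    have "tile_lists \<subseteq> {xs. set xs \<subseteq> V \<and> length xs = 6}" using tile_lists_lists by blast
    then show "finite tile_lists" using finite_lists_length_eq[OF finite_V] finite_subset by blast
    have "blocks us vs \<subseteq> {xs. set xs \<subseteq> V \<and> length xs = 11 * length us}" using blocks_lists by blast
    then show "finite (blocks us vs)" using finite_lists_length_eq[OF finite_V] finite_subset by blast
  qed
  have "1 / (27 * \<kappa> ^ 6) * n ^ 72 = n ^ 6 / 27 * (n ^ 11 / \<kappa>) ^ 6"
    by (simp add: power_divide power_mult[symmetric] power_add[symmetric])
  also have "\<dots> \<le> card tile_lists * (n ^ 11 / \<kappa>) ^ 6"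
    using card_tile_lists_ge by (intro mult_right_mono) (auto simp: n_def \<kappa>_def)
  also have "\<dots> = (\<Sum>vs\<in>tile_lists. (n ^ 11 / \<kappa>) ^ 6)" by simp
  also have "\<dots> \<le> (\<Sum>vs\<in>tile_lists. real (card (blocks us vs)))"
  proof (rule sum_mono)
    fix vs assume "vs \<in> tile_lists"
    then show "(n ^ 11 / \<kappa>) ^ 6 \<le> card (blocks us vs)"
      using card_blocks_ge[of us vs] tile_lists_lists[of vs] us big by (simp add: n_def \<kappa>_def)
  qed
  also have "\<dots> = card (absorbers us)"
    unfolding absorbers_def card_image[OF inj] using fin by (simp add: card_SigmaI)
  finally show ?thesis unfolding \<kappa>_def n_def .
qed

text \<open>\<open>J\<close> holds the lists not yet spent. Every 6-set has more than
  \<open>h\<close> absorbers and each 6-set spends one list, so with at most \<open>h\<close> lists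
  spent altogether an unspent absorber is always at hand.\<close>

lemma absorb_lists:
  assumes Ls: "length Ls = m" "pairwise (\<lambda>j l. set (Ls ! j) \<inter> set (Ls ! l) = {}) {..<m}"
    "\<And>xs. xs \<in> set Ls \<Longrightarrow> distinct xs \<and> tileable (set xs)"
    and hits: "\<And>us. length us = 6 \<Longrightarrow> distinct us \<Longrightarrow> set us \<subseteq> V \<Longrightarrow>
      h < card {j. j < m \<and> Ls ! j \<in> absorbers us}"
    and J: "J \<subseteq> {..<m}" "card ({..<m} - J) + q \<le> h"
    and U: "U \<subseteq> V" "card U = 6 * q" "U \<inter> (\<Union>j<m. set (Ls ! j)) = {}"
  shows "tileable ((\<Union>j\<in>J. set (Ls ! j)) \<union> U)"
  using J U
proof (induction q arbitrary: J U)
  case 0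
  have "finite U" using 0(3) finite_V finite_subset by blast
  then have "U = {}" using 0(4) by simp
  moreover have "tileable (\<Union>j\<in>J. set (Ls ! j))"
    using 0 Ls finite_subset[OF \<open>J \<subseteq> {..<m}\<close>]
    by (intro tileable_UN) (auto simp: disjoint_family_on_def pairwise_def subset_iff)
  ultimately show ?case by simp
next
  case (Suc q)
  have fU: "finite U" using Suc.prems finite_V finite_subset by blast
  have "6 \<le> card U" using Suc.prems by simp
  then obtain U1 where U1: "U1 \<subseteq> U" "card U1 = 6" by (meson obtain_subset_with_card_n)
  have fU1: "finite U1" using U1 fU finite_subset by blast
  obtain us where us: "set us = U1" "distinct us" using finite_distinct_list[OF fU1] by blast
  have "length us = 6" using us U1 distinct_card by fastforce
  moreover have "set us \<subseteq> V" using us U1 Suc.prems by auto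
  ultimately have "h < card {j. j < m \<and> Ls ! j \<in> absorbers us}" using hits us by blast
  then have "card ({..<m} - J) < card {j. j < m \<and> Ls ! j \<in> absorbers us}" using Suc.prems(2) by linarith
  then obtain j where j: "j < m" "Ls ! j \<in> absorbers us" "j \<in> J"
    using card_gt_imp_ex_notin[of "{..<m} - J" "{j. j < m \<and> Ls ! j \<in> absorbers us}"] by auto
  have Lj: "Ls ! j \<in> set Ls" "distinct (Ls ! j)" using j Ls by auto
  have disjU: "U \<inter> set (Ls ! l) = {}" if "l < m" for l using Suc.prems(5) that by blast
  have disjL: "set (Ls ! j) \<inter> set (Ls ! l) = {}" if "l < m" "l \<noteq> j" for l
    using Ls(2) that j by (auto simp: pairwise_def)
  have "distinct (us @ Ls ! j)" using us Lj disjU[OF j(1)] U1 by auto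
  then have t1: "tileable (U1 \<union> set (Ls ! j))" using absorbers_tileable(2)[OF j(2) Lj(2)] us by simp
  have "{..<m} - (J - {j}) = insert j ({..<m} - J)" using j by auto
  then have "card ({..<m} - (J - {j})) = Suc (card ({..<m} - J))" using j by simp
  moreover have "card (U - U1) = 6 * q" using U1 fU1 Suc.prems by (simp add: card_Diff_subset)
  ultimately have t2: "tileable ((\<Union>l\<in>J - {j}. set (Ls ! l)) \<union> (U - U1))"
    using Suc.prems by (intro Suc.IH) auto
  have "(U1 \<union> set (Ls ! j)) \<inter> ((\<Union>l\<in>J - {j}. set (Ls ! l)) \<union> (U - U1)) = {}"
    using disjU disjL U1 Suc.prems(1) j by blast
  then have "tileable ((U1 \<union> set (Ls ! j)) \<union> ((\<Union>l\<in>J - {j}. set (Ls ! l)) \<union> (U - U1)))"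
    by (rule tileable_Un[OF t1 t2])
  also have "(U1 \<union> set (Ls ! j)) \<union> ((\<Union>l\<in>J - {j}. set (Ls ! l)) \<union> (U - U1)) = (\<Union>j\<in>J. set (Ls ! j)) \<union> U"
    using U1 j by auto
  finally show ?case .
qed

lemma absorbing_set_finite:
  fixes \<eta> :: real
  defines "\<eta> \<equiv> 1 / (27 * (3 * 10 ^ 16) ^ 6)"
  assumes big: "10 \<le> card V" and m: "2 * 72\<^sup>2 * (real m + 1) \<le> \<eta> * card V"
    and h: "real (card V) ^ 6 * (1 - \<eta>/4) ^ m < (1/2) ^ h"
  shows "\<exists>W\<subseteq>V. card W \<le> 72 * m \<and> tileable W \<and>
    (\<forall>U\<subseteq>V - W. 6 dvd card U \<longrightarrow> card U \<le> 6 * h \<longrightarrow> tileable (W \<union> U))"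
proof -
  define I where "I = {us. length us = 6 \<and> distinct us \<and> set us \<subseteq> V}"
  have IV: "I \<subseteq> {us. set us \<subseteq> V \<and> length us = 6}" by (auto simp: I_def)
  have fI: "finite I" using IV finite_lists_length_eq[OF finite_V] finite_subset by blast
  have cI: "real (card I) \<le> real (card V) ^ 6"
    using card_mono[OF finite_lists_length_eq[OF finite_V] IV] card_lists_length_eq[OF finite_V, of 6]
    by (metis of_nat_mono of_nat_power)
  have "card I \<noteq> 0"
    using card_lists_distinct_length_eq'[of 6 V] big by (simp add: I_def)
  then have neI: "I \<noteq> {}" by auto
  have \<eta>: "0 < \<eta>" "\<eta> \<le> 1" by (simp_all add: \<eta>_def)
  obtain Ls where Ls: "length Ls = m" "\<And>xs. xs \<in> set Ls \<Longrightarrow> distinct xs \<and> (\<exists>us\<in>I. xs \<in> absorbers us)"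
    "pairwise (\<lambda>j l. set (Ls ! j) \<inter> set (Ls ! l) = {}) {..<m}"
    "(\<Sum>us\<in>I. (1/2) ^ card {j. j < m \<and> Ls ! j \<in> absorbers us}) \<le> card I * (1 - \<eta>/4) ^ m"
    using greedy_selection[OF finite_V fI neI \<eta>, of 72 absorbers m] absorbers_lists card_absorbers_ge big m
    unfolding I_def \<eta>_def by auto
  have t: "distinct xs \<and> tileable (set xs)" if "xs \<in> set Ls" for xs
    using Ls(2)[OF that] absorbers_tileable(1) by blast
  \<comment> \<open>A 6-set with at most \<open>h\<close> hits would alone contribute at least
    \<open>(1/2) ^ h\<close> to the potential, more than the bound on the whole sum.\<close>
  have hits: "h < card {j. j < m \<and> Ls ! j \<in> absorbers us}"
    if "length us = 6" "distinct us" "set us \<subseteq> V" for us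
  proof (rule ccontr)
    assume "\<not> ?thesis"
    then have "(1/2::real) ^ h \<le> (1/2) ^ card {j. j < m \<and> Ls ! j \<in> absorbers us}"
      by (intro power_decreasing) auto
    also have "\<dots> \<le> (\<Sum>us\<in>I. (1/2) ^ card {j. j < m \<and> Ls ! j \<in> absorbers us})"
      using that fI by (intro member_le_sum) (auto simp: I_def)
    also have "\<dots> \<le> card I * (1 - \<eta>/4) ^ m" by (rule Ls(4))
    also have "\<dots> \<le> real (card V) ^ 6 * (1 - \<eta>/4) ^ m" using cI \<eta> by (intro mult_right_mono) auto
    finally show False using h by simp
  qed
  define W where "W = (\<Union>j<m. set (Ls ! j))"
  show ?thesis
  proof (intro exI[of _ W] conjI allI impI)
    have len: "Ls ! j \<in> {xs. set xs \<subseteq> V \<and> length xs = 72}" if "j < m" for j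
      using Ls(1) Ls(2)[of "Ls ! j"] that absorbers_lists by (fastforce simp: I_def)
    then show "W \<subseteq> V" by (auto simp: W_def)
    have "card W \<le> (\<Sum>j<m. card (set (Ls ! j)))" unfolding W_def by (rule card_UN_le) simp
    also have "\<dots> \<le> (\<Sum>j<m. 72)" 
    proof (rule sum_mono)
      fix j assume "j \<in> {..<m}"
      then show "card (set (Ls ! j)) \<le> 72" using len[of j] card_length[of "Ls ! j"] by simp
    qed
    finally show "card W \<le> 72 * m" by simp
    have abs: "tileable (W \<union> U)" if U: "U \<subseteq> V - W" "6 dvd card U" "card U \<le> 6 * h" for U
    proof -
      obtain q where q: "card U = 6 * q" using U(2) by (auto elim: dvdE)
      show ?thesis unfolding W_def
        by (rule absorb_lists[OF Ls(1,3) t hits, where q = q]) (use U q in \<open>auto simp: W_def\<close>)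
    qed
    show "tileable W" using abs[of "{}"] by simp
    show "tileable (W \<union> U)" if "U \<subseteq> V - W" "6 dvd card U" "card U \<le> 6 * h" for U using abs that .
  qed
qed

end

lemma absorbing_set:
  fixes \<omega> :: real
  assumes "0 < \<omega>"
  obtains \<sigma> :: real and n0 :: nat where "0 < \<sigma>"
    "\<And>(V :: 'a set) E. codegree_third V E \<Longrightarrow> n0 \<le> card V \<Longrightarrow>
      \<exists>W\<subseteq>V. card W \<le> \<omega> * card V \<and> three_uniform.tileable E W \<and>
      (\<forall>U\<subseteq>V - W. 6 dvd card U \<longrightarrow> card U \<le> \<sigma> * card V \<longrightarrow> three_uniform.tileable E (W \<union> U))"
proof -
  define \<eta> :: real where "\<eta> = 1 / (27 * (3 * 10 ^ 16) ^ 6)"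
  have \<eta>: "0 < \<eta>" "\<eta> \<le> 1" by (simp_all add: \<eta>_def)
  \<comment> \<open>About \<open>\<beta> * n\<close> lists are selected. The first bound keeps their
    72 entries each within \<open>\<omega> * n\<close> vertices, the second meets the size condition
    of the greedy selection.\<close>
  define \<beta> where "\<beta> = min (\<omega> / 72) (\<eta> / (4 * 72\<^sup>2))"
  have \<beta>: "0 < \<beta>" "72 * \<beta> \<le> \<omega>" "4 * 72\<^sup>2 * \<beta> \<le> \<eta>"
    using assms \<eta> by (auto simp: \<beta>_def min_def field_simps)
  have eta_beta: "0 < \<eta> * \<beta>" using \<eta> \<beta> by simp
  have "eventually (\<lambda>n::nat. 6 * ln (real n) + 1 < \<eta> * \<beta> / 16 * real n) at_top"
    using eta_beta by real_asymp
  moreover have "eventually (\<lambda>n::nat. 16 \<le> \<eta> * \<beta> * real n) at_top" using eta_beta by real_asymp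
  moreover have "eventually (\<lambda>n::nat. 4 * 72\<^sup>2 \<le> \<eta> * real n) at_top" using \<eta> by real_asymp
  moreover have "eventually (\<lambda>n::nat. 2 \<le> \<beta> * real n) at_top" using \<beta> by real_asymp
  moreover have "eventually (\<lambda>n::nat. 10 \<le> n) at_top" by (rule eventually_ge_at_top)
  ultimately have "eventually (\<lambda>n::nat. 6 * ln (real n) + 1 < \<eta> * \<beta> / 16 * real n \<and>
      16 \<le> \<eta> * \<beta> * real n \<and> 4 * 72\<^sup>2 \<le> \<eta> * real n \<and> 2 \<le> \<beta> * real n \<and> 10 \<le> n) at_top"
      (is "eventually ?P _")
    by eventually_elim blast
  then obtain n0 where n0: "\<And>n. n0 \<le> n \<Longrightarrow> ?P n"
    unfolding eventually_at_top_linorder by blast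
  show ?thesis
  proof (rule that[of "\<eta> * \<beta> / 8" n0])
    show "0 < \<eta> * \<beta> / 8" using eta_beta by simp
    fix V :: "'a set" and E
    assume "codegree_third V E" and nV: "n0 \<le> card V"
    then interpret codegree_third V E by simp
    define n where "n = real (card V)"
    have n: "6 * ln n + 1 < \<eta> * \<beta> / 16 * n" "16 \<le> \<eta> * \<beta> * n" "4 * 72\<^sup>2 \<le> \<eta> * n" "2 \<le> \<beta> * n" "10 \<le> card V"
      using n0[OF nV] by (simp_all add: n_def)
    have n1: "0 < n" using n(5) by (simp add: n_def)
    define m where "m = nat \<lfloor>\<beta> * n\<rfloor>"
    have m: "real m \<le> \<beta> * n" "\<beta> * n - 1 < real m" using n(4) unfolding m_def by linarith+
    \<comment> \<open>The least \<open>h\<close> for which \<open>6 * h\<close> covers the promised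
      \<open>\<eta> * \<beta> / 8 * n\<close> vertices. Its order is a sixth of the exponent in
      \<open>exp (- \<eta> * \<beta> * n / 8)\<close>, the bound for the decay of the potential,
      which leaves room for the factor \<open>n ^ 6\<close>.\<close>
    define h where "h = nat \<lceil>\<eta> * \<beta> * n / 48\<rceil>"
    have h: "\<eta> * \<beta> * n / 48 \<le> real h" "real h < \<eta> * \<beta> * n / 48 + 1" using n(2) unfolding h_def by linarith+
    have mm: "2 * 72\<^sup>2 * (real m + 1) \<le> \<eta> * card V"
    proof -
      have "4 * 72\<^sup>2 * (\<beta> * n) \<le> \<eta> * n" using \<beta>(3) n1 by (simp add: mult.assoc[symmetric])
      then show ?thesis using m(1) n(3) unfolding n_def by simp
    qed
    have "\<eta> / 4 * (\<beta> * n / 2) \<le> \<eta> / 4 * real m" using m n(4) \<eta> by (intro mult_left_mono) auto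
    then have mh: "\<eta> * \<beta> * n / 8 \<le> \<eta> / 4 * real m" by simp
    have "n ^ 6 * (1 - \<eta>/4) ^ m \<le> exp (6 * ln n) * exp (- (\<eta>/4)) ^ m"
    proof (rule mult_mono)
      show "n ^ 6 \<le> exp (6 * ln n)" using n1 exp_of_nat_mult[of 6 "ln n"] by simp
      show "(1 - \<eta>/4) ^ m \<le> exp (- (\<eta>/4)) ^ m"
        using \<eta> exp_ge_add_one_self[of "- (\<eta>/4)"] by (intro power_mono) auto
    qed (use \<eta> in auto)
    also have "\<dots> = exp (6 * ln n - \<eta> / 4 * m)"
      by (simp add: exp_of_nat_mult[symmetric] exp_add[symmetric] mult_ac)
    also have "\<dots> < exp (- real h)"
    proof -
      define X where "X = \<eta> * \<beta> * n"
      have "6 * ln n + 1 < X / 16" "X / 8 \<le> \<eta> / 4 * m" "real h < X / 48 + 1" "16 \<le> X"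
        using n(1,2) mh h(2) by (simp_all add: X_def)
      then have "6 * ln n - \<eta> / 4 * m < - real h" by linarith
      then show ?thesis by simp
    qed
    also have "exp (- real h) = exp (-1) ^ h" by (simp add: exp_of_nat_mult[symmetric])
    also have "\<dots> \<le> (1/2) ^ h"
    proof (rule power_mono)
      have "2 \<le> exp (1::real)" using exp_ge_add_one_self[of "1::real"] by simp
      then show "exp (- 1) \<le> (1/2::real)" by (simp add: exp_minus field_simps)
    qed simp
    finally have hh: "real (card V) ^ 6 * (1 - \<eta>/4) ^ m < (1/2) ^ h" by (simp add: n_def)
    obtain W where W: "W \<subseteq> V" "card W \<le> 72 * m" "tileable W"
      "\<And>U. U \<subseteq> V - W \<Longrightarrow> 6 dvd card U \<Longrightarrow> card U \<le> 6 * h \<Longrightarrow> tileable (W \<union> U)"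
      using absorbing_set_finite[OF n(5) mm[unfolded \<eta>_def] hh[unfolded \<eta>_def]] by blast
    show "\<exists>W\<subseteq>V. card W \<le> \<omega> * card V \<and> tileable W \<and>
      (\<forall>U\<subseteq>V - W. 6 dvd card U \<longrightarrow> card U \<le> \<eta> * \<beta> / 8 * card V \<longrightarrow> tileable (W \<union> U))"
    proof (intro exI[of _ W] conjI allI impI)
      have "real (card W) \<le> 72 * (\<beta> * n)" using W(2) m by linarith
      also have "\<dots> \<le> \<omega> * n" using \<beta>(2) n1 by (simp add: mult.assoc[symmetric])
      finally show "card W \<le> \<omega> * card V" by (simp add: n_def)
      fix U assume "U \<subseteq> V - W" "6 dvd card U" "card U \<le> \<eta> * \<beta> / 8 * card V"
      then show "tileable (W \<union> U)" using W(4) h(1) unfolding n_def by simp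
    qed (use W in auto)
  qed
qed

section \<open>Perfect tilings of almost complete structures\<close>

lemma card_PiE_triple_le:
  fixes I :: "'i set" and S :: "'b set"
  assumes "finite I" "finite S" "a \<in> I" "b \<in> I" "c \<in> I" "distinct [a, b, c]"
  shows "card {h \<in> I \<rightarrow>\<^sub>E S. P (h a) (h b) (h c)}
    \<le> card {(x, y, z). x \<in> S \<and> y \<in> S \<and> z \<in> S \<and> P x y z} * card S ^ (card I - 3)"
proof -
  define J where "J = I - {a, b, c}"
  define X where "X = {(x, y, z). x \<in> S \<and> y \<in> S \<and> z \<in> S \<and> P x y z}"
  define \<iota> where "\<iota> = (\<lambda>h :: 'i \<Rightarrow> 'b. ((h a, h b, h c), restrict h J))"
  have X: "X \<subseteq> S \<times> S \<times> S" by (auto simp: X_def)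
  have "card {h \<in> I \<rightarrow>\<^sub>E S. P (h a) (h b) (h c)} \<le> card (X \<times> (J \<rightarrow>\<^sub>E S))"
  proof (rule card_inj_on_le)
    show "inj_on \<iota> {h \<in> I \<rightarrow>\<^sub>E S. P (h a) (h b) (h c)}"
    proof (rule inj_onI)
      fix h g assume h: "h \<in> {h \<in> I \<rightarrow>\<^sub>E S. P (h a) (h b) (h c)}" and g: "g \<in> {h \<in> I \<rightarrow>\<^sub>E S. P (h a) (h b) (h c)}"
        and eq: "\<iota> h = \<iota> g"
      have "h i = g i" if "i \<in> I" for i
      proof (cases "i \<in> J")
        case True
        have "restrict h J i = restrict g J i" using eq by (simp add: \<iota>_def)
        then show ?thesis using True by simp
      next
        case False
        then show ?thesis using eq that by (auto simp: \<iota>_def J_def)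
      qed
      then show "h = g" using h g by (intro PiE_ext[of h I "\<lambda>_. S" g]) auto
    qed
    show "\<iota> ` {h \<in> I \<rightarrow>\<^sub>E S. P (h a) (h b) (h c)} \<subseteq> X \<times> (J \<rightarrow>\<^sub>E S)"
      using assms(3-5) by (auto simp: \<iota>_def X_def J_def PiE_iff split: if_splits)
    show "finite (X \<times> (J \<rightarrow>\<^sub>E S))"
      using assms(1,2) X finite_subset[OF X] by (auto simp: J_def intro!: finite_PiE)
  qed
  also have "\<dots> = card X * card S ^ card J"
    using assms(1) by (simp add: card_cartesian_product card_PiE J_def)
  also have "card J = card I - 3"
    using assms by (auto simp: J_def card_Diff_subset)
  finally show ?thesis by (simp add: X_def)
qed

text \<open>A third coordinate without any condition reduces this to the case of triples.\<close>

lemma card_PiE_pair_le: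
  assumes "finite I" "finite S" "a \<in> I" "b \<in> I" "a \<noteq> b" "3 \<le> card I"
  shows "card {h \<in> I \<rightarrow>\<^sub>E S. P (h a) (h b)}
    \<le> card {(x, y). x \<in> S \<and> y \<in> S \<and> P x y} * card S ^ (card I - 2)"
proof -
  obtain c where c: "c \<in> I" "c \<noteq> a" "c \<noteq> b" using ex_notin_list[of "[a, b]" I] assms by auto
  have "{(x, y, z). x \<in> S \<and> y \<in> S \<and> z \<in> S \<and> P x y} = (\<lambda>((x, y), z). (x, y, z)) ` ({(x, y). x \<in> S \<and> y \<in> S \<and> P x y} \<times> S)"
    by (auto simp: image_iff)
  also have "card \<dots> = card {(x, y). x \<in> S \<and> y \<in> S \<and> P x y} * card S"
    by (subst card_image) (auto simp: inj_on_def card_cartesian_product)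
  finally have "card {(x, y, z). x \<in> S \<and> y \<in> S \<and> z \<in> S \<and> P x y} * card S ^ (card I - 3)
    = card {(x, y). x \<in> S \<and> y \<in> S \<and> P x y} * (card S * card S ^ (card I - 3))" by simp
  also have "card S * card S ^ (card I - 3) = card S ^ (card I - 2)"
    using assms(6) by (simp flip: power_Suc add: Suc_diff_le[symmetric] numeral_eq_Suc)
  finally show ?thesis
    using card_PiE_triple_le[OF assms(1-4) c(1), of "\<lambda>x y z. P x y"] assms(5) c by auto
qed

text \<open>In a group of six vertices, the positions 0, 2, 3 are the corners of the tile; 4 and 5 are the
  remaining vertices of the edges at 0, and 1 that of the edge opposite to 0. In the extremal case the
  positions 0 and 1 are filled from the small part.\<close>

definition roles :: "(nat \<times> nat \<times> nat) set" where
  "roles = {(0, 2, 4), (0, 3, 5), (2, 3, 1)}"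

lemma shift_mod_7_neq:
  assumes "i < 7" "j < 7" "i \<noteq> j"
  shows "(t + i) mod 7 \<noteq> (t + j) mod (7::nat)"
proof
  assume "(t + i) mod 7 = (t + j) mod 7"
  then have "i mod 7 = j mod 7" by (simp add: mod_add_left_eq mod_add_cong nat_mod_eq_iff)
  then show False using assms by simp
qed

section \<open>Mixing a bad group with six others\<close>

context three_uniform begin

definition good_group :: "(nat \<Rightarrow> nat \<Rightarrow> 'a) \<Rightarrow> nat \<Rightarrow> bool" where
  "good_group f s \<longleftrightarrow> (\<forall>(i, j, k)\<in>roles. {f i s, f j s, f k s} \<in> E)"

text \<open>Group \<open>t\<close> takes its position \<open>j\<close> from \<open>h ((t + j) mod 7)\<close>, so that no two of its vertices come from
  the same old group.\<close>

lemma exists_shuffle: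
  fixes \<alpha> :: real
  assumes M: "50 \<le> real M * (1 - 21 * \<alpha>)" "0 \<le> \<alpha>" and g0: "g0 < M"
    and few: "\<And>i j k x. (i, j, k) \<in> roles \<Longrightarrow> x < M \<Longrightarrow>
        card {(y, z). y < M \<and> z < M \<and> {f i x, f j y, f k z} \<notin> E} \<le> \<alpha> * (real M)\<^sup>2 \<and>
        card {(y, z). y < M \<and> z < M \<and> {f i y, f j x, f k z} \<notin> E} \<le> \<alpha> * (real M)\<^sup>2 \<and>
        card {(y, z). y < M \<and> z < M \<and> {f i y, f j z, f k x} \<notin> E} \<le> \<alpha> * (real M)\<^sup>2"
  shows "\<exists>h. h 0 = g0 \<and> inj_on h {..<7} \<and> h ` {..<7} \<subseteq> {..<M} \<and>
    (\<forall>t<7. \<forall>(i, j, k)\<in>roles. {f i (h ((t + i) mod 7)), f j (h ((t + j) mod 7)), f k (h ((t + k) mod 7))} \<in> E)"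
proof -
  define I where "I = {1..<7::nat}"
  define S where "S = {..<M}"
  define \<Omega> where "\<Omega> = I \<rightarrow>\<^sub>E S"
  define H where "H = (\<lambda>(h::nat \<Rightarrow> nat) p. if p = 0 then g0 else h p)"
  have I: "finite I" "card I = 6" "\<And>p. p < 7 \<Longrightarrow> p \<noteq> 0 \<Longrightarrow> p \<in> I" by (auto simp: I_def)
  have S: "finite S" "card S = M" by (auto simp: S_def)
  have M0: "0 < M" using g0 by simp
  have \<Omega>: "finite \<Omega>" "card \<Omega> = M ^ 6" using I S by (auto simp: \<Omega>_def card_PiE intro!: finite_PiE)
  define T where "T = {(p, q). p < q \<and> q < (7::nat)}"
  define B1 where "B1 = (\<lambda>(p, q). {h \<in> \<Omega>. H h p = H h q})"
  define B2 where "B2 = (\<lambda>(t, i, j, k). {h \<in> \<Omega>. {f i (H h ((t + i) mod 7)), f j (H h ((t + j) mod 7)), f k (H h ((t + k) mod 7))} \<notin> E})"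
  have "T \<subseteq> {..<7} \<times> {..<7}" by (auto simp: T_def)
  then have T: "finite T" "card T \<le> 49"
    using finite_subset card_mono[of "{..<7::nat} \<times> {..<7::nat}" T] by (auto simp: card_cartesian_product)
  have c1: "card (B1 r) \<le> M ^ 5" if rT: "r \<in> T" for r
  proof -
    obtain p q where r: "r = (p, q)" "p < q" "q < 7" using rT by (auto simp: T_def)
    have q: "q \<in> I" using r I by auto
    have M5: "M * M ^ 4 = M ^ 5" by (simp add: eval_nat_numeral)
    show ?thesis
    proof (cases "p = 0")
      case True
      obtain c where c: "c \<in> I" "c \<noteq> q" using ex_notin_list[of "[q]" I] I by auto
      have "card {h \<in> \<Omega>. g0 = h q} \<le> card {(x, y). x \<in> S \<and> y \<in> S \<and> g0 = x} * card S ^ (card I - 2)"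
        unfolding \<Omega>_def by (rule card_PiE_pair_le[of I S q c "\<lambda>x y. g0 = x"]) (use I S q c in auto)
      also have "{(x, y). x \<in> S \<and> y \<in> S \<and> g0 = x} = {g0} \<times> S" using g0 by (auto simp: S_def)
      finally show ?thesis using r True S I M5 by (simp add: B1_def H_def card_cartesian_product)
    next
      case False
      then have p: "p \<in> I" using r I by auto
      have "card {h \<in> \<Omega>. h p = h q} \<le> card {(x, y). x \<in> S \<and> y \<in> S \<and> x = y} * card S ^ (card I - 2)"
        unfolding \<Omega>_def by (rule card_PiE_pair_le[of I S p q "\<lambda>x y. x = y"]) (use I S p q r in auto)
      also have "{(x, y). x \<in> S \<and> y \<in> S \<and> x = y} = (\<lambda>x. (x, x)) ` S" by auto
      also have "card \<dots> = M" using S by (subst card_image) (auto simp: inj_on_def)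
      finally show ?thesis using r False S I M5 by (simp add: B1_def H_def)
    qed
  qed
  have c2: "real (card (B2 (t, i, j, k))) \<le> \<alpha> * real M ^ 6" if "t < 7" "(i, j, k) \<in> roles" for t i j k
  proof -
    define p where "p = (t + i) mod 7"
    define q where "q = (t + j) mod 7"
    define r where "r = (t + k) mod 7"
    have lt: "p < 7" "q < 7" "r < 7" by (auto simp: p_def q_def r_def)
    have ijk: "i < 7" "j < 7" "k < 7" "i \<noteq> j" "i \<noteq> k" "j \<noteq> k" using that by (auto simp: roles_def)
    have dist: "p \<noteq> q" "p \<noteq> r" "q \<noteq> r"
      unfolding p_def q_def r_def using ijk by (simp_all add: shift_mod_7_neq)
    have B2: "B2 (t, i, j, k) = {h \<in> \<Omega>. {f i (H h p), f j (H h q), f k (H h r)} \<notin> E}"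
      by (simp add: B2_def p_def q_def r_def)
    have M24: "real (M ^ 4) * (\<alpha> * (real M)\<^sup>2) = \<alpha> * real M ^ 6"
      by (simp add: power_add[symmetric])
    have pair: "real (card {h \<in> \<Omega>. P (h a) (h b)}) \<le> \<alpha> * real M ^ 6"
      if "a \<in> I" "b \<in> I" "a \<noteq> b" and P: "card {(y, z). y < M \<and> z < M \<and> P y z} \<le> \<alpha> * (real M)\<^sup>2" for P a b
    proof -
      have "card {h \<in> \<Omega>. P (h a) (h b)} \<le> card {(x, y). x \<in> S \<and> y \<in> S \<and> P x y} * card S ^ (card I - 2)"
        unfolding \<Omega>_def by (rule card_PiE_pair_le[of I S a b P]) (use I S that in auto)
      also have "\<dots> = M ^ 4 * card {(y, z). y < M \<and> z < M \<and> P y z}" using S I by (simp add: S_def)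
      finally have "real (card {h \<in> \<Omega>. P (h a) (h b)}) \<le> real (M ^ 4 * card {(y, z). y < M \<and> z < M \<and> P y z})"
        by (rule of_nat_mono)
      also have "\<dots> = real (M ^ 4) * card {(y, z). y < M \<and> z < M \<and> P y z}" by (rule of_nat_mult)
      also have "\<dots> \<le> real (M ^ 4) * (\<alpha> * (real M)\<^sup>2)" using P by (intro mult_left_mono) auto
      also have "\<dots> = \<alpha> * real M ^ 6" by (rule M24)
      finally show ?thesis .
    qed
    \<comment> \<open>The group \<open>g0\<close> is fixed and the other six are random. At most one
      of the three vertices comes from \<open>g0\<close>, and then the missing triples through that
      very vertex count; hence \<open>few\<close> bounds them for each single vertex and not only in
      total.\<close>
    consider "p = 0" | "q = 0" | "r = 0" | "p \<noteq> 0" "q \<noteq> 0" "r \<noteq> 0" by blast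
    then show ?thesis
    proof cases
      case 1
      then show ?thesis unfolding B2
        using pair[of q r "\<lambda>y z. {f i g0, f j y, f k z} \<notin> E"] few[OF that(2) g0] dist I lt by (simp add: H_def)
    next
      case 2
      then show ?thesis unfolding B2
        using pair[of p r "\<lambda>y z. {f i y, f j g0, f k z} \<notin> E"] few[OF that(2) g0] dist I lt by (simp add: H_def)
    next
      case 3
      then show ?thesis unfolding B2
        using pair[of p q "\<lambda>y z. {f i y, f j z, f k g0} \<notin> E"] few[OF that(2) g0] dist I lt by (simp add: H_def)
    next
      case 4
      define X where "X = {(x, y, z). x \<in> S \<and> y \<in> S \<and> z \<in> S \<and> {f i x, f j y, f k z} \<notin> E}"
      have "X = (SIGMA x:S. {(y, z). y < M \<and> z < M \<and> {f i x, f j y, f k z} \<notin> E})"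
        by (auto simp: X_def S_def)
      moreover have "finite {(y, z). y < M \<and> z < M \<and> {f i x, f j y, f k z} \<notin> E}" for x
        by (rule finite_subset[of _ "{..<M} \<times> {..<M}"]) auto
      ultimately have "real (card X) = (\<Sum>x\<in>S. real (card {(y, z). y < M \<and> z < M \<and> {f i x, f j y, f k z} \<notin> E}))"
        using S by (simp add: card_SigmaI)
      also have "\<dots> \<le> (\<Sum>x\<in>S. \<alpha> * (real M)\<^sup>2)" using few[OF that(2)] by (intro sum_mono) (auto simp: S_def)
      finally have X: "real (card X) \<le> M * (\<alpha> * (real M)\<^sup>2)" using S by simp
      have "card {h \<in> \<Omega>. {f i (h p), f j (h q), f k (h r)} \<notin> E} \<le> card X * card S ^ (card I - 3)"
        unfolding \<Omega>_def X_def by (rule card_PiE_triple_le[of I S p q r "\<lambda>x y z. {f i x, f j y, f k z} \<notin> E"]) (use I S dist lt 4 in auto)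
      then have "real (card {h \<in> \<Omega>. {f i (h p), f j (h q), f k (h r)} \<notin> E}) \<le> real (card X) * real M ^ 3"
        using I S by (simp flip: of_nat_mult of_nat_power)
      also have "\<dots> \<le> M * (\<alpha> * (real M)\<^sup>2) * real M ^ 3" using X by (intro mult_right_mono) auto
      also have "\<dots> = \<alpha> * real M ^ 6" by (simp add: eval_nat_numeral)
      finally show ?thesis unfolding B2 using 4 by (simp add: H_def)
    qed
  qed
  define Q where "Q = {..<7::nat} \<times> roles"
  have Q: "finite Q" "card Q = 21" by (simp_all add: Q_def roles_def card_cartesian_product)
  have finB: "finite (B1 r)" "finite (B2 r')" for r r' using \<Omega> by (auto simp: B1_def B2_def split: prod.splits)
  have "\<exists>h\<in>\<Omega>. h \<notin> (\<Union>r\<in>T. B1 r) \<union> (\<Union>r\<in>Q. B2 r)"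
  proof (rule card_gt_imp_ex_notin)
    show "finite ((\<Union>r\<in>T. B1 r) \<union> (\<Union>r\<in>Q. B2 r))" using T Q finB by auto
    have "card ((\<Union>r\<in>T. B1 r) \<union> (\<Union>r\<in>Q. B2 r)) \<le> (\<Sum>r\<in>T. card (B1 r)) + (\<Sum>r\<in>Q. card (B2 r))"
      using card_Un_le card_UN_le[OF T(1), of B1] card_UN_le[OF Q(1), of B2] by (meson add_mono le_trans)
    then have "real (card ((\<Union>r\<in>T. B1 r) \<union> (\<Union>r\<in>Q. B2 r)))
      \<le> real (\<Sum>r\<in>T. card (B1 r)) + (\<Sum>r\<in>Q. real (card (B2 r)))"
      using of_nat_mono by (fastforce simp flip: of_nat_sum of_nat_add)
    also have "\<dots> \<le> real (\<Sum>r\<in>T. M ^ 5) + (\<Sum>r\<in>Q. \<alpha> * real M ^ 6)"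
      by (intro add_mono of_nat_mono sum_mono c1) (use c2 in \<open>auto simp: Q_def\<close>)
    also have "\<dots> \<le> 49 * real M ^ 5 + 21 * (\<alpha> * real M ^ 6)" using T Q by (simp add: mult_right_mono)
    \<comment> \<open>At most 49 coincidences between groups have to be excluded and 21 = 7 * 3
      edges have to be present.\<close>
    also have "\<dots> < real M ^ 6"
    proof -
      have "49 * real M ^ 5 < real M ^ 5 * (real M * (1 - 21 * \<alpha>))" using M M0 by simp
      also have "\<dots> = real M ^ 6 - 21 * (\<alpha> * real M ^ 6)" by (simp add: algebra_simps eval_nat_numeral)
      finally show ?thesis by simp
    qed
    finally show "card ((\<Union>r\<in>T. B1 r) \<union> (\<Union>r\<in>Q. B2 r)) < card \<Omega>" using \<Omega> by (metis of_nat_less_iff of_nat_power)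
  qed
  then obtain h where h: "h \<in> \<Omega>" "\<And>r. r \<in> T \<Longrightarrow> h \<notin> B1 r" "\<And>r. r \<in> Q \<Longrightarrow> h \<notin> B2 r" by blast
  show ?thesis
  proof (intro exI[of _ "H h"] conjI)
    show "H h 0 = g0" by (simp add: H_def)
    have "H h p \<noteq> H h q" if "p < q" "q < 7" for p q
      using h(1) h(2)[of "(p, q)"] that by (auto simp: T_def B1_def)
    then show "inj_on (H h) {..<7}" by (intro linorder_inj_onI) auto
    show "H h ` {..<7} \<subseteq> {..<M}" using h(1) g0 I(3) by (auto simp: H_def \<Omega>_def S_def PiE_iff)
    show "\<forall>t<7. \<forall>(i, j, k)\<in>roles. {f i (H h ((t + i) mod 7)), f j (H h ((t + j) mod 7)), f k (H h ((t + k) mod 7))} \<in> E"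
      using h(1,3) by (fastforce simp: Q_def B2_def)
  qed
qed

text \<open>\<open>f j s\<close> is the vertex of \<open>S j\<close> in group \<open>s\<close>, and
  \<open>f\<close> is chosen with as many good groups as possible. Mixing a bad group with six
  others makes all seven good and leaves the rest untouched, so the number of good groups would rise
  even if the other six had been good before.\<close>

lemma shuffle_tileable:
  fixes \<alpha> :: real and S :: "nat \<Rightarrow> 'a set"
  assumes S: "\<And>j. j < 6 \<Longrightarrow> finite (S j) \<and> card (S j) = M" and disj: "disjoint_family_on S {..<6}"
    and M: "50 \<le> real M * (1 - 21 * \<alpha>)" "0 \<le> \<alpha>"
    and few: "\<And>i j k v. (i, j, k) \<in> roles \<Longrightarrow>
        (v \<in> S i \<longrightarrow> card {(y, z). y \<in> S j \<and> z \<in> S k \<and> {v, y, z} \<notin> E} \<le> \<alpha> * (real M)\<^sup>2) \<and>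
        (v \<in> S j \<longrightarrow> card {(y, z). y \<in> S i \<and> z \<in> S k \<and> {y, v, z} \<notin> E} \<le> \<alpha> * (real M)\<^sup>2) \<and>
        (v \<in> S k \<longrightarrow> card {(y, z). y \<in> S i \<and> z \<in> S j \<and> {y, z, v} \<notin> E} \<le> \<alpha> * (real M)\<^sup>2)"
  shows "tileable (\<Union>j<6. S j)"
proof -
  define P where "P = (\<lambda>f. \<forall>j<6. bij_betw (f j) {..<M} (S j))"
  define G where "G = (\<lambda>f. card {s. s < M \<and> good_group f s})"
  have "\<exists>g. bij_betw g {..<M} (S j)" if "j < 6" for j
    using ex_bij_betw_nat_finite[of "S j"] S[OF that] by (auto simp: atLeast0LessThan)
  then have "\<forall>j\<in>{..<6}. \<exists>g. bij_betw g {..<M} (S j)" by blast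
  from bchoice[OF this] obtain f0 where "\<forall>j\<in>{..<6}. bij_betw (f0 j) {..<M} (S j)" ..
  then have Pf0: "P f0" by (simp add: P_def)
  have "G f \<le> M" for f
    unfolding G_def using card_mono[of "{..<M}" "{s. s < M \<and> good_group f s}"] by auto
  then have "\<forall>f. P f \<longrightarrow> G f < Suc M" by (simp add: less_Suc_eq_le)
  from ex_has_greatest_nat[OF Pf0 this]
  obtain f where Pf: "P f" and max: "\<And>f'. P f' \<Longrightarrow> G f' \<le> G f" by blast
  have bij: "bij_betw (f j) {..<M} (S j)" if "j < 6" for j using Pf that by (simp add: P_def)
  have mem: "f j x \<in> S j" if "j < 6" "x < M" for j x
    using bij_betwE[OF bij[OF that(1)]] that(2) by simp
  have roles6: "i < 6 \<and> j < 6 \<and> k < 6" if "(i, j, k) \<in> roles" for i j k using that by (auto simp: roles_def)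
  have transfer: "card {(y, z). y < M \<and> z < M \<and> Q (f j y) (f k z)} \<le> \<alpha> * (real M)\<^sup>2"
    if jk: "j < 6" "k < 6" and Q: "card {(y, z). y \<in> S j \<and> z \<in> S k \<and> Q y z} \<le> \<alpha> * (real M)\<^sup>2" for Q j k
  proof -
    have "card {(y, z). y < M \<and> z < M \<and> Q (f j y) (f k z)} \<le> card {(y, z). y \<in> S j \<and> z \<in> S k \<and> Q y z}"
    proof (rule card_inj_on_le[of "map_prod (f j) (f k)"])
      have "inj_on (map_prod (f j) (f k)) ({..<M} \<times> {..<M})"
        using bij[OF jk(1)] bij[OF jk(2)] by (intro map_prod_inj_on) (auto simp: bij_betw_def)
      then show "inj_on (map_prod (f j) (f k)) {(y, z). y < M \<and> z < M \<and> Q (f j y) (f k z)}"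
        by (rule inj_on_subset) auto
      show "map_prod (f j) (f k) ` {(y, z). y < M \<and> z < M \<and> Q (f j y) (f k z)} \<subseteq> {(y, z). y \<in> S j \<and> z \<in> S k \<and> Q y z}"
        using mem[OF jk(1)] mem[OF jk(2)] by auto
      show "finite {(y, z). y \<in> S j \<and> z \<in> S k \<and> Q y z}"
        using S jk by (auto intro: finite_subset[of _ "S j \<times> S k"])
    qed
    then show ?thesis using Q by linarith
  qed
  have all_good: "good_group f s" if "s < M" for s
  proof (rule ccontr)
    assume bad: "\<not> good_group f s"
    obtain h where h: "h 0 = s" "inj_on h {..<7}" "h ` {..<7} \<subseteq> {..<M}"
      and hg: "\<And>t i j k. t < 7 \<Longrightarrow> (i, j, k) \<in> roles \<Longrightarrow>
        {f i (h ((t + i) mod 7)), f j (h ((t + j) mod 7)), f k (h ((t + k) mod 7))} \<in> E"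
    proof -
      have "\<exists>h. h 0 = s \<and> inj_on h {..<7} \<and> h ` {..<7} \<subseteq> {..<M} \<and>
        (\<forall>t<7. \<forall>(i, j, k)\<in>roles. {f i (h ((t + i) mod 7)), f j (h ((t + j) mod 7)), f k (h ((t + k) mod 7))} \<in> E)"
      proof (rule exists_shuffle[OF M \<open>s < M\<close>])
        fix i j k x assume r: "(i, j, k) \<in> roles" and x: "x < M"
        note l = roles6[OF r]
        show "card {(y, z). y < M \<and> z < M \<and> {f i x, f j y, f k z} \<notin> E} \<le> \<alpha> * (real M)\<^sup>2 \<and>
          card {(y, z). y < M \<and> z < M \<and> {f i y, f j x, f k z} \<notin> E} \<le> \<alpha> * (real M)\<^sup>2 \<and>
          card {(y, z). y < M \<and> z < M \<and> {f i y, f j z, f k x} \<notin> E} \<le> \<alpha> * (real M)\<^sup>2"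
          using few[OF r, of "f i x"] few[OF r, of "f j x"] few[OF r, of "f k x"] l mem[OF _ x]
            transfer[of j k "\<lambda>y z. {f i x, y, z} \<notin> E"]
            transfer[of i k "\<lambda>y z. {y, f j x, z} \<notin> E"] transfer[of i j "\<lambda>y z. {y, z, f k x} \<notin> E"]
          by simp
      qed
      then obtain h where "h 0 = s" "inj_on h {..<7}" "h ` {..<7} \<subseteq> {..<M}"
        "\<forall>t<7. \<forall>(i, j, k)\<in>roles. {f i (h ((t + i) mod 7)), f j (h ((t + j) mod 7)), f k (h ((t + k) mod 7))} \<in> E"
        by blast
      then show ?thesis using that[of h] by blast
    qed
    define H where "H = h ` {..<7}"
    have hM: "h (p mod 7) < M" for p using h(3) by (auto simp: image_subset_iff)
    \<comment> \<open>Among the seven chosen groups the vertices at position \<open>j\<close> are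
      rotated by \<open>j\<close> places; nothing else moves. Each \<open>\<pi> j\<close> is a
      permutation, so the classes \<open>S j\<close> stay exactly covered.\<close>
    define \<pi> where "\<pi> = (\<lambda>j s. if s \<in> H then h ((inv_into {..<7} h s + j) mod 7) else s)"
    have \<pi>h: "\<pi> j (h t) = h ((t + j) mod 7)" if "t < 7" for j t
      using that h(2) by (simp add: \<pi>_def H_def)
    have \<pi>bij: "bij_betw (\<pi> j) {..<M} {..<M}" if "j < 6" for j
    proof -
      have into: "\<pi> j ` {..<M} \<subseteq> {..<M}" using hM by (auto simp: \<pi>_def)
      have "inj_on (\<pi> j) {..<M}"
      proof (rule inj_onI)
        fix x y assume xy: "\<pi> j x = \<pi> j y"
        have inH: "\<pi> j z \<in> H \<longleftrightarrow> z \<in> H" for z by (auto simp: \<pi>_def H_def)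
        show "x = y"
        proof (cases "x \<in> H")
          case True
          then have "y \<in> H" using inH xy by metis
          then obtain p q where pq: "x = h p" "p < 7" "y = h q" "q < 7" using True by (auto simp: H_def)
          then have "h ((p + j) mod 7) = h ((q + j) mod 7)" using xy \<pi>h by simp
          then have "(j + p) mod 7 = (j + q) mod 7"
            using inj_onD[OF h(2)] by (simp add: add.commute)
          then show ?thesis using shift_mod_7_neq[of p q j] pq by blast
        next
          case False
          then have "y \<notin> H" using inH xy by metis
          then show ?thesis using False xy by (simp add: \<pi>_def)
        qed
      qed
      then show ?thesis using endo_inj_surj[OF _ into] by (simp add: bij_betw_def)
    qed
    define f' where "f' = (\<lambda>j. f j \<circ> \<pi> j)"
    have "P f'" unfolding P_def f'_def using bij \<pi>bij bij_betw_trans by blast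
    then have "G f' \<le> G f" by (rule max)
    moreover have "G f < G f'"
      unfolding G_def
    proof (rule psubset_card_mono)
      have new: "good_group f' (h t)" if "t < 7" for t
        using hg[OF that] \<pi>h[OF that] unfolding good_group_def f'_def by auto
      have old: "good_group f' x \<longleftrightarrow> good_group f x" if "x \<notin> H" for x
        using that by (simp add: good_group_def f'_def \<pi>_def)
      have "good_group f' x" if "good_group f x" for x
        using that new old by (cases "x \<in> H") (auto simp: H_def)
      moreover have "good_group f' s" using new[of 0] h(1) by simp
      ultimately show "{s. s < M \<and> good_group f s} \<subset> {s. s < M \<and> good_group f' s}"
        using bad \<open>s < M\<close> by blast
    qed simp
    ultimately show False by simp
  qed
  have Sdisj: "S i \<inter> S j = {}" if "i < 6" "j < 6" "i \<noteq> j" for i j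
    using disj that by (auto simp: disjoint_family_on_def)
  have neq: "f i x \<noteq> f j y" if "i < 6" "j < 6" "i \<noteq> j" "x < M" "y < M" for i j x y
    using Sdisj[OF that(1-3)] mem[OF that(1,4)] mem[OF that(2,5)] by auto
  have inj: "f j x \<noteq> f j y" if "j < 6" "x < M" "y < M" "x \<noteq> y" for j x y
    using bij[OF that(1)] that by (auto simp: bij_betw_def inj_on_def)
  define B where "B = (\<lambda>s. (\<lambda>j. f j s) ` {..<6})"
  have "tileable (B s)" if "s < M" for s
  proof (rule tileable_tile)
    have "{f 0 s, f 2 s, f 4 s} \<in> E" "{f 0 s, f 3 s, f 5 s} \<in> E" "{f 2 s, f 3 s, f 1 s} \<in> E"
      using all_good[OF that] by (auto simp: good_group_def roles_def)
    moreover have "distinct [f 0 s, f 2 s, f 3 s, f 4 s, f 1 s, f 5 s]" using neq that by auto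
    ultimately have "tile {f 0 s, f 2 s, f 3 s, f 4 s, f 1 s, f 5 s}"
      by (intro tileI) (auto simp: insert_commute)
    moreover have "B s = {f 0 s, f 2 s, f 3 s, f 4 s, f 1 s, f 5 s}"
      by (auto simp: B_def lessThan_Suc numeral_eq_Suc)
    ultimately show "tile (B s)" by simp
  qed
  moreover have "disjoint_family_on B {..<M}"
    using neq inj unfolding disjoint_family_on_def B_def by (auto; metis)
  ultimately have "tileable (\<Union>s<M. B s)" by (intro tileable_UN) auto
  also have "(\<Union>s<M. B s) = (\<Union>j<6. f j ` {..<M})" by (auto simp: B_def)
  also have "\<dots> = (\<Union>j<6. S j)" using bij by (intro SUP_cong) (auto simp: bij_betw_def)
  finally show ?thesis .
qed

end

section \<open>The extremal case\<close>

lemma card_pairs_eq_sum: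
  assumes "finite A" "finite B"
  shows "card {(x, a). x \<in> B \<and> a \<in> A \<and> P x a} = (\<Sum>a\<in>A. card {x \<in> B. P x a})"
proof -
  have "{(x, a). x \<in> B \<and> a \<in> A \<and> P x a} = (SIGMA x:B. {a \<in> A. P x a})" by auto
  then have "card {(x, a). x \<in> B \<and> a \<in> A \<and> P x a} = (\<Sum>x\<in>B. card {a \<in> A. P x a})"
    using assms by (simp add: card_SigmaI)
  then show ?thesis using sum_card_swap[OF assms(2,1), of P] by simp
qed

lemma card_pairs_swap: "card {(x, a). x \<in> B \<and> a \<in> A \<and> P x a} = card {(a, x). a \<in> A \<and> x \<in> B \<and> P x a}"
proof -
  have "{(a, x). a \<in> A \<and> x \<in> B \<and> P x a} = prod.swap ` {(x, a). x \<in> B \<and> a \<in> A \<and> P x a}" by auto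
  then show ?thesis by (simp add: card_image)
qed

lemma markov_card:
  fixes t :: real
  assumes "finite A" "finite B"
  shows "t * card {a \<in> A. t \<le> card {x \<in> B. P x a}} \<le> card {(x, a). x \<in> B \<and> a \<in> A \<and> P x a}"
proof -
  define A' where "A' = {a \<in> A. t \<le> card {x \<in> B. P x a}}"
  have "t * card A' = (\<Sum>a\<in>A'. t)" by simp
  also have "\<dots> \<le> (\<Sum>a\<in>A'. real (card {x \<in> B. P x a}))" by (rule sum_mono) (simp add: A'_def)
  also have "\<dots> \<le> (\<Sum>a\<in>A. real (card {x \<in> B. P x a}))" using assms by (intro sum_mono2) (auto simp: A'_def)
  also have "\<dots> = card {(x, a). x \<in> B \<and> a \<in> A \<and> P x a}" using card_pairs_eq_sum[OF assms, of P] by simp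
  finally show ?thesis by (simp add: A'_def)
qed

section \<open>Disjoint tiles around prescribed cores, and matchings\<close>

context three_uniform begin

text \<open>The core \<open>C i\<close> is the set that the tile of \<open>i\<close> has to contain.
  The other cores are tiled first, with \<open>C i\<close> added to the forbidden set, and then a
  tile is found around \<open>C i\<close>; \<open>m\<close> bounds the number of forbidden vertices
  at every stage.\<close>

lemma greedy_tiles:
  assumes "finite I" "finite Z"
    and ext: "\<And>i Z. i \<in> I \<Longrightarrow> finite Z \<Longrightarrow> card Z \<le> m \<Longrightarrow> Z \<inter> C i = {} \<Longrightarrow>
      \<exists>T. tile T \<and> C i \<subseteq> T \<and> T \<inter> Z = {} \<and> P T"
    and core: "disjoint_family_on C I" "\<And>i. i \<in> I \<Longrightarrow> card (C i) \<le> 6 \<and> finite (C i) \<and> Z \<inter> C i = {}"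
    and m: "card Z + 6 * card I \<le> m"
  shows "\<exists>T. (\<forall>i\<in>I. tile (T i) \<and> C i \<subseteq> T i \<and> T i \<inter> Z = {} \<and> P (T i)) \<and> disjoint_family_on T I"
  using assms
proof (induction I arbitrary: Z rule: finite_induct)
  case empty
  then show ?case by (simp add: disjoint_family_on_def)
next
  case (insert i I)
  have Ci: "card (C i) \<le> 6" "finite (C i)" "Z \<inter> C i = {}" using insert.prems(4) by auto
  have "card (Z \<union> C i) \<le> card Z + 6" using card_Un_le[of Z "C i"] Ci by linarith
  then have "card (Z \<union> C i) + 6 * card I \<le> m" using insert.prems(5) insert.hyps by simp
  moreover have "(Z \<union> C i) \<inter> C j = {}" if "j \<in> I" for j
    using insert.prems(3,4) insert.hyps that by (auto simp: disjoint_family_on_def)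
  moreover have "disjoint_family_on C I" using insert.prems(3) by (auto simp: disjoint_family_on_def)
  ultimately obtain T where T: "\<And>j. j \<in> I \<Longrightarrow> tile (T j) \<and> C j \<subseteq> T j \<and> T j \<inter> (Z \<union> C i) = {} \<and> P (T j)"
    "disjoint_family_on T I"
    using insert.IH[of "Z \<union> C i"] insert.prems Ci(2) by (metis finite_Un insertI2)
  define Z' where "Z' = Z \<union> (\<Union>j\<in>I. T j)"
  have "card (\<Union>j\<in>I. T j) \<le> (\<Sum>j\<in>I. card (T j))" by (rule card_UN_le[OF insert.hyps(1)])
  also have "\<dots> = (\<Sum>j\<in>I. 6)" using T(1) tile_card by (intro sum.cong) auto
  finally have "card Z' \<le> m"
    using card_Un_le[of Z "\<Union>j\<in>I. T j"] insert.prems(5) insert.hyps unfolding Z'_def by simp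
  moreover have "finite Z'" using insert.prems(1) insert.hyps T(1) tile_finite by (auto simp: Z'_def)
  moreover have "Z' \<inter> C i = {}" using Ci(3) T(1) by (auto simp: Z'_def)
  ultimately obtain Ti where Ti: "tile Ti" "C i \<subseteq> Ti" "Ti \<inter> Z' = {}" "P Ti"
    using insert.prems(2)[of i Z'] by auto
  show ?case
  proof (intro exI[of _ "T(i := Ti)"] conjI ballI)
    fix j assume "j \<in> insert i I"
    then show "tile ((T(i := Ti)) j)" "C j \<subseteq> (T(i := Ti)) j" "(T(i := Ti)) j \<inter> Z = {}" "P ((T(i := Ti)) j)"
      using T(1)[of j] Ti by (auto simp: Z'_def)
  next
    show "disjoint_family_on (T(i := Ti)) (insert i I)"
      using T(2) Ti(3) insert.hyps by (auto simp: disjoint_family_on_def Z'_def)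
  qed
qed

text \<open>Let \<open>M\<close> be a maximum matching with fewer than \<open>k\<close> edges and
  \<open>R\<close> the part of \<open>B\<close> that it leaves uncovered. By maximality all
  neighbours in \<open>B\<close> of a pair from \<open>R\<close> lie on \<open>M\<close>, so some
  \<open>e \<in> M\<close> contains on average more than one neighbour per pair. Hence one vertex
  \<open>x\<close> of \<open>e\<close> forms edges with more than a third of the pairs and another
  vertex \<open>y\<close> with at least one. Disjoint pairs for \<open>x\<close> and
  \<open>y\<close> give two edges that replace \<open>e\<close>.\<close>

lemma exists_matching:
  assumes B: "B \<subseteq> V" "3 * k + 13 \<le> card B"
    and deg: "\<And>p q. p \<in> B \<Longrightarrow> q \<in> B \<Longrightarrow> p \<noteq> q \<Longrightarrow> k \<le> card (N p q \<inter> B)"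
  shows "\<exists>M\<subseteq>E. card M = k \<and> (\<forall>e\<in>M. e \<subseteq> B) \<and> disjoint M"
proof -
  have fB: "finite B" using B finite_V finite_subset by blast
  define good where "good = (\<lambda>M. M \<subseteq> E \<and> (\<forall>e\<in>M. e \<subseteq> B) \<and> disjoint M \<and> card M \<le> k)"
  have "good {}" by (simp add: good_def)
  moreover have "\<forall>M. good M \<longrightarrow> card M < Suc k" by (simp add: good_def)
  ultimately obtain M where M: "good M" and max: "\<And>M'. good M' \<Longrightarrow> card M' \<le> card M"
    using ex_has_greatest_nat[of good "{}" card "Suc k"] by blast
  have ME: "M \<subseteq> E" "\<And>e. e \<in> M \<Longrightarrow> e \<subseteq> B" "disjoint M" "card M \<le> k" using M by (auto simp: good_def)
  have "M \<subseteq> Pow B" using ME by auto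
  then have fM: "finite M" using fB finite_subset by blast
  show ?thesis
  proof (cases "card M = k")
    case True
    then show ?thesis using ME by blast
  next
    case False
    then have j: "card M < k" using ME by simp
    define X where "X = \<Union>M"
    have c3: "card e = 3" "finite e" if "e \<in> M" for e
      using edge_card[of e] ME(1) ME(2)[OF that] that fB finite_subset[of e B] by auto
    have "card X = (\<Sum>e\<in>M. card e)" unfolding X_def
      using ME(3) c3(2) by (intro card_Union_disjoint) (auto simp: disjoint_def pairwise_def disjnt_def)
    then have cX: "card X = 3 * card M" using c3 by simp
    have fX: "finite X" "X \<subseteq> B" using fM c3 ME(2) unfolding X_def by blast+
    define R where "R = B - X"
    have fR: "finite R" using fB by (simp add: R_def)
    have "card B - card X \<le> card R" unfolding R_def by (rule diff_card_le_card_Diff[OF fX(1)])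
    then have r13: "13 \<le> card R" using B(2) cX j by linarith
    have inX: "z \<in> X" if "p \<in> R" "q \<in> R" "{p, q, z} \<in> E" "z \<in> B" for p q z
    proof (rule ccontr)
      assume "z \<notin> X"
      then have "{p, q, z} \<inter> X = {}" "{p, q, z} \<subseteq> B" using that by (auto simp: R_def)
      moreover from this have "{p, q, z} \<notin> M" by (auto simp: X_def)
      ultimately have "good (insert {p, q, z} M)"
        using ME that(3) j fM by (auto simp: good_def disjoint_def X_def)
      then show False using max[of "insert {p, q, z} M"] \<open>{p, q, z} \<notin> M\<close> fM by simp
    qed
    define P where "P = (SIGMA p:R. R - {p})"
    have fP: "finite P" "P \<subseteq> R \<times> R" using fR by (auto simp: P_def)
    have cP: "card P = card R * (card R - 1)" unfolding P_def using fR by (simp add: card_SigmaI)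
    define l where "l = (\<lambda>x. card {pq \<in> P. {fst pq, snd pq, x} \<in> E})"
    have l_le: "l x \<le> card P" for x unfolding l_def using fP by (intro card_mono) auto
    have "k * card P = (\<Sum>pq\<in>P. k)" by simp
    also have "\<dots> \<le> (\<Sum>pq\<in>P. card {x \<in> X. {fst pq, snd pq, x} \<in> E})"
    proof (rule sum_mono)
      fix pq assume "pq \<in> P"
      then obtain p q where pq: "pq = (p, q)" "p \<in> R" "q \<in> R" "p \<noteq> q" by (auto simp: P_def)
      have "k \<le> card (N p q \<inter> B)" using deg pq by (auto simp: R_def)
      also have "\<dots> \<le> card {x \<in> X. {p, q, x} \<in> E}"
        using inX[OF pq(2,3)] fX by (intro card_mono) (auto simp: N_def)
      finally show "k \<le> card {x \<in> X. {fst pq, snd pq, x} \<in> E}" using pq by simp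
    qed
    also have "\<dots> = sum l X" unfolding l_def by (rule sum_card_swap[OF fP(1) fX(1)])
    also have "\<dots> = (\<Sum>e\<in>M. sum l e)"
      unfolding X_def using sum.Union_disjoint[of M l] ME(3) c3 by (auto simp: disjoint_def)
    finally have tot: "k * card P \<le> (\<Sum>e\<in>M. sum l e)" .
    have P0: "0 < card P" using cP r13 by simp
    have "\<exists>e\<in>M. card P < sum l e"
    proof (rule ccontr)
      assume "\<not> ?thesis"
      then have "(\<Sum>e\<in>M. sum l e) \<le> (\<Sum>e\<in>M. card P)" by (intro sum_mono) auto
      also have "\<dots> < k * card P" using j P0 by simp
      finally show False using tot by simp
    qed
    then obtain e where e: "e \<in> M" "card P < sum l e" by blast
    obtain x where x: "x \<in> e" "card P < 3 * l x"
    proof -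
      have "\<exists>x\<in>e. card P < 3 * l x"
      proof (rule ccontr)
        assume "\<not> ?thesis"
        then have "(\<Sum>x\<in>e. 3 * l x) \<le> (\<Sum>x\<in>e. card P)" by (intro sum_mono) auto
        then have "3 * sum l e \<le> 3 * card P" using c3 e by (simp add: sum_distrib_left)
        then show False using e by simp
      qed
      then show ?thesis using that by blast
    qed
    have "sum l e = l x + sum l (e - {x})" using x c3 e by (meson sum.remove)
    then have "sum l (e - {x}) \<noteq> 0" using e(2) l_le[of x] by linarith
    then obtain y where "y \<in> e - {x}" "l y \<noteq> 0" by (rule sum.not_neutral_contains_not_neutral)
    then have y: "y \<in> e" "y \<noteq> x" "l y \<noteq> 0" by auto
    have "{pq \<in> P. {fst pq, snd pq, y} \<in> E} \<noteq> {}" using y(3) unfolding l_def by (metis card.empty)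
    then obtain p q where pq: "(p, q) \<in> P" "{p, q, y} \<in> E" by auto
    define W where "W = {p, q} \<times> R \<union> R \<times> {p, q}"
    have "card W \<le> card ({p, q} \<times> R) + card (R \<times> {p, q})" unfolding W_def by (rule card_Un_le)
    also have "\<dots> \<le> 4 * card R" by (simp add: card_cartesian_product card_insert_if)
    finally have W: "card W \<le> 4 * card R" .
    \<comment> \<open>At most \<open>4 * card R\<close> ordered pairs meet \<open>{p, q}\<close>;
      with at least 13 vertices in \<open>R\<close> this is at most a third of all pairs.\<close>
    have "12 * card R \<le> card P" using r13 cP by simp
    then have "card W < card {pq \<in> P. {fst pq, snd pq, x} \<in> E}" using W x(2) unfolding l_def by linarith
    moreover have "finite W" using fR by (simp add: W_def)
    ultimately obtain p' q' where pq': "(p', q') \<in> P" "{p', q', x} \<in> E" "(p', q') \<notin> W"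
      using card_gt_imp_ex_notin[of W "{pq \<in> P. {fst pq, snd pq, x} \<in> E}"] by auto
    have R: "p \<in> R" "q \<in> R" "p' \<in> R" "q' \<in> R" using pq(1) pq'(1) by (auto simp: P_def)
    then have d: "p' \<notin> {p, q}" "q' \<notin> {p, q}" using pq'(3) by (auto simp: W_def)
    define M' where "M' = insert {p, q, y} (insert {p', q', x} (M - {e}))"
    have xy: "x \<in> X" "y \<in> X" using x y e by (auto simp: X_def)
    have RX: "v \<notin> X" if "v \<in> R" for v using that by (auto simp: R_def)
    have other: "g \<inter> {p, q, y} = {}" "g \<inter> {p', q', x} = {}" if "g \<in> M - {e}" for g
    proof -
      have "g \<inter> e = {}" "g \<subseteq> X" using that e ME(3) by (auto simp: disjoint_def X_def)
      then show "g \<inter> {p, q, y} = {}" "g \<inter> {p', q', x} = {}" using x y R RX by auto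
    qed
    have two: "{p, q, y} \<inter> {p', q', x} = {}" using d x y R RX xy by auto
    have nin: "{p, q, y} \<notin> M - {e}" "{p', q', x} \<notin> M - {e}" using other by blast+
    have "card M' = card M + 1"
    proof -
      have "{p, q, y} \<noteq> {p', q', x}" using two by auto
      then have "card M' = Suc (Suc (card (M - {e})))" using nin fM by (simp add: M'_def)
      then show ?thesis using e fM by (metis Suc_eq_plus1 card_Suc_Diff1)
    qed
    moreover have "good M'"
      unfolding good_def
    proof (intro conjI)
      show "M' \<subseteq> E" using ME pq pq' by (auto simp: M'_def)
      show "\<forall>g\<in>M'. g \<subseteq> B" using ME R xy fX by (auto simp: M'_def R_def)
      show "card M' \<le> k" using \<open>card M' = card M + 1\<close> j by simp
      have union: "disjoint (insert g G)" if "disjoint G" "\<And>g'. g' \<in> G \<Longrightarrow> g' \<inter> g = {}" for g :: "'a set" and G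
        using that by (auto simp: disjoint_def)
      have "disjoint (M - {e})" using ME(3) by (auto simp: disjoint_def)
      then show "disjoint M'" unfolding M'_def using other two
        by (intro union) (auto simp only: insert_iff Int_commute)
    qed
    ultimately show ?thesis using max[of M'] by simp
  qed
qed

end

text \<open>\<open>A\<close> is the small part. The vertices of \<open>Q\<close> are atypical, but lie in many edges with two vertices
  in \<open>B\<close>, so that they can be covered one by one.\<close>

locale near_extremal = codegree_third V E for V :: "'a set" and E +
  fixes A B Q :: "'a set" and \<alpha> \<beta> \<rho> :: real
  assumes part: "A \<union> B = V" "A \<inter> B = {}" and QA: "Q \<subseteq> A"
    and card_A: "\<bar>card A - card V / 3\<bar> \<le> \<rho> * card V" and card_Q: "card Q \<le> \<rho> * card V"
    and missing_B: "\<And>b. b \<in> B \<Longrightarrow>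
      card {(x, a). x \<in> B \<and> a \<in> A \<and> {b, x, a} \<notin> E} \<le> \<alpha> * (real (card V))\<^sup>2"
    and missing_A: "\<And>a. a \<in> A - Q \<Longrightarrow>
      card {(x, y). x \<in> B \<and> y \<in> B \<and> {a, x, y} \<notin> E} \<le> \<alpha> * (real (card V))\<^sup>2"
    and link_Q: "\<And>q. q \<in> Q \<Longrightarrow>
      \<beta> * (real (card V))\<^sup>2 \<le> card {(x, y). x \<in> B \<and> y \<in> B \<and> {q, x, y} \<in> E}"
    and num: "\<alpha> \<le> 1/3000" "0 \<le> \<alpha>" "0 < \<rho>" "\<rho> \<le> 1/2000" "50 * \<rho> \<le> \<beta>" "10000 \<le> card V" "6 dvd card V"
      "1 \<le> \<rho> * card V"
begin

definition "n = real (card V)"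

lemma n_ge: "10000 \<le> n" using num by (simp add: n_def)

lemma finite_AB: "finite A" "finite B" "finite Q"
  using part finite_V QA finite_subset[of Q A] by (metis finite_Un)+

lemma card_B: "real (card B) = n - card A"
  using card_Un_disjoint[OF finite_AB(1,2) part(2)] part by (simp add: n_def)

lemma A_bounds: "card A \<le> n / 3 + n / 2000" "n / 3 - n / 2000 \<le> card A" "2 * n / 3 - n / 2000 \<le> card B"
proof -
  have "\<rho> * n \<le> n * (1 / 2000)" using num n_ge mult_right_mono[of \<rho> "1/2000" n] by simp
  then show "card A \<le> n / 3 + n / 2000" "n / 3 - n / 2000 \<le> card A" "2 * n / 3 - n / 2000 \<le> card B"
    using card_A card_B unfolding n_def[symmetric] abs_le_iff by linarith+
qed

definition "rn = \<rho> * n"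

lemma rho_n: "rn \<le> n / 2000"
  using num n_ge mult_right_mono[of \<rho> "1/2000" n] by (simp add: rn_def)

lemma card_Q': "card Q \<le> rn"
  using card_Q by (simp add: rn_def n_def)

lemma card_A': "\<bar>card A - n / 3\<bar> \<le> rn"
  using card_A by (simp add: rn_def n_def)

text \<open>Markov's inequality; \<open>\<alpha> \<le> 1/3000\<close> enters as
  \<open>20 * \<alpha> \<le> 1/150\<close>.\<close>

lemma few_bad:
  assumes "b \<in> B"
  shows "card {a \<in> A. n / 20 \<le> card {x \<in> B. {b, x, a} \<notin> E}} \<le> n / 150"
    and "card {x \<in> B. n / 20 \<le> card {a \<in> A. {b, x, a} \<notin> E}} \<le> n / 150"
proof -
  have n0: "0 < n" using n_ge by simp
  have s: "n / 20 * c \<le> \<alpha> * n\<^sup>2 \<Longrightarrow> c \<le> n / 150" for c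
  proof -
    assume "n / 20 * c \<le> \<alpha> * n\<^sup>2"
    then have "n * c \<le> n * (20 * \<alpha> * n)" by (simp add: power2_eq_square mult_ac)
    then have "c \<le> 20 * \<alpha> * n" using n0 by simp
    also have "\<dots> \<le> 20 * (1/3000) * n" using num n0 by (intro mult_right_mono mult_left_mono) auto
    finally show ?thesis by simp
  qed
  have m: "card {(x, a). x \<in> B \<and> a \<in> A \<and> {b, x, a} \<notin> E} \<le> \<alpha> * n\<^sup>2"
    using missing_B[OF assms] by (simp add: n_def)
  have "n / 20 * card {a \<in> A. n / 20 \<le> card {x \<in> B. {b, x, a} \<notin> E}} \<le> \<alpha> * n\<^sup>2"
    using markov_card[OF finite_AB(1,2), of "n / 20" "\<lambda>x a. {b, x, a} \<notin> E"] m by linarith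
  then show "card {a \<in> A. n / 20 \<le> card {x \<in> B. {b, x, a} \<notin> E}} \<le> n / 150" by (rule s)
  have "n / 20 * card {x \<in> B. n / 20 \<le> card {a \<in> A. {b, x, a} \<notin> E}} \<le> \<alpha> * n\<^sup>2"
    using markov_card[OF finite_AB(2,1), of "n / 20" "\<lambda>a x. {b, x, a} \<notin> E"] m
      card_pairs_swap[of B A "\<lambda>x a. {b, x, a} \<notin> E"] by linarith
  then show "card {x \<in> B. n / 20 \<le> card {a \<in> A. {b, x, a} \<notin> E}} \<le> n / 150" by (rule s)
qed

lemma card_Un_real_le: "real (card (X \<union> Y)) \<le> real (card X) + real (card Y)"
  using card_Un_le[of X Y] by (metis of_nat_add of_nat_mono)

lemma exists_notin:
  assumes "finite Y" "real (card Y) < card X"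
  shows "\<exists>x\<in>X. x \<notin> Y"
  using card_gt_imp_ex_notin[of Y X] assms by simp

text \<open>\<open>b\<close> and \<open>b'\<close> become corners, and the third corner is a fresh
  \<open>a \<in> A\<close> that forms edges with each of them and almost every vertex of
  \<open>B\<close>, so the two missing outer vertices can be taken from \<open>B\<close>. The case
  \<open>z \<in> B\<close> serves the balancing of the parts, the case \<open>z \<in> Q\<close> the
  covering of atypical vertices.\<close>

lemma extend_edge:
  assumes b: "b \<in> B" "b' \<in> B" and e: "{b, b', z} \<in> E"
    and Z: "finite Z" "card Z \<le> n / 100" "Z \<inter> {b, b', z} = {}"
  shows "\<exists>T. tile T \<and> {b, b', z} \<subseteq> T \<and> T \<inter> Z = {} \<and> card (T \<inter> A) = (if z \<in> A then 2 else 1)"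
proof -
  have bb: "b \<noteq> b'" "b \<noteq> z" "b' \<noteq> z" using edgeD[OF e] by auto
  define D where "D = (\<lambda>b. {a \<in> A. n / 20 \<le> card {x \<in> B. {b, x, a} \<notin> E}})"
  have D: "card (D b) \<le> n / 150" "card (D b') \<le> n / 150" using few_bad b by (auto simp: D_def)
  have fD: "finite (D b)" for b using finite_AB by (simp add: D_def)
  have "card (Q \<union> Z \<union> {z} \<union> D b \<union> D b') \<le> n / 2000 + n / 100 + 1 + n / 150 + n / 150"
    using card_Un_real_le[of "Q \<union> Z \<union> {z} \<union> D b" "D b'"] card_Un_real_le[of "Q \<union> Z \<union> {z}" "D b"]
      card_Un_real_le[of "Q \<union> Z" "{z}"] card_Un_real_le[of Q Z] D Z(2) card_Q' rho_n by simp
  also have "\<dots> < card A" using A_bounds n_ge by linarith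
  finally obtain a where a: "a \<in> A" "a \<notin> Q \<union> Z \<union> {z} \<union> D b \<union> D b'"
    using exists_notin[of "Q \<union> Z \<union> {z} \<union> D b \<union> D b'" A] finite_AB Z fD by auto
  have choose: "\<exists>x\<in>B. {c, x, a} \<in> E \<and> x \<notin> Z \<and> x \<notin> set xs" if c: "c = b \<or> c = b'" and xs: "length xs \<le> 3" for c xs
  proof -
    have "card {x \<in> B. {c, x, a} \<notin> E} < n / 20" using a c by (auto simp: D_def)
    then have "card ({x \<in> B. {c, x, a} \<notin> E} \<union> Z \<union> set xs) < n / 20 + n / 100 + 4"
      using card_Un_real_le[of "{x \<in> B. {c, x, a} \<notin> E} \<union> Z" "set xs"]
        card_Un_real_le[of "{x \<in> B. {c, x, a} \<notin> E}" Z] card_length[of xs] xs Z(2) by linarith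
    also have "\<dots> < card B" using A_bounds n_ge by linarith
    finally show ?thesis
      using exists_notin[of "{x \<in> B. {c, x, a} \<notin> E} \<union> Z \<union> set xs" B] finite_AB Z by auto
  qed
  obtain x where x: "x \<in> B" "{b, x, a} \<in> E" "x \<notin> Z" "x \<notin> set [b', z]" using choose[of b "[b', z]"] by auto
  obtain y where y: "y \<in> B" "{b', y, a} \<in> E" "y \<notin> Z" "y \<notin> set [b, z, x]" using choose[of b' "[b, z, x]"] by auto
  have aB: "a \<notin> B" "b \<notin> A" "b' \<notin> A" "x \<notin> A" "y \<notin> A" using a part b x y by auto
  have d: "distinct [b, b', a, z, y, x]"
    using bb a b x y aB edgeD[OF x(2)] edgeD[OF y(2)] by auto
  have "tile {b, b', a, z, y, x}"
    by (rule tileI[OF d]) (use e x y in \<open>simp_all add: insert_commute\<close>)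
  moreover have "{b, b', a, z, y, x} \<inter> A = (if z \<in> A then {a, z} else {a})" using aB a by auto
  moreover have "a \<noteq> z" using d by auto
  ultimately show ?thesis
    using Z(3) a x y by (intro exI[of _ "{b, b', a, z, y, x}"]) auto
qed

text \<open>Corners in \<open>B\<close> and outer vertices in \<open>A\<close>: as many vertices of
  \<open>A\<close> as a tile can have if each edge has only one.\<close>

lemma tile_three_three:
  assumes Z: "finite Z" "card Z \<le> n / 100"
  shows "\<exists>T. tile T \<and> T \<inter> Z = {} \<and> card (T \<inter> A) = 3"
proof -
  define D where "D = (\<lambda>b. {x \<in> B. n / 20 \<le> card {a \<in> A. {b, x, a} \<notin> E}})"
  have D: "card (D b) \<le> n / 150" if "b \<in> B" for b using few_bad that by (auto simp: D_def)
  have fD: "finite (D b)" for b using finite_AB by (simp add: D_def)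
  have "real (card Z) < card B" using Z A_bounds n_ge by linarith
  then obtain b1 where b1: "b1 \<in> B" "b1 \<notin> Z" using exists_notin[OF Z(1), of B] by blast
  have "card (Z \<union> D b1 \<union> {b1}) < card B"
    using Z A_bounds n_ge D[OF b1(1)] card_Un_real_le[of Z "D b1"] card_Un_real_le[of "Z \<union> D b1" "{b1}"] by simp
  then obtain b2 where b2: "b2 \<in> B" "b2 \<notin> Z \<union> D b1 \<union> {b1}" using exists_notin[of "Z \<union> D b1 \<union> {b1}" B] Z fD by auto
  have "card (Z \<union> D b1 \<union> D b2 \<union> set [b1, b2]) < card B"
    using Z A_bounds n_ge D[OF b1(1)] D[OF b2(1)] card_Un_real_le[of Z "D b1"] card_length[of "[b1, b2]"]
      card_Un_real_le[of "Z \<union> D b1" "D b2"] card_Un_real_le[of "Z \<union> D b1 \<union> D b2" "set [b1, b2]"] by simp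
  then obtain b3 where b3: "b3 \<in> B" "b3 \<notin> Z \<union> D b1 \<union> D b2 \<union> set [b1, b2]"
    using exists_notin[of "Z \<union> D b1 \<union> D b2 \<union> set [b1, b2]" B] Z fD by auto
  have choose: "\<exists>a\<in>A. {b, b', a} \<in> E \<and> a \<notin> Z \<and> a \<notin> set xs"
    if "b' \<in> B" "b' \<notin> D b" "length xs \<le> 2" for b b' xs
  proof -
    have "card {a \<in> A. {b, b', a} \<notin> E} < n / 20" using that by (auto simp: D_def)
    then have "card ({a \<in> A. {b, b', a} \<notin> E} \<union> Z \<union> set xs) < n / 20 + n / 100 + 3"
      using card_Un_real_le[of "{a \<in> A. {b, b', a} \<notin> E} \<union> Z" "set xs"]
        card_Un_real_le[of "{a \<in> A. {b, b', a} \<notin> E}" Z] card_length[of xs] that(3) Z(2) by linarith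
    also have "\<dots> < card A" using A_bounds n_ge by linarith
    finally show ?thesis
      using exists_notin[of "{a \<in> A. {b, b', a} \<notin> E} \<union> Z \<union> set xs" A] finite_AB Z by auto
  qed
  obtain a3 where a3: "a3 \<in> A" "{b1, b2, a3} \<in> E" "a3 \<notin> Z" using choose[of b2 b1 "[]"] b2 by auto
  obtain a2 where a2: "a2 \<in> A" "{b1, b3, a2} \<in> E" "a2 \<notin> Z" "a2 \<notin> set [a3]" using choose[of b3 b1 "[a3]"] b3 by auto
  obtain a1 where a1: "a1 \<in> A" "{b2, b3, a1} \<in> E" "a1 \<notin> Z" "a1 \<notin> set [a2, a3]"
    using choose[of b3 b2 "[a2, a3]"] b3 by auto
  have n: "a \<noteq> b" if "a \<in> A" "b \<in> B" for a b using that part by auto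
  have d: "distinct [b1, b2, b3, a3, a1, a2]" using a1 a2 a3 b1 b2 b3 n by auto
  have "tile {b1, b2, b3, a3, a1, a2}"
    by (rule tileI[OF d]) (use a1 a2 a3 in \<open>simp_all add: insert_commute\<close>)
  moreover have "{b1, b2, b3, a3, a1, a2} \<inter> A = {a1, a2, a3}" using a1 a2 a3 b1 b2 b3 n by auto
  moreover have "card {a1, a2, a3} = 3" using d by auto
  ultimately show ?thesis using a1 a2 a3 b1 b2 b3 by (intro exI[of _ "{b1, b2, b3, a3, a1, a2}"]) auto
qed

lemma tile_family:
  assumes "finite I" "\<And>i. i \<in> I \<Longrightarrow> tile (T i) \<and> card (T i \<inter> A) = c" "disjoint_family_on T I"
  defines "R \<equiv> \<Union>i\<in>I. T i"
  shows "tileable R" "card R = 6 * card I" "card (R \<inter> A) = c * card I" "card (R \<inter> B) + c * card I = 6 * card I"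
proof -
  show "tileable R" unfolding R_def using assms tileable_tile by (intro tileable_UN) auto
  have d: "T i \<inter> T j = {}" if "i \<in> I" "j \<in> I" "i \<noteq> j" for i j
    using assms(3) that by (auto simp: disjoint_family_on_def)
  have "card R = (\<Sum>i\<in>I. card (T i))" unfolding R_def
    by (rule card_UN_disjoint) (use assms d tile_finite in auto)
  also have "\<dots> = (\<Sum>i\<in>I. 6)" using assms(2) tile_card by (intro sum.cong) auto
  finally show cR: "card R = 6 * card I" by simp
  have "R \<inter> A = (\<Union>i\<in>I. T i \<inter> A)" by (auto simp: R_def)
  also have "card \<dots> = (\<Sum>i\<in>I. card (T i \<inter> A))"
  proof (rule card_UN_disjoint)
    show "\<forall>i\<in>I. \<forall>j\<in>I. i \<noteq> j \<longrightarrow> T i \<inter> A \<inter> (T j \<inter> A) = {}" using d by blast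
  qed (use assms tile_finite in auto)
  finally show cA: "card (R \<inter> A) = c * card I" using assms(2) by simp
  have "R \<subseteq> A \<union> B" using tileable_subset[OF \<open>tileable R\<close>] part by simp
  then have "R = (R \<inter> A) \<union> (R \<inter> B)" by auto
  then have "card R = card (R \<inter> A) + card (R \<inter> B)"
    using card_Un_disjoint[of "R \<inter> A" "R \<inter> B"] finite_AB part(2) by (metis Int_assoc Int_commute Int_empty_right finite_Int inf_left_commute)
  then show "card (R \<inter> B) + c * card I = 6 * card I" using cR cA by simp
qed

text \<open>If \<open>A\<close> is too small, the codegree condition yields disjoint edges inside \<open>B\<close>, each of which extends
  to a tile with one vertex in \<open>A\<close>; if \<open>A\<close> is too large, tiles with three vertices in \<open>A\<close> are used.\<close>

lemma exists_balancing_tiles: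
  "\<exists>R. tileable R \<and> R \<inter> Q = {} \<and> card R \<le> 6 * rn \<and> card (B - R) = 2 * card (A - R)"
proof -
  have "3 dvd card V" using num(7) dvd_trans[of 3 6 "card V"] by simp
  then obtain m where m: "card V = 3 * m" by (elim dvdE)
  have cB: "card A + card B = 3 * m"
    using card_Un_disjoint[OF finite_AB(1,2) part(2)] part m by simp
  have nm: "n = 3 * real m" using m by (simp add: n_def)
  define lim where "lim = nat \<lfloor>n / 100\<rfloor>"
  have lim: "real lim \<le> n / 100" "n / 100 - 1 \<le> real lim" using n_ge unfolding lim_def by linarith+
  show ?thesis
  proof (cases "card A \<le> m")
    case True
    \<comment> \<open>A tile with one vertex in \<open>A\<close> lowers
      \<open>card B - 2 * card A\<close> by 3, and the surplus to be removed is
      \<open>3 * k\<close>.\<close>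
    define k where "k = m - card A"
    have k: "card A + k = m" "real k \<le> rn"
      using True card_A' nm unfolding k_def by (auto simp: of_nat_diff abs_le_iff)
    have "\<exists>M\<subseteq>E. card M = k \<and> (\<forall>e\<in>M. e \<subseteq> B) \<and> disjoint M"
    proof (rule exists_matching)
      show "B \<subseteq> V" using part by auto
      have "real (3 * k + 13) \<le> card B" using k(2) rho_n A_bounds n_ge by simp
      then show "3 * k + 13 \<le> card B" by linarith
      fix p q assume pq: "p \<in> B" "q \<in> B" "p \<noteq> q"
      have "real m \<le> card (N p q)" using codeg[of p q] pq part m by auto
      moreover have "N p q \<subseteq> (N p q \<inter> B) \<union> A" using N_subset part by blast
      then have "card (N p q) \<le> card (N p q \<inter> B) + card A"
        using card_mono[of "(N p q \<inter> B) \<union> A" "N p q"] card_Un_le[of "N p q \<inter> B" A] finite_AB by fastforce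
      ultimately show "k \<le> card (N p q \<inter> B)" using k(1) by linarith
    qed
    then obtain M where M: "M \<subseteq> E" "card M = k" "\<And>e. e \<in> M \<Longrightarrow> e \<subseteq> B" "disjoint M" by blast
    have "M \<subseteq> Pow B" using M(3) by auto
    then have fM: "finite M" using finite_AB finite_subset by blast
    have "\<exists>T. (\<forall>e\<in>M. tile (T e) \<and> e \<subseteq> T e \<and> T e \<inter> Q = {} \<and> card (T e \<inter> A) = 1) \<and> disjoint_family_on T M"
    proof (rule greedy_tiles[of M Q lim "\<lambda>e. e" "\<lambda>T. card (T \<inter> A) = 1"])
      fix e Z assume e: "e \<in> M" and Z: "finite Z" "card Z \<le> lim" "Z \<inter> e = {}"
      have "card e = 3" using edge_card M(1) e by auto
      then obtain b b' z where ebz: "e = {b, b', z}" by (auto simp: card_3_iff)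
      have "z \<notin> A" "b \<in> B" "b' \<in> B" using M(3)[OF e] part ebz by auto
      moreover have "real (card Z) \<le> n / 100" using Z(2) lim(1) by linarith
      ultimately show "\<exists>T. tile T \<and> e \<subseteq> T \<and> T \<inter> Z = {} \<and> card (T \<inter> A) = 1"
        using extend_edge[of b b' z Z] e M(1) Z ebz by auto
    next
      show "disjoint_family_on (\<lambda>e. e) M" using M(4) by (auto simp: disjoint_family_on_def disjoint_def)
      show "card e \<le> 6 \<and> finite e \<and> Q \<inter> e = {}" if "e \<in> M" for e
        using edge_card[of e] M(1) M(3)[OF that] that QA part finite_AB finite_subset[of e B] by auto
      have "real (card Q + 6 * card M) \<le> lim"
        using card_Q' k(2) rho_n lim(2) n_ge M(2) by simp
      then show "card Q + 6 * card M \<le> lim" by linarith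
    qed (use fM finite_AB in auto)
    then obtain T where T: "\<forall>e\<in>M. tile (T e) \<and> e \<subseteq> T e \<and> T e \<inter> Q = {} \<and> card (T e \<inter> A) = 1"
      "disjoint_family_on T M" by (elim exE conjE) (rule that)
    define R where "R = (\<Union>e\<in>M. T e)"
    have fam: "tileable R" "card R = 6 * k" "card (R \<inter> A) = k" "card (R \<inter> B) = 5 * k"
      using tile_family[OF fM, of T 1] T M(2) unfolding R_def by auto
    have "R \<inter> Q = {}" using T by (auto simp: R_def)
    moreover have "card (B - R) = 2 * card (A - R)"
      using card_minus[OF finite_AB(1), of R] card_minus[OF finite_AB(2), of R] fam k(1) cB by linarith
    ultimately show ?thesis using fam k(2) by (intro exI[of _ R]) auto
  next
    case False
    \<comment> \<open>A tile with three vertices in each part raises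
      \<open>card B - 2 * card A\<close> by 3, and the deficit is \<open>3 * k\<close>.\<close>
    define k where "k = card A - m"
    have k: "card A = m + k" "real k \<le> rn"
      using False card_A' nm unfolding k_def by (auto simp: of_nat_diff abs_le_iff)
    have "\<exists>T. (\<forall>i\<in>{..<k}. tile (T i) \<and> {} \<subseteq> T i \<and> T i \<inter> Q = {} \<and> card (T i \<inter> A) = 3) \<and> disjoint_family_on T {..<k}"
    proof (rule greedy_tiles[of "{..<k}" Q lim "\<lambda>_. {}" "\<lambda>T. card (T \<inter> A) = 3"])
      fix Z :: "'a set" assume Z: "finite Z" "card Z \<le> lim"
      then have "real (card Z) \<le> n / 100" using lim(1) by linarith
      then show "\<exists>T. tile T \<and> {} \<subseteq> T \<and> T \<inter> Z = {} \<and> card (T \<inter> A) = 3"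
        using tile_three_three[OF Z(1)] by auto
    next
      have "real (card Q + 6 * k) \<le> lim"
        using card_Q' k(2) rho_n lim(2) n_ge by simp
      then show "card Q + 6 * card {..<k} \<le> lim" by simp
    qed (use finite_AB in \<open>auto simp: disjoint_family_on_def\<close>)
    then obtain T where T: "\<forall>i\<in>{..<k}. tile (T i) \<and> {} \<subseteq> T i \<and> T i \<inter> Q = {} \<and> card (T i \<inter> A) = 3"
      "disjoint_family_on T {..<k}" by (elim exE conjE) (rule that)
    define R where "R = (\<Union>i\<in>{..<k}. T i)"
    have fam: "tileable R" "card R = 6 * k" "card (R \<inter> A) = 3 * k" "card (R \<inter> B) = 3 * k"
      using tile_family[of "{..<k}" T 3] T unfolding R_def by auto
    have "R \<inter> Q = {}" using T by (auto simp: R_def)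
    moreover have "card (B - R) = 2 * card (A - R)"
      using card_minus[OF finite_AB(1), of R] card_minus[OF finite_AB(2), of R] fam k(1) cB by linarith
    ultimately show ?thesis using fam k(2) by (intro exI[of _ R]) auto
  qed
qed

text \<open>The vertices used so far, about \<open>12 * rn\<close> at most, block fewer than
  \<open>50 * rn * n\<close> of the at least \<open>\<beta> * n\<^sup>2\<close> pairs in the link of
  \<open>q\<close>. The tiles split 2 : 4 between the parts and so keep the balance already
  reached.\<close>

lemma cover_Q:
  assumes R1: "finite R1" "R1 \<inter> Q = {}" "card R1 \<le> 6 * rn"
  shows "\<exists>R. tileable R \<and> R \<inter> R1 = {} \<and> Q \<subseteq> R \<and> card R = 6 * card Q \<and>
    card (R \<inter> A) = 2 * card Q \<and> card (R \<inter> B) = 4 * card Q"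
proof -
  have rn1: "1 \<le> rn" using num(8) by (simp add: rn_def n_def)
  define lim where "lim = nat \<lceil>12 * rn\<rceil>"
  have lim: "12 * rn \<le> real lim" "real lim \<le> 12 * rn + 1" using rn1 unfolding lim_def by linarith+
  have "\<exists>T. (\<forall>q\<in>Q. tile (T q) \<and> {q} \<subseteq> T q \<and> T q \<inter> R1 = {} \<and> card (T q \<inter> A) = 2) \<and> disjoint_family_on T Q"
  proof (rule greedy_tiles[of Q R1 lim "\<lambda>q. {q}" "\<lambda>T. card (T \<inter> A) = 2"])
    fix q Z assume q: "q \<in> Q" and Z: "finite Z" "card Z \<le> lim" "Z \<inter> {q} = {}"
    define L where "L = {(x, y). x \<in> B \<and> y \<in> B \<and> {q, x, y} \<in> E}"
    define W where "W = Z \<times> B \<union> B \<times> Z"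
    have cZ: "real (card Z) \<le> 12 * rn + 1" using Z(2) lim(2) by linarith
    have "real (card W) \<le> real (card (Z \<times> B)) + real (card (B \<times> Z))" unfolding W_def by (rule card_Un_real_le)
    also have "\<dots> = 2 * real (card Z) * real (card B)" by (simp add: card_cartesian_product)
    also have "\<dots> \<le> 2 * (12 * rn + 1) * n"
      using cZ rn1 card_B by (intro mult_mono) auto
    also have "\<dots> < 50 * rn * n" using rn1 n_ge by (intro mult_strict_right_mono) auto
    also have "\<dots> = (50 * \<rho>) * n\<^sup>2" by (simp add: rn_def power2_eq_square)
    also have "\<dots> \<le> \<beta> * n\<^sup>2" using num(5) by (intro mult_right_mono) auto
    also have "\<dots> \<le> card L" using link_Q[OF q] by (simp add: L_def n_def)
    finally obtain x y where xy: "(x, y) \<in> L" "(x, y) \<notin> W"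
      using exists_notin[of W L] Z(1) finite_AB by (auto simp: W_def)
    then have b: "x \<in> B" "y \<in> B" "{x, y, q} \<in> E" "x \<notin> Z" "y \<notin> Z"
      by (auto simp: L_def W_def insert_commute)
    have "real (card Z) \<le> n / 100" using cZ rho_n n_ge by linarith
    moreover have "q \<in> A" using q QA by auto
    ultimately show "\<exists>T. tile T \<and> {q} \<subseteq> T \<and> T \<inter> Z = {} \<and> card (T \<inter> A) = 2"
      using extend_edge[OF b(1-3) Z(1)] Z(3) b by auto
  next
    have "real (card R1 + 6 * card Q) \<le> lim" using R1(3) card_Q' lim(1) by simp
    then show "card R1 + 6 * card Q \<le> lim" by linarith
  qed (use R1 finite_AB in \<open>auto simp: disjoint_family_on_def\<close>)
  then obtain T where T: "\<forall>q\<in>Q. tile (T q) \<and> {q} \<subseteq> T q \<and> T q \<inter> R1 = {} \<and> card (T q \<inter> A) = 2"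
    "disjoint_family_on T Q" by (elim exE conjE) (rule that)
  define R where "R = (\<Union>q\<in>Q. T q)"
  have "tileable R" "card R = 6 * card Q" "card (R \<inter> A) = 2 * card Q" "card (R \<inter> B) = 4 * card Q"
    using tile_family[OF finite_AB(3), of T 2] T unfolding R_def by auto
  moreover have "R \<inter> R1 = {}" "Q \<subseteq> R" using T by (auto simp: R_def)
  ultimately show ?thesis by blast
qed

lemma missing_subset:
  fixes t :: real
  assumes "\<alpha> * n\<^sup>2 \<le> t"
  shows "v \<in> A - Q \<Longrightarrow> X \<subseteq> B \<Longrightarrow> Y \<subseteq> B \<Longrightarrow> card {(y, z). y \<in> X \<and> z \<in> Y \<and> {v, y, z} \<notin> E} \<le> t"
    and "v \<in> B \<Longrightarrow> X \<subseteq> B \<Longrightarrow> Y \<subseteq> A \<Longrightarrow> card {(y, z). y \<in> X \<and> z \<in> Y \<and> {v, y, z} \<notin> E} \<le> t"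
    and "v \<in> B \<Longrightarrow> X \<subseteq> A \<Longrightarrow> Y \<subseteq> B \<Longrightarrow> card {(y, z). y \<in> X \<and> z \<in> Y \<and> {v, y, z} \<notin> E} \<le> t"
proof -
  have mono: "card {(y, z). y \<in> X \<and> z \<in> Y \<and> P y z} \<le> card {(y, z). y \<in> X' \<and> z \<in> Y' \<and> P y z}"
    if "X \<subseteq> X'" "Y \<subseteq> Y'" "finite X'" "finite Y'" for X Y X' Y' :: "'a set" and P
    using that by (intro card_mono finite_subset[of "{(y, z). y \<in> X' \<and> z \<in> Y' \<and> P y z}" "X' \<times> Y'"]) auto
  show "card {(y, z). y \<in> X \<and> z \<in> Y \<and> {v, y, z} \<notin> E} \<le> t" if "v \<in> A - Q" "X \<subseteq> B" "Y \<subseteq> B"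
    using mono[OF that(2,3) finite_AB(2) finite_AB(2), of "\<lambda>y z. {v, y, z} \<notin> E"] missing_A[OF that(1)] assms
    unfolding n_def by linarith
  show B1: "card {(y, z). y \<in> X \<and> z \<in> Y \<and> {v, y, z} \<notin> E} \<le> t" if "v \<in> B" "X \<subseteq> B" "Y \<subseteq> A" for X Y
    using mono[OF that(2,3) finite_AB(2) finite_AB(1), of "\<lambda>y z. {v, y, z} \<notin> E"] missing_B[OF that(1)] assms
    unfolding n_def by linarith
  show "card {(y, z). y \<in> X \<and> z \<in> Y \<and> {v, y, z} \<notin> E} \<le> t" if "v \<in> B" "X \<subseteq> A" "Y \<subseteq> B"
  proof -
    have "{v, y, z} = {v, z, y}" for y z by auto
    then have "card {(y, z). y \<in> X \<and> z \<in> Y \<and> {v, y, z} \<notin> E} = card {(y, z). y \<in> Y \<and> z \<in> X \<and> {v, y, z} \<notin> E}"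
      using card_pairs_swap[of X Y "\<lambda>y z. {v, y, z} \<notin> E"] by simp
    then show ?thesis using B1[OF that(1,3,2)] by simp
  qed
qed

lemma tileable_V: "tileable V"
proof -
  obtain R1 where R1: "tileable R1" "R1 \<inter> Q = {}" "card R1 \<le> 6 * rn" "card (B - R1) = 2 * card (A - R1)"
    using exists_balancing_tiles by blast
  obtain R2 where R2: "tileable R2" "R2 \<inter> R1 = {}" "Q \<subseteq> R2" "card R2 = 6 * card Q"
    "card (R2 \<inter> A) = 2 * card Q" "card (R2 \<inter> B) = 4 * card Q"
    using cover_Q[OF tileable_finite[OF R1(1)] R1(2,3)] by blast
  define R where "R = R1 \<union> R2"
  have tR: "tileable R" unfolding R_def using R1 R2 by (intro tileable_Un) auto
  have cR: "real (card R) \<le> 12 * rn" unfolding R_def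
    using card_Un_real_le[of R1 R2] R1(3) R2(4) card_Q' by simp
  define A' where "A' = A - R"
  define B' where "B' = B - R"
  have fin: "finite A'" "finite B'" using finite_AB by (auto simp: A'_def B'_def)
  have sub: "A' \<subseteq> A - Q" "B' \<subseteq> B" using R2(3) by (auto simp: A'_def B'_def R_def)
  have cAB: "card B' = 2 * card A'"
  proof -
    have "A' = (A - R1) - R2" "B' = (B - R1) - R2" by (auto simp: A'_def B'_def R_def)
    moreover have "R2 \<inter> (A - R1) = R2 \<inter> A" "R2 \<inter> (B - R1) = R2 \<inter> B" using R2(2) by auto
    ultimately show ?thesis
      using card_minus[of "A - R1" R2] card_minus[of "B - R1" R2] finite_AB R2(5,6) R1(4) by simp
  qed
  have VR: "V - R = A' \<union> B'" "A' \<inter> B' = {}" using part by (auto simp: A'_def B'_def)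
  have RV: "R \<subseteq> V" using tileable_subset[OF tR] .
  have "card (V - R) = card A' + card B'" using VR card_Un_disjoint[OF fin VR(2)] by simp
  then have cV: "card V = card R + 3 * card A'"
    using card_minus[OF finite_V, of R] RV cAB by (simp add: Int_absorb2)
  \<comment> \<open>\<open>A'\<close> will be split into two classes of equal size, so its size has
    to be even; this is where divisibility by 2 enters.\<close>
  have "6 dvd 3 * card A'"
    using tileable_card[OF tR] num(7) unfolding cV by (simp add: dvd_add_right_iff)
  then have "even (card A')" by presburger
  then obtain M where M: "card A' = 2 * M" by (elim evenE)
  have cB': "card B' = 4 * M" using cAB M by simp
  have "real (card A) \<le> card A' + card R"
    using card_minus[OF finite_AB(1), of R] card_mono[of R "R \<inter> A"] tileable_finite[OF tR] unfolding A'_def by simp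
  then have M_ge: "16 / 100 * n \<le> real M" using cR rho_n A_bounds n_ge M by simp
  \<comment> \<open>\<open>(100/16)\<^sup>2 < 40\<close>, and \<open>21 * 40 / 3000 < 1/2\<close>
    leaves enough room for the shuffle.\<close>
  have nM: "\<alpha> * n\<^sup>2 \<le> 40 * \<alpha> * (real M)\<^sup>2"
  proof -
    have "(16 / 100 * n)\<^sup>2 \<le> (real M)\<^sup>2" using M_ge n_ge by (intro power_mono) auto
    then have "16 * n\<^sup>2 \<le> 625 * (real M)\<^sup>2" by (simp add: power_mult_distrib power_divide)
    then have "n\<^sup>2 \<le> 40 * (real M)\<^sup>2" using zero_le_power2[of "real M"] by linarith
    then show ?thesis using mult_left_mono[of "n\<^sup>2" "40 * (real M)\<^sup>2" \<alpha>] num(2) by simp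
  qed
  obtain S0 where S0: "S0 \<subseteq> A'" "card S0 = M" using obtain_subset_with_card_n[of M A'] M by auto
  obtain S2 where S2: "S2 \<subseteq> B'" "card S2 = M" using obtain_subset_with_card_n[of M B'] cB' by auto
  have r2: "card (B' - S2) = 3 * M" using S2 fin cB' finite_subset[of S2 B'] by (simp add: card_Diff_subset)
  obtain S3 where S3: "S3 \<subseteq> B' - S2" "card S3 = M" using obtain_subset_with_card_n[of M "B' - S2"] r2 by auto
  have r3: "card (B' - S2 - S3) = 2 * M"
    using S3 fin r2 finite_subset[of S3 "B' - S2"] by (simp add: card_Diff_subset)
  obtain S4 where S4: "S4 \<subseteq> B' - S2 - S3" "card S4 = M" using obtain_subset_with_card_n[of M "B' - S2 - S3"] r3 by auto
  define S1 where "S1 = A' - S0"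
  define S5 where "S5 = B' - S2 - S3 - S4"
  have c15: "card S1 = M" "card S5 = M"
    using S0 S4 r3 M fin finite_subset[of S0 A'] finite_subset[of S4 "B' - S2 - S3"]
    by (simp_all add: S1_def S5_def card_Diff_subset)
  \<comment> \<open>Positions 0 and 1 come from \<open>A\<close>. Every triple of
    \<open>roles\<close> contains exactly one of them, so all edges used have one vertex in
    \<open>A\<close> and two in \<open>B\<close>.\<close>
  define S where "S = (\<lambda>j::nat. [S0, S1, S2, S3, S4, S5] ! j)"
  have S: "S 0 = S0" "S 1 = S1" "S 2 = S2" "S 3 = S3" "S 4 = S4" "S 5 = S5" "S (Suc 0) = S1" by (simp_all add: S_def)
  have six: "j = 0 \<or> j = 1 \<or> j = 2 \<or> j = 3 \<or> j = 4 \<or> j = 5" if "j < 6" for j :: nat using that by linarith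
  have SA: "S0 \<subseteq> A - Q" "S1 \<subseteq> A - Q" "S0 \<subseteq> A" "S1 \<subseteq> A" using S0 sub by (auto simp: S1_def)
  have SB: "S2 \<subseteq> B" "S3 \<subseteq> B" "S4 \<subseteq> B" "S5 \<subseteq> B" using S2 S3 S4 sub by (auto simp: S5_def)
  have "tileable (\<Union>j<6. S j)"
  proof (rule shuffle_tileable)
    show "finite (S j) \<and> card (S j) = M" if "j < 6" for j
      using six[OF that] S S0 S2 S3 S4 c15 SA SB finite_AB finite_subset by metis
    have d: "S0 \<inter> S1 = {}" "S0 \<inter> S2 = {}" "S0 \<inter> S3 = {}" "S0 \<inter> S4 = {}" "S0 \<inter> S5 = {}"
      "S1 \<inter> S2 = {}" "S1 \<inter> S3 = {}" "S1 \<inter> S4 = {}" "S1 \<inter> S5 = {}" "S2 \<inter> S3 = {}" "S2 \<inter> S4 = {}"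
      "S2 \<inter> S5 = {}" "S3 \<inter> S4 = {}" "S3 \<inter> S5 = {}" "S4 \<inter> S5 = {}"
      using SA SB part(2) S3 S4 by (auto simp: S1_def S5_def)
    show "disjoint_family_on S {..<6}"
      unfolding disjoint_family_on_def
    proof (intro ballI impI)
      fix i j :: nat assume "i \<in> {..<6}" "j \<in> {..<6}" "i \<noteq> j"
      then have "i \<noteq> j" "i = 0 \<or> i = 1 \<or> i = 2 \<or> i = 3 \<or> i = 4 \<or> i = 5"
        "j = 0 \<or> j = 1 \<or> j = 2 \<or> j = 3 \<or> j = 4 \<or> j = 5" using six by auto
      then show "S i \<inter> S j = {}"
        by (elim disjE) (simp_all only: S d Int_commute simp_thms)
    qed
    have "M \<ge> 1600" using M_ge n_ge by simp
    moreover have "1 / 2 \<le> 1 - 21 * (40 * \<alpha>)" using num(1) by simp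
    ultimately have "real 1600 * (1 / 2) \<le> real M * (1 - 21 * (40 * \<alpha>))" by (intro mult_mono) auto
    then show "50 \<le> real M * (1 - 21 * (40 * \<alpha>))" by simp
    show "0 \<le> 40 * \<alpha>" using num(2) by simp
    fix i j k :: nat and v :: 'a
    assume r: "(i, j, k) \<in> roles"
    have c: "{y, v, z} = {v, y, z}" "{y, z, v} = {v, y, z}" for y z by auto
    note m = missing_subset[OF nM, of v]
    from r consider "i = 0" "j = 2" "k = 4" | "i = 0" "j = 3" "k = 5" | "i = 2" "j = 3" "k = 1"
      by (auto simp: roles_def)
    then show "(v \<in> S i \<longrightarrow> card {(y, z). y \<in> S j \<and> z \<in> S k \<and> {v, y, z} \<notin> E} \<le> 40 * \<alpha> * (real M)\<^sup>2) \<and>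
      (v \<in> S j \<longrightarrow> card {(y, z). y \<in> S i \<and> z \<in> S k \<and> {y, v, z} \<notin> E} \<le> 40 * \<alpha> * (real M)\<^sup>2) \<and>
      (v \<in> S k \<longrightarrow> card {(y, z). y \<in> S i \<and> z \<in> S j \<and> {y, z, v} \<notin> E} \<le> 40 * \<alpha> * (real M)\<^sup>2)"
    proof cases
      case 1
      then show ?thesis unfolding c using m(1)[of S2 S4] m(3)[of S0 S4] m(3)[of S0 S2] SA SB S by auto
    next
      case 2
      then show ?thesis unfolding c using m(1)[of S3 S5] m(3)[of S0 S5] m(3)[of S0 S3] SA SB S by auto
    next
      case 3
      then show ?thesis unfolding c using m(2)[of S3 S1] m(2)[of S2 S1] m(1)[of S2 S3] SA SB S by auto
    qed
  qed
  also have "(\<Union>j<6. S j) = S0 \<union> S1 \<union> S2 \<union> S3 \<union> S4 \<union> S5"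
    using S by (auto simp: lessThan_Suc numeral_eq_Suc)
  also have "\<dots> = V - R" using VR(1) S0 S2 S3 S4 by (auto simp: S1_def S5_def)
  finally have "tileable (R \<union> (V - R))" using tR by (intro tileable_Un) auto
  then show ?thesis using RV by (simp add: Un_absorb1)
qed

end

section \<open>From a sparse complement to the near-extremal structure\<close>

lemma card_pairs_change_le:
  assumes "finite V" "A \<subseteq> V" "B \<subseteq> V"
  shows "card {(x, y). x \<in> A \<and> y \<in> B \<and> P x y}
    \<le> card {(x, y). x \<in> C \<and> y \<in> D \<and> x \<in> V \<and> y \<in> V \<and> P x y} + card (A - C) * card V + card (B - D) * card V"
proof -
  have f: "finite (A - C)" "finite (B - D)" using assms finite_subset by blast+
  have "finite {(x, y). x \<in> C \<and> y \<in> D \<and> x \<in> V \<and> y \<in> V \<and> P x y}"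
    by (rule finite_subset[of _ "V \<times> V"]) (use assms in auto)
  then have "card {(x, y). x \<in> A \<and> y \<in> B \<and> P x y}
    \<le> card ({(x, y). x \<in> C \<and> y \<in> D \<and> x \<in> V \<and> y \<in> V \<and> P x y} \<union> (A - C) \<times> V \<union> V \<times> (B - D))"
    using assms f by (intro card_mono) auto
  also have "\<dots> \<le> card {(x, y). x \<in> C \<and> y \<in> D \<and> x \<in> V \<and> y \<in> V \<and> P x y} + card ((A - C) \<times> V) + card (V \<times> (B - D))"
    by (meson add_mono card_Un_le le_refl le_trans)
  finally show ?thesis by (simp add: card_cartesian_product mult.commute)
qed

lemma sum_if_plus:
  fixes a b :: real
  assumes "finite D" "S \<subseteq> D"
  shows "(\<Sum>y\<in>D. (if y \<in> S then a else 0) + b) = card S * a + card D * b"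
  using sum.inter_restrict[OF assms(1), of "\<lambda>_. a" S] assms(2)
  by (simp add: sum.distrib Int_absorb1)

context codegree_third begin

text \<open>By sparsity almost all pairs in \<open>D\<close> have almost all their neighbours in
  \<open>A0\<close>, which is barely larger than \<open>n / 3\<close>; so on average a vertex of
  \<open>A0\<close> misses few pairs of \<open>D\<close>. To control single vertices, they are
  redistributed according to \<open>q v\<close>, the number of their edges with pairs of
  \<open>D\<close>: a vertex put into \<open>B\<close> has few such edges, and a vertex of
  \<open>A\<close>, even an atypical one, has enough of them to be covered.\<close>

lemma near_extremal_if_sparse:
  fixes \<epsilon> :: real
  defines "\<epsilon> \<equiv> 1 / 10 ^ 11"
  assumes big: "10 ^ 11 \<le> card V" "6 dvd card V"
    and o: "o1 \<in> V" "o2 \<in> V" "o1 \<noteq> o2" and small: "card (N o1 o2) \<le> (1/3 + \<epsilon>) * card V"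
    and sparse: "\<not> dense_in (V - N o1 o2) (\<epsilon> * card V)"
  shows "tileable V"
proof -
  define n where "n = real (card V)"
  define A0 where "A0 = N o1 o2"
  define D where "D = V - A0"
  define t where "t = \<epsilon> * n"
  have n: "10 ^ 11 \<le> n" using big(1) unfolding n_def by (metis of_nat_le_iff of_nat_numeral of_nat_power)
  have t: "1 \<le> t" "t = n / 10 ^ 11" using n by (simp_all add: t_def \<epsilon>_def)
  have tn0: "0 \<le> t * n" using t(1) n by simp
  have A0: "A0 \<subseteq> V" "n / 3 \<le> card A0" "card A0 \<le> n / 3 + t"
    using N_subset codeg[OF o] small by (auto simp: A0_def n_def t_def algebra_simps)
  have fin: "finite A0" "finite D" "D \<subseteq> V" "A0 \<inter> D = {}" "A0 \<union> D = V"
    using A0 finite_V finite_subset by (auto simp: D_def)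
  have "card V = card A0 + card D" using card_Un_disjoint[OF fin(1,2,4)] fin(5) by simp
  then have cD: "real (card D) = n - card A0" by (simp add: n_def)
  have le_n: "real (card S) \<le> n" if "S \<subseteq> V" for S using card_mono[OF finite_V that] by (simp add: n_def)
  define bad where "bad = (\<lambda>x. {y \<in> D. t \<le> card (N x y \<inter> D)})"
  define X where "X = {x \<in> D. t \<le> card (bad x)}"
  have cX: "real (card X) < t"
  proof (rule ccontr)
    assume "\<not> real (card X) < t"
    moreover have "X \<subseteq> D" by (auto simp: X_def)
    moreover have "bad x \<subseteq> D" "t \<le> card (bad x)" "\<forall>y\<in>bad x. t \<le> card (N x y \<inter> D)" if "x \<in> X" for x
      using that by (auto simp: X_def bad_def)
    ultimately have "dense_in D t" unfolding dense_in_def by (metis not_less)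
    then show False using sparse by (simp add: D_def A0_def t_def n_def)
  qed
  define q where "q = (\<lambda>v. real (card {(x, y). x \<in> D \<and> y \<in> D \<and> {v, x, y} \<in> E}))"
  define miss where "miss = (\<lambda>v. real (card {(x, y). x \<in> D \<and> y \<in> D \<and> {v, x, y} \<notin> E}))"
  have q_sum: "q v = (\<Sum>y\<in>D. real (card (N v y \<inter> D)))" for v
  proof -
    have "{x \<in> D. {v, x, y} \<in> E} = N v y \<inter> D" for y by (auto simp: N_def insert_commute)
    then show ?thesis using card_pairs_eq_sum[OF fin(2,2), of "\<lambda>x y. {v, x, y} \<in> E"] by (simp add: q_def)
  qed
  have q_good: "q b \<le> 2 * (t * n)" if "b \<in> D - X" for b
  proof -
    have "q b \<le> (\<Sum>y\<in>D. (if y \<in> bad b then n else 0) + t)"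
      unfolding q_sum
    proof (rule sum_mono)
      fix y assume "y \<in> D"
      moreover have "real (card (N b y \<inter> D)) \<le> n" using fin(3) by (intro le_n) auto
      ultimately show "real (card (N b y \<inter> D)) \<le> (if y \<in> bad b then n else 0) + t"
        using t(1) by (auto simp: bad_def)
    qed
    also have "\<dots> = card (bad b) * n + card D * t"
      by (rule sum_if_plus[OF fin(2)]) (auto simp: bad_def)
    also have "\<dots> \<le> t * n + n * t"
      using that le_n[OF fin(3)] t n by (intro add_mono mult_right_mono) (auto simp: X_def)
    finally show ?thesis by (simp add: mult.commute)
  qed
  have total: "(\<Sum>v\<in>A0. miss v) \<le> 5 * (t * n\<^sup>2)"
  proof -
    have "(\<Sum>v\<in>A0. miss v) = real (\<Sum>v\<in>A0. card {p \<in> D \<times> D. {v, fst p, snd p} \<notin> E})"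
      unfolding miss_def of_nat_sum by (intro sum.cong arg_cong[of _ _ "\<lambda>S. real (card S)"]) auto
    also have "\<dots> = real (\<Sum>p\<in>D \<times> D. card {v \<in> A0. {v, fst p, snd p} \<notin> E})"
      using sum_card_swap[of A0 "D \<times> D" "\<lambda>v p. {v, fst p, snd p} \<notin> E"] fin by simp
    also have "\<dots> = (\<Sum>x\<in>D. \<Sum>y\<in>D. real (card {v \<in> A0. {v, x, y} \<notin> E}))"
      by (simp add: sum.cartesian_product split_def)
    also have "\<dots> \<le> (\<Sum>x\<in>D. (if x \<in> X then n * n else 0) + 4 * (t * n))"
    proof (rule sum_mono)
      fix x assume x: "x \<in> D"
      have c_le: "real (card {v \<in> A0. {v, x, y} \<notin> E}) \<le> n" for y using A0(1) by (intro le_n) auto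
      show "(\<Sum>y\<in>D. real (card {v \<in> A0. {v, x, y} \<notin> E})) \<le> (if x \<in> X then n * n else 0) + 4 * (t * n)"
      proof (cases "x \<in> X")
        case True
        have "(\<Sum>y\<in>D. real (card {v \<in> A0. {v, x, y} \<notin> E})) \<le> (\<Sum>y\<in>D. n)" by (intro sum_mono c_le)
        also have "\<dots> \<le> n * n" using le_n[OF fin(3)] n by (simp add: mult_right_mono)
        finally show ?thesis using True tn0 by simp
      next
        case False
        \<comment> \<open>The diagonal \<open>y = x\<close>, where no codegree bound holds, is
          counted as bad. For any other \<open>y\<close> outside \<open>bad x\<close> fewer than
          \<open>t\<close> neighbours are lost to \<open>D\<close>, and \<open>A0\<close> exceeds
          \<open>n / 3\<close> by at most \<open>t\<close>, which makes
          \<open>2 * t\<close>.\<close>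
        have "(\<Sum>y\<in>D. real (card {v \<in> A0. {v, x, y} \<notin> E})) \<le> (\<Sum>y\<in>D. (if y \<in> insert x (bad x) then n else 0) + 2 * t)"
        proof (rule sum_mono)
          fix y assume y: "y \<in> D"
          show "real (card {v \<in> A0. {v, x, y} \<notin> E}) \<le> (if y \<in> insert x (bad x) then n else 0) + 2 * t"
          proof (cases "y \<in> insert x (bad x)")
            case True
            then show ?thesis using c_le[of y] t(1) by simp
          next
            case False
            then have "y \<noteq> x" "card (N x y \<inter> D) < t" using y by (auto simp: bad_def)
            moreover have "n / 3 \<le> card (N x y)" using codeg[of x y] x y fin(3) False by (auto simp: n_def)
            moreover have "N x y = (N x y \<inter> A0) \<union> (N x y \<inter> D)" using N_subset[of x y] fin(5) by auto
            then have "card (N x y) \<le> card (N x y \<inter> A0) + card (N x y \<inter> D)" by (metis card_Un_le)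
            moreover have "card A0 = card (A0 \<inter> N x y) + card (A0 - N x y)" by (rule card_Int_Diff[OF fin(1)])
            moreover have "{v \<in> A0. {v, x, y} \<notin> E} = A0 - N x y" by (auto simp: N_def insert_commute)
            moreover have "A0 \<inter> N x y = N x y \<inter> A0" by auto
            ultimately have "real (card {v \<in> A0. {v, x, y} \<notin> E}) \<le> 2 * t" using A0(3) by simp
            then show ?thesis using False by simp
          qed
        qed
        also have "\<dots> = card (insert x (bad x)) * n + card D * (2 * t)"
          by (rule sum_if_plus[OF fin(2)]) (use x in \<open>auto simp: bad_def\<close>)
        also have "\<dots> \<le> (2 * t) * n + n * (2 * t)"
        proof (intro add_mono mult_right_mono)
          have "real (card (bad x)) < t" using False x by (auto simp: X_def)
          then show "real (card (insert x (bad x))) \<le> 2 * t"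
            using card_Un_le[of "{x}" "bad x"] t(1) by simp
        qed (use le_n[OF fin(3)] t n in auto)
        also have "\<dots> = 4 * (t * n)" by (simp add: mult.commute)
        finally show ?thesis using False by simp
      qed
    qed
    also have "\<dots> = card X * (n * n) + card D * (4 * (t * n))"
      by (rule sum_if_plus[OF fin(2)]) (auto simp: X_def)
    also have "\<dots> \<le> t * (n * n) + n * (4 * (t * n))"
      using cX le_n[OF fin(3)] t n by (intro add_mono mult_right_mono) auto
    finally show ?thesis by (simp add: power2_eq_square mult_ac)
  qed
  \<comment> \<open>Markov's inequality: the factor 30000 is 5 from \<open>total\<close> times 6000
    from the threshold.\<close>
  have few_miss: "real (card {v \<in> A0. n\<^sup>2 / 6000 \<le> miss v}) \<le> 30000 * t"
  proof -
    define F where "F = {v \<in> A0. n\<^sup>2 / 6000 \<le> miss v}"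
    have "card F * (n\<^sup>2 / 6000) = (\<Sum>v\<in>F. n\<^sup>2 / 6000)" by simp
    also have "\<dots> \<le> (\<Sum>v\<in>F. miss v)" by (rule sum_mono) (simp add: F_def)
    also have "\<dots> \<le> (\<Sum>v\<in>A0. miss v)" using fin by (intro sum_mono2) (auto simp: F_def miss_def)
    finally have "card F * n\<^sup>2 \<le> (30000 * t) * n\<^sup>2" using total by simp
    then show ?thesis unfolding F_def[symmetric] by (rule mult_right_le_imp_le) (use n in simp)
  qed
  define A where "A = {v \<in> V. n\<^sup>2 / 12000 \<le> q v}"
  define B where "B = V - A"
  define Q where "Q = {a \<in> A. a \<notin> A0 \<or> n\<^sup>2 / 6000 \<le> miss a}"
  have tn: "t * n = n\<^sup>2 / 10 ^ 11" by (simp add: t(2) power2_eq_square)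
  have n2: "10 ^ 22 \<le> n\<^sup>2" using power_mono[OF n, of 2] by simp
  have A_X: "A - A0 \<subseteq> X"
  proof
    fix v assume v: "v \<in> A - A0"
    then have "v \<in> D" by (auto simp: D_def A_def)
    show "v \<in> X"
    proof (rule ccontr)
      assume "v \<notin> X"
      then have "n\<^sup>2 / 12000 \<le> 2 * (t * n)" using q_good[of v] v \<open>v \<in> D\<close> by (auto simp: A_def)
      then show False using n2 unfolding tn by simp
    qed
  qed
  have fX: "finite X" using fin by (simp add: X_def)
  have cAA0: "real (card (A - A0)) \<le> t" using card_mono[OF fX A_X] cX by linarith
  \<comment> \<open>\<open>q v\<close> and \<open>miss v\<close> add up to the square of
    \<open>card D\<close>, so a vertex in few edges with pairs of \<open>D\<close> misses many of
    these pairs.\<close>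
  have "A0 - A \<subseteq> {v \<in> A0. n\<^sup>2 / 6000 \<le> miss v}"
  proof
    fix v assume v: "v \<in> A0 - A"
    then have qv: "q v < n\<^sup>2 / 12000" using A0(1) by (auto simp: A_def)
    have "6/10 * n \<le> card D" using cD A0(3) t n by simp
    then have "(6/10 * n)\<^sup>2 \<le> (real (card D))\<^sup>2" using n by (intro power_mono) auto
    also have "(real (card D))\<^sup>2 = real (card (D \<times> D))" by (simp add: card_cartesian_product power2_eq_square)
    also have "D \<times> D = {(x, y). x \<in> D \<and> y \<in> D \<and> {v, x, y} \<in> E} \<union> {(x, y). x \<in> D \<and> y \<in> D \<and> {v, x, y} \<notin> E}" by auto
    also have "real (card \<dots>) \<le> q v + miss v"
      unfolding q_def miss_def by (rule order_trans[OF of_nat_mono[OF card_Un_le]]) simp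
    finally have "36 / 100 * n\<^sup>2 \<le> q v + miss v" by (simp add: power_mult_distrib power_divide)
    then show "v \<in> {v \<in> A0. n\<^sup>2 / 6000 \<le> miss v}" using v qv n2 by simp
  qed
  then have cA0A: "real (card (A0 - A)) \<le> 30000 * t"
    using card_mono[of "{v \<in> A0. n\<^sup>2 / 6000 \<le> miss v}" "A0 - A"] few_miss fin by auto
  have BD: "B - D = A0 - A" "D - B \<subseteq> A - A0" using A0(1) by (auto simp: B_def D_def A_def)
  have AV: "A \<subseteq> V" "B \<subseteq> V" "finite A" using finite_V by (auto simp: A_def B_def)
  have cDB: "real (card (D - B)) \<le> t" using card_mono[OF finite_Diff[OF AV(3)] BD(2)] cAA0 by linarith
  have change: "real (card {(x, y). x \<in> S \<and> y \<in> T \<and> P x y})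
    \<le> real (card {(x, y). x \<in> S' \<and> y \<in> T' \<and> P x y}) + s * n + s' * n"
    if "S \<subseteq> V" "T \<subseteq> V" "S' \<subseteq> V" "T' \<subseteq> V" "card (S - S') \<le> s" "card (T - T') \<le> s'" for S T S' T' :: "'a set" and s s' :: real and P
  proof -
    have "{(x, y). x \<in> S' \<and> y \<in> T' \<and> x \<in> V \<and> y \<in> V \<and> P x y} = {(x, y). x \<in> S' \<and> y \<in> T' \<and> P x y}"
      using that by auto
    then have "card {(x, y). x \<in> S \<and> y \<in> T \<and> P x y}
      \<le> card {(x, y). x \<in> S' \<and> y \<in> T' \<and> P x y} + card (S - S') * card V + card (T - T') * card V"
      using card_pairs_change_le[OF finite_V that(1,2), of P S' T'] by simp
    then have "real (card {(x, y). x \<in> S \<and> y \<in> T \<and> P x y})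
      \<le> real (card {(x, y). x \<in> S' \<and> y \<in> T' \<and> P x y} + card (S - S') * card V + card (T - T') * card V)"
      by (rule of_nat_mono)
    also have "\<dots> = real (card {(x, y). x \<in> S' \<and> y \<in> T' \<and> P x y}) + real (card (S - S')) * n + real (card (T - T')) * n"
      by (simp add: n_def)
    also have "\<dots> \<le> real (card {(x, y). x \<in> S' \<and> y \<in> T' \<and> P x y}) + s * n + s' * n"
      using that n by (intro add_mono mult_right_mono) auto
    finally show ?thesis .
  qed
  \<comment> \<open>The thresholds 1/12000 for \<open>q\<close> and 1/6000 for \<open>miss\<close>
    leave room below 1/3000 for exchanging about \<open>30000 * t\<close> vertices. The third
    parameter loses \<open>2 * \<epsilon>\<close> because up to \<open>t\<close> vertices of
    \<open>D\<close> are outside \<open>B\<close>, and the last one bounds both the size of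
    \<open>Q\<close> and the difference between \<open>card A\<close> and
    \<open>n / 3\<close>.\<close>
  interpret near_extremal V E A B Q "1/3000" "1/12000 - 2 * \<epsilon>" "60000 * \<epsilon>"
  proof
    show "A \<union> B = V" "A \<inter> B = {}" "Q \<subseteq> A" using AV by (auto simp: B_def Q_def)
    have "card A = card (A \<inter> A0) + card (A - A0)" by (rule card_Int_Diff[OF AV(3)])
    moreover have "card A0 = card (A0 \<inter> A) + card (A0 - A)" by (rule card_Int_Diff[OF fin(1)])
    moreover have "A \<inter> A0 = A0 \<inter> A" by auto
    ultimately have "real (card A) + card (A0 - A) = real (card A0) + card (A - A0)" by simp
    then have "\<bar>real (card A) - n / 3\<bar> \<le> 60000 * t" using A0 cAA0 cA0A t(1) by (intro abs_leI) linarith+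
    then show "\<bar>real (card A) - real (card V) / 3\<bar> \<le> 60000 * \<epsilon> * real (card V)"
      by (simp add: n_def t_def mult.assoc)
    have "Q \<subseteq> (A - A0) \<union> {v \<in> A0. n\<^sup>2 / 6000 \<le> miss v}" by (auto simp: Q_def)
    then have "card Q \<le> card ((A - A0) \<union> {v \<in> A0. n\<^sup>2 / 6000 \<le> miss v})"
      using AV fin by (intro card_mono) auto
    also have "\<dots> \<le> card (A - A0) + card {v \<in> A0. n\<^sup>2 / 6000 \<le> miss v}" by (rule card_Un_le)
    finally have "real (card Q) \<le> 60000 * t" using cAA0 few_miss t(1) by simp
    then show "real (card Q) \<le> 60000 * \<epsilon> * real (card V)" by (simp add: n_def t_def mult.assoc)
  next
    fix b assume b: "b \<in> B"
    have qb: "q b < n\<^sup>2 / 12000" using b by (auto simp: B_def A_def)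
    have "card {(x, a). x \<in> B \<and> a \<in> A \<and> {b, x, a} \<notin> E}
      \<le> real (card {(x, a). x \<in> D \<and> a \<in> A0 \<and> {b, x, a} \<notin> E}) + 30000 * t * n + t * n"
      by (rule change) (use AV fin A0 BD cA0A cAA0 in auto)
    also have "real (card {(x, a). x \<in> D \<and> a \<in> A0 \<and> {b, x, a} \<notin> E}) = (\<Sum>x\<in>D. real (card {a \<in> A0. {b, x, a} \<notin> E}))"
      using card_pairs_eq_sum[OF fin(2,1), of "\<lambda>a x. {b, x, a} \<notin> E"] card_pairs_swap[of D A0 "\<lambda>x a. {b, x, a} \<notin> E"]
      by simp
    also have "\<dots> \<le> (\<Sum>x\<in>D. (if x = b then n else 0) + (t + card (N b x \<inter> D)))"
    proof (rule sum_mono)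
      fix x assume x: "x \<in> D"
      show "real (card {a \<in> A0. {b, x, a} \<notin> E}) \<le> (if x = b then n else 0) + (t + card (N b x \<inter> D))"
      proof (cases "x = b")
        case True
        have "real (card {a \<in> A0. {b, x, a} \<notin> E}) \<le> n" using A0(1) by (intro le_n) auto
        then show ?thesis using True t(1) by simp
      next
        case False
        have "n / 3 \<le> card (N b x)" using codeg[of b x] x b AV fin(3) False by (auto simp: n_def)
        moreover have "N b x = (N b x \<inter> A0) \<union> (N b x \<inter> D)" using N_subset[of b x] fin(5) by auto
        then have "card (N b x) \<le> card (N b x \<inter> A0) + card (N b x \<inter> D)" by (metis card_Un_le)
        moreover have "card A0 = card (A0 \<inter> N b x) + card (A0 - N b x)" by (rule card_Int_Diff[OF fin(1)])
        moreover have "{a \<in> A0. {b, x, a} \<notin> E} = A0 - N b x" by (auto simp: N_def)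
        moreover have "A0 \<inter> N b x = N b x \<inter> A0" by auto
        ultimately show ?thesis using A0(3) False by simp
      qed
    qed
    also have "\<dots> = (\<Sum>x\<in>D. if x = b then n else 0) + (card D * t + q b)"
      unfolding q_sum by (simp add: sum.distrib)
    also have "\<dots> \<le> n + (n * t + q b)"
      using le_n[OF fin(3)] t n fin(2) by (intro add_mono mult_right_mono) (auto simp: sum.delta)
    also have "n + (n * t + q b) \<le> t * n + (n * t + q b)" using t(1) n by simp
    finally have "card {(x, a). x \<in> B \<and> a \<in> A \<and> {b, x, a} \<notin> E} \<le> 30003 * (t * n) + q b"
      by (simp add: algebra_simps)
    also have "\<dots> \<le> n\<^sup>2 / 3000" using qb n2 unfolding tn by simp
    finally show "real (card {(x, a). x \<in> B \<and> a \<in> A \<and> {b, x, a} \<notin> E}) \<le> 1 / 3000 * (real (card V))\<^sup>2"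
      by (simp add: n_def)
  next
    fix a assume a: "a \<in> A - Q"
    then have ma: "miss a < n\<^sup>2 / 6000" by (auto simp: Q_def)
    have "card {(x, y). x \<in> B \<and> y \<in> B \<and> {a, x, y} \<notin> E} \<le> miss a + 30000 * t * n + 30000 * t * n"
      unfolding miss_def by (rule change) (use AV fin BD cA0A in auto)
    also have "\<dots> = miss a + 60000 * (t * n)" by simp
    also have "\<dots> \<le> n\<^sup>2 / 3000" using ma n2 unfolding tn by simp
    finally show "real (card {(x, y). x \<in> B \<and> y \<in> B \<and> {a, x, y} \<notin> E}) \<le> 1 / 3000 * (real (card V))\<^sup>2"
      by (simp add: n_def)
  next
    fix v assume v: "v \<in> Q"
    then have "n\<^sup>2 / 12000 \<le> q v" by (auto simp: Q_def A_def)
    also have "q v \<le> real (card {(x, y). x \<in> B \<and> y \<in> B \<and> {v, x, y} \<in> E}) + t * n + t * n"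
      unfolding q_def by (rule change) (use AV fin cDB in auto)
    finally have "n\<^sup>2 / 12000 \<le> card {(x, y). x \<in> B \<and> y \<in> B \<and> {v, x, y} \<in> E} + t * n + t * n" .
    then have "(1 / 12000 - 2 * \<epsilon>) * n\<^sup>2 \<le> card {(x, y). x \<in> B \<and> y \<in> B \<and> {v, x, y} \<in> E}"
      unfolding tn \<epsilon>_def by (simp add: field_simps)
    then show "(1 / 12000 - 2 * \<epsilon>) * (real (card V))\<^sup>2 \<le> card {(x, y). x \<in> B \<and> y \<in> B \<and> {v, x, y} \<in> E}"
      by (simp add: n_def)
  next
    show "10000 \<le> card V" using big(1) by simp
    show "6 dvd card V" by (rule big(2))
    show "1 \<le> 60000 * \<epsilon> * card V" using t(1) by (simp add: t_def n_def)
  qed (simp_all add: \<epsilon>_def)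
  show ?thesis by (rule tileable_V)
qed

end

section \<open>Conclusion\<close>

context codegree_third begin

text \<open>The largest possible \<open>Y\<close> in \<open>dense_in\<close> for the complement of
  \<open>N a b\<close>; \<open>outer_set\<close> is the corresponding \<open>X\<close>. Being
  determined by at most three vertices, these witnesses are polynomially many and can all be
  tracked.\<close>

definition inner_set :: "real \<Rightarrow> 'a \<Rightarrow> 'a \<Rightarrow> 'a \<Rightarrow> 'a set" where
  "inner_set t a b x = {y \<in> V - N a b. t \<le> card (N x y \<inter> (V - N a b))}"

definition outer_set :: "real \<Rightarrow> 'a \<Rightarrow> 'a \<Rightarrow> 'a set" where
  "outer_set t a b = {x \<in> V - N a b. t \<le> card (inner_set t a b x)}"

definition tracked :: "real \<Rightarrow> 'a set set" where
  "tracked t = {V} \<union> (\<lambda>(a, b). N a b) ` (V \<times> V) \<union> (\<lambda>(a, b). outer_set t a b) ` (V \<times> V) \<union>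
     (\<lambda>(a, b, x). inner_set t a b x) ` (V \<times> V \<times> V) \<union>
     (\<lambda>(a, b, x, y). N x y \<inter> (V - N a b)) ` (V \<times> V \<times> V \<times> V)"

lemma tracked_subset: "F \<in> tracked t \<Longrightarrow> F \<subseteq> V"
  by (auto simp: tracked_def inner_set_def outer_set_def dest: N_memD)

lemma N_inter_tracked:
  assumes "a \<in> V" "b \<in> V" "x \<in> V" "y \<in> V"
  shows "N x y \<inter> (V - N a b) \<in> tracked t"
proof -
  have "(\<lambda>(a, b, x, y). N x y \<inter> (V - N a b)) (a, b, x, y) \<in>
    (\<lambda>(a, b, x, y). N x y \<inter> (V - N a b)) ` (V \<times> V \<times> V \<times> V)"
    by (rule imageI) (simp add: assms)
  then show ?thesis unfolding tracked_def by simp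
qed

lemma finite_tracked: "finite (tracked t)"
  using finite_V by (auto simp: tracked_def)

lemma card_tracked:
  assumes "1 \<le> card V"
  shows "card (tracked t) \<le> 5 * card V ^ 4"
proof -
  define m where "m = card V"
  have m: "1 \<le> m" using assms by (simp add: m_def)
  have p: "m * m \<le> m ^ 4" "m * (m * m) \<le> m ^ 4" "m * (m * (m * m)) \<le> m ^ 4" "1 \<le> m ^ 4"
    using m power_increasing[of 2 4 m] power_increasing[of 3 4 m] one_le_power[OF m, of 4]
    by (simp_all add: power2_eq_square power3_eq_cube power4_eq_xxxx mult_ac)
  define A where "A = (\<lambda>(a, b). N a b) ` (V \<times> V)"
  define B where "B = (\<lambda>(a, b). outer_set t a b) ` (V \<times> V)"
  define C where "C = (\<lambda>(a, b, x). inner_set t a b x) ` (V \<times> V \<times> V)"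
  define D where "D = (\<lambda>(a, b, x, y). N x y \<inter> (V - N a b)) ` (V \<times> V \<times> V \<times> V)"
  have "card A \<le> card (V \<times> V)" "card B \<le> card (V \<times> V)" "card C \<le> card (V \<times> V \<times> V)"
    "card D \<le> card (V \<times> V \<times> V \<times> V)"
    unfolding A_def B_def C_def D_def using finite_V by (simp_all only: card_image_le finite_cartesian_product)
  then have "card A \<le> m ^ 4" "card B \<le> m ^ 4" "card C \<le> m ^ 4" "card D \<le> m ^ 4"
    using p by (simp_all add: card_cartesian_product m_def)
  moreover have "tracked t = {V} \<union> A \<union> B \<union> C \<union> D"
    by (simp add: tracked_def A_def B_def C_def D_def)
  ultimately show ?thesis
    using card_Un_le[of "{V} \<union> A \<union> B \<union> C" D] card_Un_le[of "{V} \<union> A \<union> B" C]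
      card_Un_le[of "{V} \<union> A" B] card_Un_le[of "{V}" A] p(4) by (simp add: m_def)
qed

lemma dense_in_outer_set:
  assumes "dense_in (V - N a b) t"
  shows "t \<le> card (outer_set t a b)"
proof -
  obtain X where X: "X \<subseteq> V - N a b" "t \<le> card X"
    and XY: "\<And>x. x \<in> X \<Longrightarrow> \<exists>Y\<subseteq>V - N a b. t \<le> card Y \<and> (\<forall>y\<in>Y. t \<le> card (N x y \<inter> (V - N a b)))"
    using assms unfolding dense_in_def by blast
  have "x \<in> outer_set t a b" if x: "x \<in> X" for x
  proof -
    obtain Y where Y: "Y \<subseteq> V - N a b" "t \<le> card Y" "\<forall>y\<in>Y. t \<le> card (N x y \<inter> (V - N a b))"
      using XY[OF x] by blast
    then have "Y \<subseteq> inner_set t a b x" by (auto simp: inner_set_def)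
    then have "card Y \<le> card (inner_set t a b x)"
      using finite_V by (intro card_mono) (auto simp: inner_set_def)
    then show ?thesis using X x Y(2) by (auto simp: outer_set_def)
  qed
  then have "card X \<le> card (outer_set t a b)"
    using finite_V by (intro card_mono) (auto simp: outer_set_def)
  then show ?thesis using X(2) by linarith
qed

text \<open>Removing \<open>W\<close> and running the greedy process cost \<open>g / 2\<close> each,
  so a tracked set loses at most \<open>g\<close> of its proportion in \<open>V\<close>. A
  neighbourhood of proportion at most \<open>1/3 + 2 * g\<close> in \<open>U\<close> therefore has
  at most \<open>1/3 + 3 * g\<close> in \<open>V\<close>, and \<open>rich\<close> applies to it.
  Sets of proportion \<open>\<epsilon>\<close> retain \<open>\<epsilon> / 2\<close>, so the density
  of the complement passes to \<open>U\<close>.\<close>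

lemma almost_perfect_tiling:
  fixes \<epsilon> g \<sigma> del lam :: real and K :: nat
  assumes g: "0 < g" "100 * g \<le> \<epsilon>" "\<epsilon> \<le> 1"
    and W: "W \<subseteq> V" "card W \<le> g / 2 * card V"
    and rich: "\<And>a b. a \<in> V \<Longrightarrow> b \<in> V \<Longrightarrow> a \<noteq> b \<Longrightarrow> card (N a b) \<le> (1/3 + \<epsilon>) * card V \<Longrightarrow>
      dense_in (V - N a b) (\<epsilon> * card V)"
    and par: "0 < lam" "0 < \<sigma>" "del = \<sigma> * g / 8"
    and big: "12 \<le> \<sigma> * n'" "12 * lam \<le> \<sigma> * n'" "100 \<le> \<sigma> * n'" "5 \<le> 10 * g * (\<sigma> * n')"
      "80 * n' ^ 4 * exp (lam * g / 4 + 144 * lam\<^sup>2 / (\<sigma>\<^sup>2 * n')) < exp (lam * g / 2)"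
    and K: "2 \<le> K" "8 \<le> g * (real K - 1)" "K \<le> g * (\<sigma> * n')" "6 * K < del * (\<sigma> * n' - K)"
    and n': "n' = real (card (V - W))"
  shows "\<exists>U\<subseteq>V - W. card U < \<sigma> * n' \<and> tileable (V - W - U)"
proof -
  define n where "n = real (card V)"
  define t where "t = \<epsilon> * n"
  define FF where "FF = (\<lambda>F. F - W) ` tracked t"
  have n'0: "0 < n'" using big(1) par(2) zero_less_mult_pos[of \<sigma> n'] by linarith
  have n'n: "n' \<le> n" using finite_V card_mono[of V "V - W"] by (simp add: n' n_def)
  have n0: "0 < n" using n'0 n'n by linarith
  have "card V - card W \<le> card (V - W)" using finite_V W finite_subset by (intro diff_card_le_card_Diff) blast
  moreover have "g / 2 * n \<le> 1 / 2 * n" using g n0 by (intro mult_right_mono) auto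
  ultimately have nn': "n \<le> 2 * n'" using W(2) unfolding n' n_def by linarith
  have fFF: "finite FF" using finite_tracked by (simp add: FF_def)
  have "card FF \<le> card (tracked t)" unfolding FF_def by (rule card_image_le[OF finite_tracked])
  then have "card FF \<le> 5 * card V ^ 4" using card_tracked[of t] n0 unfolding n_def by simp
  then have "real (card FF) \<le> 5 * n ^ 4" unfolding n_def by (metis of_nat_mono of_nat_mult of_nat_numeral of_nat_power)
  also have "\<dots> \<le> 5 * (2 * n') ^ 4" using nn' n0 by (intro mult_left_mono power_mono) auto
  finally have cFF: "real (card FF) \<le> 80 * n' ^ 4" by (simp add: power_mult_distrib)
  have "\<exists>U\<subseteq>V - W. card U < \<sigma> * real (card (V - W)) \<and> tileable (V - W - U)"
  proof (rule tracked_greedy_tiling[where FF = FF and lam = lam and del = del and \<gamma> = "g / 2"])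
    show "finite FF" by (rule fFF)
    show "V - W \<in> FF" by (auto simp: FF_def tracked_def)
    show "finite (V - W)" using finite_V by simp
    show "0 < lam" "0 < \<sigma>" by fact+
    show "0 \<le> del" unfolding par(3) using par(2) g(1) by simp
    show "12 \<le> \<sigma> * real (card (V - W))" "12 * lam \<le> \<sigma> * real (card (V - W))" using big n' by simp_all
    \<comment> \<open>With this \<open>del\<close> the drift takes up half of the available exponent
      \<open>lam * g / 2\<close>. The other half has to absorb the number of tracked sets, at most
      \<open>80 * n' ^ 4\<close>, and the second-order term.\<close>
    have e: "2 * lam * del / \<sigma> = lam * g / 4" unfolding par(3) using par(2) by simp
    have "real (card FF) * exp (lam * g / 4 + 144 * lam\<^sup>2 / (\<sigma>\<^sup>2 * n'))
      \<le> 80 * n' ^ 4 * exp (lam * g / 4 + 144 * lam\<^sup>2 / (\<sigma>\<^sup>2 * n'))"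
      using cFF by (intro mult_right_mono) auto
    also have "\<dots> < exp (lam * (g / 2))" using big(5) by simp
    finally show "real (card FF) * exp (2 * lam * del / \<sigma> + 144 * lam\<^sup>2 / (\<sigma>\<^sup>2 * real (card (V - W))))
      < exp (lam * (g / 2))" unfolding n'[symmetric] e .
    show "F \<subseteq> V - W" if "F \<in> FF" for F using that tracked_subset by (auto simp: FF_def)
  next
    fix U :: "'a set" and c :: "'a \<Rightarrow> real"
    assume U: "U \<subseteq> V - W" and bigU: "\<sigma> * real (card (V - W)) \<le> card U"
      and track: "\<And>F. F \<in> FF \<Longrightarrow> card F / real (card (V - W)) - g / 2 \<le> card (F \<inter> U) / card U"
      and c: "\<And>v. v \<in> U \<Longrightarrow> 0 \<le> c v" "0 < sum c U"
    define M where "M = real (card U)"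
    have bigM: "\<sigma> * n' \<le> M" using bigU by (simp add: M_def n')
    then have M0: "0 < M" using big(1) by linarith
    have tr: "(card F / n - g) * M \<le> card (F \<inter> U)" if F: "F \<in> tracked t" for F
    proof -
      have "F - W \<in> FF" using F by (simp add: FF_def)
      note this[THEN track]
      moreover have "(F - W) \<inter> U = F \<inter> U" using U by auto
      ultimately have 1: "card (F - W) / n' - g / 2 \<le> card (F \<inter> U) / M" by (simp add: n' M_def)
      have fW: "finite W" using W finite_V finite_subset by blast
      have "card F \<le> card (F - W) + card W" using diff_card_le_card_Diff[OF fW, of F] by linarith
      then have "card F / n \<le> (card (F - W) + card W) / n" using n0 by (intro divide_right_mono) auto
      also have "\<dots> = card (F - W) / n + card W / n" by (simp add: add_divide_distrib)
      also have "\<dots> \<le> card (F - W) / n' + g / 2"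
      proof (rule add_mono)
        show "card (F - W) / n \<le> card (F - W) / n'" using n'n n'0 by (intro divide_left_mono) auto
        show "card W / n \<le> g / 2" using W(2) n0 by (simp add: n_def field_simps)
      qed
      finally have "card F / n - g \<le> card (F \<inter> U) / M" using 1 by linarith
      then show ?thesis using M0 by (simp add: pos_le_divide_eq)
    qed
    have UV: "U \<subseteq> V" using U by auto
    show "\<exists>T. tile T \<and> T \<subseteq> U \<and> sum c T \<le> (6 + del) * sum c U / card U"
    proof (rule light_tile[OF UV g(1) _ _ _ K(1,2) _ _ _ _ c])
      show "g \<le> 1 / 100" "40 * g \<le> \<epsilon> / 2" using g by simp_all
      show "0 < del" unfolding par(3) using par(2) g(1) by simp
      show "K \<le> g * real (card U)"
        using order_trans[OF K(3) mult_left_mono[OF bigM, of g]] g(1) by (simp add: M_def)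
      show "100 \<le> card U" using big(3) bigM by (simp add: M_def)
      show "5 \<le> 10 * g * real (card U)"
        using order_trans[OF big(4) mult_left_mono[OF bigM, of "10 * g"]] g(1) by (simp add: M_def)
      have "del * (\<sigma> * n' - K) \<le> del * (M - K)"
        unfolding par(3) using bigM par(2) g(1) by (intro mult_left_mono) auto
      then show "6 * K < del * (real (card U) - K)" using K(4) by (simp add: M_def)
    next
      fix a b assume ab: "a \<in> U" "b \<in> U" "a \<noteq> b"
      have abV: "a \<in> V" "b \<in> V" using ab UV by auto
      have N: "N a b \<in> tracked t" using abV by (force simp: tracked_def)
      have "1 / 3 \<le> card (N a b) / n" using codeg[OF abV ab(3)] n0 by (simp add: n_def field_simps)
      then have "(1 / 3 - g) * M \<le> (card (N a b) / n - g) * M" using M0 by (intro mult_right_mono) auto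
      also have "\<dots> \<le> card (N a b \<inter> U)" by (rule tr[OF N])
      finally show "(1 / 3 - g) * real (card U) \<le> card (N a b \<inter> U)" by (simp add: M_def)
      assume small: "card (N a b \<inter> U) \<le> (1 / 3 + 2 * g) * real (card U)"
      then have "(card (N a b) / n - g) * M \<le> (1 / 3 + 2 * g) * M" using tr[OF N] by (simp add: M_def)
      then have "card (N a b) / n - g \<le> 1 / 3 + 2 * g" using M0 by simp
      then have "card (N a b) / n \<le> 1 / 3 + \<epsilon>" using g by linarith
      then have "card (N a b) \<le> (1 / 3 + \<epsilon>) * n" using n0 by (simp add: pos_divide_le_eq)
      then have dense: "dense_in (V - N a b) t" using rich abV ab(3) by (simp add: n_def t_def)
      have half: "\<epsilon> / 2 * M \<le> card (F \<inter> U)" if F: "F \<in> tracked t" "t \<le> card F" for F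
      proof -
        have "\<epsilon> \<le> card F / n" using F(2) n0 by (simp add: t_def field_simps)
        then have "\<epsilon> / 2 \<le> card F / n - g" using g by linarith
        then have "\<epsilon> / 2 * M \<le> (card F / n - g) * M" using M0 by (intro mult_right_mono) auto
        then show ?thesis using tr[OF F(1)] by linarith
      qed
      show "dense_in (U - N a b) (\<epsilon> / 2 * real (card U))"
        unfolding dense_in_def M_def[symmetric]
      proof (rule exI[of _ "outer_set t a b \<inter> U"], intro conjI ballI)
        show "outer_set t a b \<inter> U \<subseteq> U - N a b" by (auto simp: outer_set_def)
        have "outer_set t a b \<in> tracked t" using abV by (force simp: tracked_def)
        then show "\<epsilon> / 2 * M \<le> card (outer_set t a b \<inter> U)" using dense_in_outer_set[OF dense] by (rule half)
        fix x assume x: "x \<in> outer_set t a b \<inter> U"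
        show "\<exists>Y\<subseteq>U - N a b. \<epsilon> / 2 * M \<le> card Y \<and> (\<forall>y\<in>Y. \<epsilon> / 2 * M \<le> card (N x y \<inter> (U - N a b)))"
        proof (intro exI[of _ "inner_set t a b x \<inter> U"] conjI ballI)
          show "inner_set t a b x \<inter> U \<subseteq> U - N a b" by (auto simp: inner_set_def)
          have "inner_set t a b x \<in> tracked t" using abV x UV by (force simp: tracked_def)
          then show "\<epsilon> / 2 * M \<le> card (inner_set t a b x \<inter> U)" by (rule half) (use x in \<open>simp add: outer_set_def\<close>)
          fix y assume y: "y \<in> inner_set t a b x \<inter> U"
          have "N x y \<inter> (V - N a b) \<in> tracked t" using abV x y UV by (intro N_inter_tracked) auto
          then have "\<epsilon> / 2 * M \<le> card (N x y \<inter> (V - N a b) \<inter> U)" by (rule half) (use y in \<open>simp add: inner_set_def\<close>)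
          moreover have "N x y \<inter> (V - N a b) \<inter> U = N x y \<inter> (U - N a b)" using UV by auto
          ultimately show "\<epsilon> / 2 * M \<le> card (N x y \<inter> (U - N a b))" by simp
        qed
      qed
    qed
  qed
  then show ?thesis by (simp add: n')
qed

end

section \<open>Choice of the constants and combination of the cases\<close>

lemma tileable_if_codegree_third:
  "\<exists>n0::nat. \<forall>(V :: 'a set) E. codegree_third V E \<longrightarrow> n0 \<le> card V \<longrightarrow> 6 dvd card V \<longrightarrow> three_uniform.tileable E V"
proof -
  define \<epsilon> :: real where "\<epsilon> = 1 / 10 ^ 11"
  define g :: real where "g = \<epsilon> / 100"
  have g: "0 < g" "100 * g \<le> \<epsilon>" "\<epsilon> \<le> 1" "g \<le> 1" by (simp_all add: g_def \<epsilon>_def)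
  have g2: "0 < g / 2" using g by simp
  obtain \<sigma> :: real and n1 :: nat where \<sigma>: "0 < \<sigma>"
    and absorb: "\<And>(V :: 'a set) E. codegree_third V E \<Longrightarrow> n1 \<le> card V \<Longrightarrow>
      \<exists>W\<subseteq>V. card W \<le> g / 2 * card V \<and> three_uniform.tileable E W \<and>
      (\<forall>U\<subseteq>V - W. 6 dvd card U \<longrightarrow> card U \<le> \<sigma> * card V \<longrightarrow> three_uniform.tileable E (W \<union> U))"
    by (rule absorbing_set[OF g2, where 'a = 'a]) (rule that)
  define del where "del = \<sigma> * g / 8"
  have del: "0 < del" using \<sigma> g by (simp add: del_def)
  define K where "K = nat \<lceil>8 / g\<rceil> + 2"
  have "8 / g \<le> real K - 1" unfolding K_def by linarith
  then have K: "2 \<le> K" "8 \<le> g * (real K - 1)" using g by (simp_all add: K_def field_simps)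
  \<comment> \<open>Any fixed exponent strictly between 0 and 1 serves: the power outgrows
    \<open>ln n\<close>, and \<open>(lam n)\<^sup>2 / n\<close> stays small compared with
    \<open>lam n\<close>.\<close>
  define lam where "lam = (\<lambda>n::nat. real n powr (1/4))"
  have gs: "0 < g * \<sigma>" "0 < del * \<sigma>" using g \<sigma> del by simp_all
  have "eventually (\<lambda>n::nat. 0 < lam n) at_top" unfolding lam_def by real_asymp
  moreover have "eventually (\<lambda>n::nat. 12 \<le> \<sigma> * n) at_top" using \<sigma> by real_asymp
  moreover have "eventually (\<lambda>n::nat. 12 * lam n \<le> \<sigma> * n) at_top" unfolding lam_def using \<sigma> by real_asymp
  moreover have "eventually (\<lambda>n::nat. 100 \<le> \<sigma> * n) at_top" using \<sigma> by real_asymp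
  moreover have "eventually (\<lambda>n::nat. 5 \<le> 10 * (g * \<sigma>) * n) at_top" using gs by real_asymp
  moreover have "eventually (\<lambda>n::nat. 80 * real n ^ 4 * exp (lam n * g / 4 + 144 * (lam n)\<^sup>2 / (\<sigma>\<^sup>2 * n)) < exp (lam n * g / 2)) at_top"
    unfolding lam_def using \<sigma> g(1) by real_asymp
  moreover have "eventually (\<lambda>n::nat. K \<le> (g * \<sigma>) * n) at_top" using gs by real_asymp
  moreover have "eventually (\<lambda>n::nat. 6 * K + del * K < (del * \<sigma>) * n) at_top" using gs by real_asymp
  ultimately have "eventually (\<lambda>n::nat. 0 < lam n \<and> 12 \<le> \<sigma> * n \<and> 12 * lam n \<le> \<sigma> * n \<and> 100 \<le> \<sigma> * n \<and>
      5 \<le> 10 * (g * \<sigma>) * n \<and>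
      80 * real n ^ 4 * exp (lam n * g / 4 + 144 * (lam n)\<^sup>2 / (\<sigma>\<^sup>2 * n)) < exp (lam n * g / 2) \<and>
      K \<le> (g * \<sigma>) * n \<and> 6 * K + del * K < (del * \<sigma>) * n) at_top" (is "eventually ?P _")
    by eventually_elim blast
  then obtain n2 where n2: "\<And>n. n2 \<le> n \<Longrightarrow> ?P n"
    unfolding eventually_at_top_linorder by blast
  show ?thesis
  \<comment> \<open>At least half of the vertices remain outside the absorbing set, whence the
    factor 2 before \<open>n2\<close>; \<open>10 ^ 11\<close> is what the extremal case
    requires.\<close>
  proof (intro exI[of _ "max (10 ^ 11) (max n1 (2 * n2))"] allI impI)
    fix V :: "'a set" and E
    assume "codegree_third V E" and big: "max (10 ^ 11) (max n1 (2 * n2)) \<le> card V" and six: "6 dvd card V"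
    then interpret codegree_third V E by simp
    show "tileable V"
    proof (cases "\<exists>a\<in>V. \<exists>b\<in>V. a \<noteq> b \<and> card (N a b) \<le> (1/3 + \<epsilon>) * card V \<and> \<not> dense_in (V - N a b) (\<epsilon> * card V)")
      case True
      then show ?thesis using near_extremal_if_sparse big six unfolding \<epsilon>_def by auto
    next
      case False
      obtain W where W: "W \<subseteq> V" "card W \<le> g / 2 * card V" "tileable W"
        and ab: "\<And>U. U \<subseteq> V - W \<Longrightarrow> 6 dvd card U \<Longrightarrow> card U \<le> \<sigma> * card V \<Longrightarrow> tileable (W \<union> U)"
        using absorb[OF \<open>codegree_third V E\<close>] big by auto
      define n' where "n' = card (V - W)"
      have cV: "card V = card W + n'" using card_minus[OF finite_V, of W] W(1) by (simp add: n'_def Int_absorb2)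
      have "g / 2 * card V \<le> 1 / 2 * real (card V)" using g by (intro mult_right_mono) auto
      then have "card V \<le> 2 * n'" using W(2) cV by linarith
      then have "n2 \<le> n'" using big by simp
      note n2 = n2[OF this]
      have "\<exists>U\<subseteq>V - W. card U < \<sigma> * n' \<and> tileable (V - W - U)"
      proof (rule almost_perfect_tiling[OF g(1-3) W(1,2) _ _ \<sigma> del_def _ _ _ _ _ K])
        show "dense_in (V - N a b) (\<epsilon> * card V)"
          if "a \<in> V" "b \<in> V" "a \<noteq> b" "card (N a b) \<le> (1/3 + \<epsilon>) * card V" for a b
          using False that by blast
        show "0 < lam n'" "12 \<le> \<sigma> * real n'" "12 * lam n' \<le> \<sigma> * real n'" "100 \<le> \<sigma> * real n'"
          "80 * real n' ^ 4 * exp (lam n' * g / 4 + 144 * (lam n')\<^sup>2 / (\<sigma>\<^sup>2 * real n')) < exp (lam n' * g / 2)"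
          using n2 by blast+
        show "5 \<le> 10 * g * (\<sigma> * real n')" "real K \<le> g * (\<sigma> * real n')" using n2 by (simp_all add: mult_ac)
        show "real (6 * K) < del * (\<sigma> * real n' - real K)" using n2 by (simp add: algebra_simps)
        show "real n' = real (card (V - W))" by (simp add: n'_def)
      qed
      then obtain U where U: "U \<subseteq> V - W" "card U < \<sigma> * n'" "tileable (V - W - U)" by blast
      have "card U + card (V - W - U) = n'"
        using card_minus[of "V - W" U] finite_V U(1) by (simp add: n'_def Int_absorb2)
      then have "6 dvd card U"
        using six cV tileable_card[OF W(3)] tileable_card[OF U(3)] by (metis dvd_add_right_iff dvd_add_left_iff)
      moreover have "\<sigma> * n' \<le> \<sigma> * card V" using \<sigma> cV by (intro mult_left_mono) auto
      ultimately have "tileable (W \<union> U)" using U(1,2) by (intro ab) auto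
      then have "tileable ((W \<union> U) \<union> (V - W - U))" using U(3) by (rule tileable_Un) auto
      also have "(W \<union> U) \<union> (V - W - U) = V" using W(1) U(1) by auto
      finally show ?thesis .
    qed
  qed
qed

section \<open>From the minimum codegree to neighbourhoods of pairs\<close>

lemma codegree_third_if_min_codegree:
  assumes "three_graph H" "card (verts H) / 3 \<le> real (min_codegree H)"
  shows "codegree_third (verts H) (edges H)"
proof
  show "finite (verts H)" "edges H \<subseteq> nsets (verts H) 3" using assms(1) by (auto simp: three_graph_def)
  then interpret three_uniform "verts H" "edges H" by unfold_locales
  fix a b assume ab: "a \<in> verts H" "b \<in> verts H" "a \<noteq> b"
  have "{e \<in> edges H. {a, b} \<subseteq> e} = (\<lambda>x. {a, b, x}) ` N a b"
  proof (intro equalityI subsetI)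
    fix e assume e: "e \<in> {e \<in> edges H. {a, b} \<subseteq> e}"
    then have "card (e - {a, b}) = 1" using edge_card[of e] ab by (simp add: card_Diff_subset)
    then obtain x where "e - {a, b} = {x}" by (auto simp: card_1_singleton_iff)
    then have "e = {a, b, x}" using e by auto
    then show "e \<in> (\<lambda>x. {a, b, x}) ` N a b" using e by (auto simp: N_def)
  qed (auto simp: N_def)
  moreover have "inj_on (\<lambda>x. {a, b, x}) (N a b)"
  proof (rule inj_onI)
    fix x y assume "x \<in> N a b" "y \<in> N a b" "{a, b, x} = {a, b, y}"
    moreover from this have "x \<noteq> a" "x \<noteq> b" using edgeD[of a b x] by (auto simp: N_def)
    ultimately show "x = y" by auto
  qed
  ultimately have deg: "codegree H {a, b} = card (N a b)"
    unfolding codegree_def by (simp add: card_image)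
  have "{a, b} \<in> nsets (verts H) 2" using ab by (auto simp: nsets_def)
  moreover have "finite (nsets (verts H) 2)" using finite_V by (rule finite_imp_finite_nsets)
  ultimately have "min_codegree H \<le> codegree H {a, b}" unfolding min_codegree_def by (intro Min_le) auto
  then show "real (card (verts H)) / 3 \<le> real (card (three_uniform.N (edges H) a b))"
    using assms(2) deg by linarith
qed

theorem theorem1p1:
  shows "\<exists>n0 :: nat. \<forall>n \<ge> n0. 6 dvd n \<longrightarrow>
    (\<forall>H :: 'a hypergraph.
      three_graph H \<and> card (verts H) = n \<and> real (min_codegree H) \<ge> real n / 3
        \<longrightarrow> (\<exists>G. is_factor C63 H G))"
proof -
  obtain n0 where n0: "\<And>(V :: 'a set) E. codegree_third V E \<Longrightarrow> n0 \<le> card V \<Longrightarrow> 6 dvd card V \<Longrightarrow>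
      three_uniform.tileable E V"
    using tileable_if_codegree_third by blast
  show ?thesis
  proof (intro exI[of _ n0] allI impI)
    fix n :: nat and H :: "'a hypergraph"
    assume "n0 \<le> n" "6 dvd n" and H: "three_graph H \<and> card (verts H) = n \<and> real (min_codegree H) \<ge> real n / 3"
    then interpret codegree_third "verts H" "edges H" by (intro codegree_third_if_min_codegree) auto
    have "tileable (verts H)" using n0[OF codegree_third_axioms] H \<open>n0 \<le> n\<close> \<open>6 dvd n\<close> by auto
    from tileable_imp_factor[OF this] show "\<exists>G. is_factor C63 H G" by simp
  qed
qed

end
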